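(* Let $q>2$ and consider any $\mathbf r\in\mathcal X^s$ and the transition from $\mathbf r$ to $\mathcal X^s\setminus\{\mathbf r\}$ for the $q$-state Potts Metropolis dynamics on the $K\times L$ torus. Then (all unions being over $\mathbf t\in\mathcal X^s\setminus\{\mathbf r\}$): (a) $\lim_{\beta\to\infty}\mathbb P_\beta\big(\tau^{\mathbf r}_{\bigcup_{\mathbf t}\overline{\mathcal P}(\mathbf r,\mathbf t)}<\tau^{\mathbf r}_{\mathcal X^s\setminus\{\mathbf r\}}\big)=\lim_{\beta\to\infty}\mathbb P_\beta\big(\tau^{\mathbf r}_{\bigcup_{\mathbf t}\widetilde{\mathcal P}(\mathbf r,\mathbf t)}<\tau^{\mathbf r}_{\mathcal X^s\setminus\{\mathbf r\}}\big)=1$; (b) $\lim_{\beta\to\infty}\mathbb P_\beta\big(\tau^{\mathbf r}_{\bigcup_{\mathbf t}\overline{\mathcal Q}(\mathbf r,\mathbf t)}<\tau^{\mathbf r}_{\mathcal X^s\setminus\{\mathbf r\}}\big)=\lim_{\beta\to\infty}\mathbb P_\beta\big(\tau^{\mathbf r}_{\bigcup_{\mathbf t}\widetilde{\mathcal Q}(\mathbf r,\mathbf t)}<\tau^{\mathbf r}_{\mathcal X^s\setminus\{\mathbf r\}}\big)=1$; (c) $\lim_{\beta\to\infty}\mathbb P_\beta\big(\tau^{\mathbf r}_{\bigcup_{\mathbf t}\overline{\mathcal H}_i(\mathbf r,\mathbf t)}<\tau^{\mathbf r}_{\mathcal X^s\setminus\{\mathbf r\}}\big)=\lim_{\beta\to\infty}\mathbb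 P_\beta\big(\tau^{\mathbf r}_{\bigcup_{\mathbf t}\widetilde{\mathcal H}_i(\mathbf r,\mathbf t)}<\tau^{\mathbf r}_{\mathcal X^s\setminus\{\mathbf r\}}\big)=1$ for any $i=1,\dots,K-3$; (d) $\lim_{\beta\to\infty}\mathbb P_\beta\big(\tau^{\mathbf r}_{\bigcup_{\mathbf t}\mathcal W_j^{(h)}(\mathbf r,\mathbf t)}<\tau^{\mathbf r}_{\mathcal X^s\setminus\{\mathbf r\}}\big)=1$ for every $j=2,\dots,L-3$ and $h=1,\dots,K-1$. Moreover, (a)–(d) imply $$\lim_{\beta\to\infty}\mathbb P_\beta\big(\tau^{\mathbf r}_{\mathcal G(\mathbf r,\mathcal X^s\setminus\{\mathbf r\})}<\tau^{\mathbf r}_{\mathcal X^s\setminus\{\mathbf r\}}\big)=1,$$ where $\mathcal G(\mathbf r,\mathcal X^s\setminus\{\mathbf r\})$ is the union of all minimal gates for the transition $\mathbf r\to\mathcal X^s\setminus\{\mathbf r\}$.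
   Context: Model. Fix integers $q$, $K<L$, $L\ge 3$. $\Lambda=(V,E)$ is the two-dimensional torus with $V=\{0,\dots,K-1\}\times\{0,\dots,L-1\}$ (vertex $(i,j)$ lies in row $i$ and column $j$; there are $K$ rows and $L$ columns) and $E$ the set of nearest-neighbour pairs with periodic boundary conditions. $S=\{1,\dots,q\}$, $\mathcal X=S^V$, $H(\sigma)=-\sum_{(v,w)\in E}1_{\{\sigma(v)=\sigma(w)\}}$. For $s\in S$, bold $\mathbf s\in\mathcal X$ is the configuration constantly equal to $s$; $\mathcal X^s=\{\mathbf 1,\dots,\mathbf q\}$ is the set of global minima of $H$ (stable configurations). Dynamics. For $\beta>0$, $\{X_t^\beta\}_{t\in\mathbb N}$ is the Markov chain on $\mathcal X$ with transition probabilities $P_\beta(\sigma,\sigma')=Q(\sigma,\sigma')e^{-\beta[H(\sigma')-H(\sigma)]^+}$ for $\sigma\ne\sigma'$ and $P_\beta(\sigma,\sigma)=1-\sum_{\eta\neq\sigma}P_\beta(\sigma,\eta)$, where $[x]^+=\max\{0,x\}$ and $Q(\sigma,\sigma')=1/(q|V|)$ if $\sigma,\sigma'$ differ at exactly one vertex, $Q(\sigma,\sigma')=0$ if they differ at more than one. For nonempty $\mathcal A\subset\mathcal X$, $\tau^\sigma_{\mathcal A}=\inf\{t>0:X_t^\beta\in\mathcal A\}$ is the first hitting time of $\mathcal A$ for the chain started from $\sigma$ at time $0$. Paths, saddles, gates. A path $\omega:\sigma\to\sigma'$ is a finite sequence $\omega_0=\sigma,\dots,\omega_n=\sigma'$ in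 $\mathcal X$ with $Q(\omega_i,\omega_{i+1})>0$; $\Phi_\omega=\max_i H(\omega_i)$; $\Phi(\sigma,\sigma')=\min_{\omega:\sigma\to\sigma'}\Phi_\omega$; for a nonempty set $\mathcal A\not\ni\sigma$, $\Phi(\sigma,\mathcal A)=\min_{\sigma'\in\mathcal A}\Phi(\sigma,\sigma')$. $\Omega^{opt}_{\sigma,\mathcal A}$ is the set of paths $\omega$ from $\sigma$ to an element of $\mathcal A$ with $\Phi_\omega=\Phi(\sigma,\mathcal A)$. $\mathcal S(\sigma,\mathcal A)$ is the set of $\xi\in\mathcal X$ such that there is $\omega\in\Omega^{opt}_{\sigma,\mathcal A}$ with $\xi\in\omega$ and $H(\xi)=\max_{\eta\in\omega}H(\eta)$. A gate for $\sigma\to\mathcal A$ is a subset $\mathcal W\subseteq\mathcal S(\sigma,\mathcal A)$ such that $\omega\cap\mathcal W\ne\varnothing$ for all $\omega\in\Omega^{opt}_{\sigma,\mathcal A}$. A gate $\mathcal W$ is a minimal gate if for every proper subset $\mathcal W'\subset\mathcal W$ there is $\omega'\in\Omega^{opt}_{\sigma,\mathcal A}$ with $\omega'\cap\mathcal W'=\varnothing$. Sets of configurations. For distinct spins $r,s$: $\bar R_{a,b}(r,s)$ is the set of configurations in which all spins are $r$ except those, equal to $s$, in a rectangle $a\times b$ of $\Lambda$ ($a$ = horizontal length, i.e. number of columns; $b$ = vertical length, i.e. number of rows). $\bar B^h_{a,b}(r,s)$, $1\le h\le b-1$, is the set of configurations in which all spins are $r$ except those, equal to $s$, in a rectangle $a\times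 b$ together with a bar $1\times h$ (one column wide, $h$ consecutive rows) adjacent to one of the sides of length $b$. $\tilde R_{a,b}(r,s)$, $\tilde B^h_{a,b}(r,s)$ are the same with the roles of $r$ and $s$ interchanged. Put $\overline{\mathcal P}(\mathbf r,\mathbf s)=\bar B^{K-1}_{1,K}(r,s)$; $\overline{\mathcal Q}(\mathbf r,\mathbf s)=\bar R_{2,K-1}(r,s)\cup\bar B^{K-2}_{1,K}(r,s)$; $\overline{\mathcal H}_i(\mathbf r,\mathbf s)=\bar B^i_{1,K}(r,s)\cup\bigcup_{h=i+1}^{K-2}\bar B^h_{1,K-1}(r,s)$ for $i=1,\dots,K-3$; and $\widetilde{\mathcal P},\widetilde{\mathcal Q},\widetilde{\mathcal H}_i$ by the same formulas with $\tilde R,\tilde B$ in place of $\bar R,\bar B$. Finally $\mathcal W_j^{(h)}(\mathbf r,\mathbf s)=\bar B^h_{j,K}(r,s)=\tilde B^{K-h}_{L-j-1,K}(r,s)$ for $j=2,\dots,L-3$, $h=1,\dots,K-1$.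
   Formalization: The formal theorem assumes K ≥ 3: for K ≤ 2 the set Q uses a bar of length K−2 < 1, which is undefined, and for K = 2, L = 3 claim (a) fails because filling row by row has a lower energy barrier than the configurations in P. *)

theory Defs
  imports "HOL-Probability.Probability" "HOL-Library.Extended_Nat"
begin

section \<open>The Potts model on the torus\<close>

type_synonym vertex = "nat \<times> nat"
type_synonym config = "vertex \<Rightarrow> nat"

definition vertices :: "nat \<Rightarrow> nat \<Rightarrow> vertex set" where
  "vertices K L = {0..<K} \<times> {0..<L}"

definition cyc_adj :: "nat \<Rightarrow> nat \<Rightarrow> nat \<Rightarrow> bool" where
  "cyc_adj n a b \<longleftrightarrow> b = Suc a mod n \<or> a = Suc b mod n"

definition nearest_neighbours :: "nat \<Rightarrow> nat \<Rightarrow> vertex \<Rightarrow> vertex \<Rightarrow> bool" where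
  "nearest_neighbours K L v w \<longleftrightarrow>
     (fst v = fst w \<and> cyc_adj L (snd v) (snd w)) \<or>
     (snd v = snd w \<and> cyc_adj K (fst v) (fst w))"

definition edges :: "nat \<Rightarrow> nat \<Rightarrow> vertex set set" where
  "edges K L = {{v, w} | v w. v \<in> vertices K L \<and> w \<in> vertices K L \<and> nearest_neighbours K L v w}"

definition spins :: "nat \<Rightarrow> nat set" where
  "spins q = {1..q}"

definition configs :: "nat \<Rightarrow> nat \<Rightarrow> nat \<Rightarrow> config set" where
  "configs q K L = vertices K L \<rightarrow>\<^sub>E spins q"

definition energy :: "nat \<Rightarrow> nat \<Rightarrow> config \<Rightarrow> int" where
  "energy K L \<sigma> = - (\<Sum>e\<in>edges K L. of_bool (\<forall>v\<in>e. \<forall>w\<in>e. \<sigma> v = \<sigma> w))"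

definition const_config :: "nat \<Rightarrow> nat \<Rightarrow> nat \<Rightarrow> config" where
  "const_config K L s = (\<lambda>v\<in>vertices K L. s)"

definition stable_configs :: "nat \<Rightarrow> nat \<Rightarrow> nat \<Rightarrow> config set" where
  "stable_configs q K L = const_config K L ` spins q"

section \<open>Metropolis dynamics\<close>

text \<open>The diagonal value of the connectivity matrix is the one that makes its rows sum to one
  (a uniformly chosen vertex gets a uniformly chosen spin).\<close>

definition connectivity :: "nat \<Rightarrow> nat \<Rightarrow> nat \<Rightarrow> config \<Rightarrow> config \<Rightarrow> real" where
  "connectivity q K L \<sigma> \<sigma>' =
     (let d = card {v \<in> vertices K L. \<sigma> v \<noteq> \<sigma>' v} in
        if d = 0 then 1 / real q
        else if d = 1 then 1 / (real q * real (card (vertices K L)))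
        else 0)"

definition metropolis_rate :: "nat \<Rightarrow> nat \<Rightarrow> nat \<Rightarrow> real \<Rightarrow> config \<Rightarrow> config \<Rightarrow> real" where
  "metropolis_rate q K L \<beta> \<sigma> \<sigma>' =
     connectivity q K L \<sigma> \<sigma>' * exp (- \<beta> * real_of_int (max 0 (energy K L \<sigma>' - energy K L \<sigma>)))"

definition transition_prob :: "nat \<Rightarrow> nat \<Rightarrow> nat \<Rightarrow> real \<Rightarrow> config \<Rightarrow> config \<Rightarrow> real" where
  "transition_prob q K L \<beta> \<sigma> \<sigma>' =
     (if \<sigma> \<noteq> \<sigma>' then metropolis_rate q K L \<beta> \<sigma> \<sigma>'
      else 1 - (\<Sum>\<eta>\<in>configs q K L - {\<sigma>}. metropolis_rate q K L \<beta> \<sigma> \<eta>))"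

text \<open>\<open>X\<close> is a realization, on the probability space \<open>M\<close>, of the time-homogeneous Markov chain with
  the above transition matrix started from \<open>\<sigma>\<close>; the law is prescribed through the
  probabilities of cylinder events.\<close>

definition metropolis_chain ::
    "nat \<Rightarrow> nat \<Rightarrow> nat \<Rightarrow> real \<Rightarrow> config \<Rightarrow> 'w measure \<Rightarrow> (nat \<Rightarrow> 'w \<Rightarrow> config) \<Rightarrow> bool" where
  "metropolis_chain q K L \<beta> \<sigma> M X \<longleftrightarrow>
     prob_space M \<and>
     (\<forall>t. X t \<in> measurable M (count_space (configs q K L))) \<and>
     (\<forall>n x. (\<forall>t\<le>n. x t \<in> configs q K L) \<longrightarrow>
        measure M {\<omega> \<in> space M. \<forall>t\<le>n. X t \<omega> = x t} =
          of_bool (x 0 = \<sigma>) * (\<Prod>t<n. transition_prob q K L \<beta> (x t) (x (Suc t))))"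

definition hitting_time :: "(nat \<Rightarrow> 'w \<Rightarrow> config) \<Rightarrow> config set \<Rightarrow> 'w \<Rightarrow> enat" where
  "hitting_time X A \<omega> = (INF t\<in>{t. 0 < t \<and> X t \<omega> \<in> A}. enat t)"

definition prob_hits_before ::
    "'w measure \<Rightarrow> (nat \<Rightarrow> 'w \<Rightarrow> config) \<Rightarrow> config set \<Rightarrow> config set \<Rightarrow> real" where
  "prob_hits_before M X A B = measure M {\<omega> \<in> space M. hitting_time X A \<omega> < hitting_time X B \<omega>}"

section \<open>Optimal paths, saddles and gates\<close>

definition paths :: "nat \<Rightarrow> nat \<Rightarrow> nat \<Rightarrow> config \<Rightarrow> config \<Rightarrow> config list set" where
  "paths q K L \<sigma> \<sigma>' =
     {\<omega>. \<omega> \<noteq> [] \<and> set \<omega> \<subseteq> configs q K L \<and> hd \<omega> = \<sigma> \<and> last \<omega> = \<sigma>' \<and>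
         (\<forall>i. Suc i < length \<omega> \<longrightarrow> connectivity q K L (\<omega> ! i) (\<omega> ! Suc i) > 0)}"

definition path_height :: "nat \<Rightarrow> nat \<Rightarrow> config list \<Rightarrow> int" where
  "path_height K L \<omega> = Max (energy K L ` set \<omega>)"

definition comm_height :: "nat \<Rightarrow> nat \<Rightarrow> nat \<Rightarrow> config \<Rightarrow> config \<Rightarrow> int" where
  "comm_height q K L \<sigma> \<sigma>' = Min (path_height K L ` paths q K L \<sigma> \<sigma>')"

definition comm_height_set :: "nat \<Rightarrow> nat \<Rightarrow> nat \<Rightarrow> config \<Rightarrow> config set \<Rightarrow> int" where
  "comm_height_set q K L \<sigma> A = Min (comm_height q K L \<sigma> ` A)"

definition opt_paths :: "nat \<Rightarrow> nat \<Rightarrow> nat \<Rightarrow> config \<Rightarrow> config set \<Rightarrow> config list set" where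
  "opt_paths q K L \<sigma> A =
     {\<omega> \<in> (\<Union>\<sigma>'\<in>A. paths q K L \<sigma> \<sigma>'). path_height K L \<omega> = comm_height_set q K L \<sigma> A}"

definition saddles :: "nat \<Rightarrow> nat \<Rightarrow> nat \<Rightarrow> config \<Rightarrow> config set \<Rightarrow> config set" where
  "saddles q K L \<sigma> A =
     {\<xi>. \<exists>\<omega>\<in>opt_paths q K L \<sigma> A. \<xi> \<in> set \<omega> \<and> energy K L \<xi> = path_height K L \<omega>}"

definition gate :: "nat \<Rightarrow> nat \<Rightarrow> nat \<Rightarrow> config \<Rightarrow> config set \<Rightarrow> config set \<Rightarrow> bool" where
  "gate q K L \<sigma> A W \<longleftrightarrow>
     W \<subseteq> saddles q K L \<sigma> A \<and> (\<forall>\<omega>\<in>opt_paths q K L \<sigma> A. set \<omega> \<inter> W \<noteq> {})"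

definition minimal_gate :: "nat \<Rightarrow> nat \<Rightarrow> nat \<Rightarrow> config \<Rightarrow> config set \<Rightarrow> config set \<Rightarrow> bool" where
  "minimal_gate q K L \<sigma> A W \<longleftrightarrow>
     gate q K L \<sigma> A W \<and> (\<forall>W'. W' \<subset> W \<longrightarrow> (\<exists>\<omega>\<in>opt_paths q K L \<sigma> A. set \<omega> \<inter> W' = {}))"

definition all_min_gates :: "nat \<Rightarrow> nat \<Rightarrow> nat \<Rightarrow> config \<Rightarrow> config set \<Rightarrow> config set" where
  "all_min_gates q K L \<sigma> A = \<Union> {W. minimal_gate q K L \<sigma> A W}"

section \<open>Rectangles and rectangles with a bar\<close>

text \<open>The block with upper left corner \<open>(i, j)\<close>, \<open>a\<close> columns wide and \<open>b\<close> rows high,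
  wrapped around the torus.\<close>

definition block :: "nat \<Rightarrow> nat \<Rightarrow> nat \<Rightarrow> nat \<Rightarrow> nat \<Rightarrow> nat \<Rightarrow> vertex set" where
  "block K L i j a b = {((i + y) mod K, (j + x) mod L) | x y. x < a \<and> y < b}"

definition two_spin_config :: "nat \<Rightarrow> nat \<Rightarrow> nat \<Rightarrow> nat \<Rightarrow> vertex set \<Rightarrow> config" where
  "two_spin_config K L r s C = (\<lambda>v\<in>vertices K L. if v \<in> C then s else r)"

definition Rbar :: "nat \<Rightarrow> nat \<Rightarrow> nat \<Rightarrow> nat \<Rightarrow> nat \<Rightarrow> nat \<Rightarrow> config set" where
  "Rbar K L a b r s =
     {two_spin_config K L r s (block K L i j a b) | i j. (i, j) \<in> vertices K L}"

text \<open>The bar occupies rows \<open>i + k, \<dots>, i + k + h - 1\<close> of the column immediately to the right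
  (\<open>j + a\<close>) or to the left (\<open>j - 1\<close>, written \<open>j + L - 1\<close>) of the rectangle, and lies within
  the extent \<open>i, \<dots>, i + b - 1\<close> of its vertical side. For \<open>b = K\<close> the side is a full cycle, and
  letting \<open>i\<close> vary yields every cyclic position of the bar.\<close>

definition Bbar :: "nat \<Rightarrow> nat \<Rightarrow> nat \<Rightarrow> nat \<Rightarrow> nat \<Rightarrow> nat \<Rightarrow> nat \<Rightarrow> config set" where
  "Bbar K L h a b r s =
     {two_spin_config K L r s (block K L i j a b \<union> block K L (i + k) c 1 h) | i j k c.
        (i, j) \<in> vertices K L \<and> 1 \<le> h \<and> h \<le> b - 1 \<and> k + h \<le> b \<and> c \<in> {j + a, j + L - 1}}"

definition Rtilde :: "nat \<Rightarrow> nat \<Rightarrow> nat \<Rightarrow> nat \<Rightarrow> nat \<Rightarrow> nat \<Rightarrow> config set" where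
  "Rtilde K L a b r s = Rbar K L a b s r"

definition Btilde :: "nat \<Rightarrow> nat \<Rightarrow> nat \<Rightarrow> nat \<Rightarrow> nat \<Rightarrow> nat \<Rightarrow> nat \<Rightarrow> config set" where
  "Btilde K L h a b r s = Bbar K L h a b s r"

definition Pbar :: "nat \<Rightarrow> nat \<Rightarrow> nat \<Rightarrow> nat \<Rightarrow> config set" where
  "Pbar K L r s = Bbar K L (K - 1) 1 K r s"

definition Ptilde :: "nat \<Rightarrow> nat \<Rightarrow> nat \<Rightarrow> nat \<Rightarrow> config set" where
  "Ptilde K L r s = Btilde K L (K - 1) 1 K r s"

definition Qbar :: "nat \<Rightarrow> nat \<Rightarrow> nat \<Rightarrow> nat \<Rightarrow> config set" where
  "Qbar K L r s = Rbar K L 2 (K - 1) r s \<union> Bbar K L (K - 2) 1 K r s"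

definition Qtilde :: "nat \<Rightarrow> nat \<Rightarrow> nat \<Rightarrow> nat \<Rightarrow> config set" where
  "Qtilde K L r s = Rtilde K L 2 (K - 1) r s \<union> Btilde K L (K - 2) 1 K r s"

definition Hbar :: "nat \<Rightarrow> nat \<Rightarrow> nat \<Rightarrow> nat \<Rightarrow> nat \<Rightarrow> config set" where
  "Hbar K L i r s = Bbar K L i 1 K r s \<union> (\<Union>h\<in>{i + 1..K - 2}. Bbar K L h 1 (K - 1) r s)"

definition Htilde :: "nat \<Rightarrow> nat \<Rightarrow> nat \<Rightarrow> nat \<Rightarrow> nat \<Rightarrow> config set" where
  "Htilde K L i r s = Btilde K L i 1 K r s \<union> (\<Union>h\<in>{i + 1..K - 2}. Btilde K L h 1 (K - 1) r s)"

definition Wgate :: "nat \<Rightarrow> nat \<Rightarrow> nat \<Rightarrow> nat \<Rightarrow> nat \<Rightarrow> nat \<Rightarrow> config set" where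
  "Wgate K L j h r s = Bbar K L h j K r s"

end

theory Submission
  imports Defs
begin

text \<open>Call the number of disagreeing edges of a configuration its excess; it is the energy counted from
the common value of the monochromatic configurations. A path is low if its excess never exceeds
\<open>2 * K + 2\<close>. The theorem combines an estimate for reversible chains with a geometric statement on
low paths.

The probabilistic part. Let \<open>D\<close> be the set of configurations of energy above some level \<open>\<Phi>\<close>, let
\<open>T\<close> be the target, and let \<open>f n x\<close> be the probability that the chain started in \<open>x\<close> visits \<open>D\<close>
within \<open>n\<close> steps and not after \<open>T\<close>. Off \<open>D \<union> T\<close> the function \<open>f n\<close> is at most its own average over
one step, because \<open>f\<close> increases with \<open>n\<close>. By reversibility its Dirichlet form is therefore at most
that of the indicator of \<open>D\<close>, which is of order \<open>exp (- \<beta> * (\<Phi> + 1))\<close> since energies are integers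
(\<open>dirichlet_hit_prob\<close>). Along a path from \<open>x\<close> to \<open>T\<close> of energy at most \<open>\<Phi>\<close> all conductances are
at least of order \<open>exp (- \<beta> * \<Phi>)\<close>; as \<open>f n\<close> vanishes at the end of this path, its value at \<open>x\<close> is
of order \<open>exp (- \<beta> / 2)\<close>, uniformly in \<open>n\<close> (\<open>dirichlet_path_bound\<close>). So with high probability the
target is reached without exceeding \<open>\<Phi>\<close>, and any set that meets all such paths is visited before
(\<open>gate_hit_whp\<close>).

The geometric part. The excess is the sum over all rows and columns of the number of changes of
spin along that cycle, and a nonconstant cycle has at least two of them. If a low configuration has
constant columns of two different spins, every row has two changes, which leaves at most two for
the columns: the configuration is a vertical strip together with at most one bar
(\<open>two_phase_droplet\<close>). Its shape can be read off from the number of its sites. A single flip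
cannot turn a constant column of one spin into one of another, so a low path from \<open>r\<close> to another
monochromatic configuration has to traverse such strips from one side to the other
(\<open>phase_step\<close>, \<open>two_phase_step\<close>). On the way the number of sites takes all intermediate values,
which yields \<open>Pbar\<close>, \<open>Ptilde\<close> and \<open>Wgate\<close> (\<open>level_gate\<close>). The remaining gates come from the flip
that completes the first column of the strip: just before it, the row of the flipped site must be
constant, so that the configuration is a column of \<open>K - 1\<close> sites with a bar, or two such columns
(\<open>entry_structure\<close>). Together with the low neighbours of two such columns (\<open>Rbar_step\<close>) this
gives \<open>Qbar\<close> and \<open>Hbar\<close> (\<open>bar_gate\<close>), and, read at the other end of the strip regime with the two
spins exchanged, \<open>Qtilde\<close> and \<open>Htilde\<close> (\<open>bar_gate_reversed\<close>).

For the union of the minimal gates, filling the torus column by column is a low path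
(\<open>low_path_exists\<close>), so optimal paths are low; they meet a minimal gate, which consists of saddles.\<close>

section \<open>Finite reversible Markov chains\<close>

locale finite_kernel =
  fixes S :: "'a set" and P :: "'a \<Rightarrow> 'a \<Rightarrow> real"
  assumes finite_S: "finite S"
    and P_nonneg: "x \<in> S \<Longrightarrow> y \<in> S \<Longrightarrow> 0 \<le> P x y"
    and P_sum: "x \<in> S \<Longrightarrow> (\<Sum>y\<in>S. P x y) = 1"
begin

primrec path_weight :: "'a \<Rightarrow> 'a list \<Rightarrow> real" where
  "path_weight x [] = 1"
| "path_weight x (y # ys) = P x y * path_weight y ys"

primrec hits_before :: "'a set \<Rightarrow> 'a set \<Rightarrow> 'a list \<Rightarrow> bool" where
  "hits_before D T [] = False"
| "hits_before D T (x # xs) = (x \<in> D \<or> x \<notin> T \<and> hits_before D T xs)"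

text \<open>The probability that the chain started in \<open>x\<close> visits \<open>D\<close> within \<open>n\<close> steps and not after \<open>T\<close>.\<close>

primrec hit_prob :: "'a set \<Rightarrow> 'a set \<Rightarrow> nat \<Rightarrow> 'a \<Rightarrow> real" where
  "hit_prob D T 0 x = of_bool (x \<in> D)"
| "hit_prob D T (Suc n) x = (if x \<in> D then 1 else if x \<in> T then 0 else \<Sum>y\<in>S. P x y * hit_prob D T n y)"

primrec avoid_prob :: "'a set \<Rightarrow> nat \<Rightarrow> 'a \<Rightarrow> real" where
  "avoid_prob T 0 x = of_bool (x \<notin> T)"
| "avoid_prob T (Suc n) x = (if x \<in> T then 0 else \<Sum>y\<in>S. P x y * avoid_prob T n y)"

abbreviation lists_of :: "nat \<Rightarrow> 'a list set" where
  "lists_of n \<equiv> {xs. set xs \<subseteq> S \<and> length xs = n}"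

lemma finite_lists_of: "finite (lists_of n)"
  using finite_lists_length_eq[OF finite_S] .

lemma sum_lists_Suc:
  "(\<Sum>xs\<in>lists_of (Suc n). f xs) = (\<Sum>y\<in>S. \<Sum>ys\<in>lists_of n. f (y # ys))"
proof -
  have "lists_of (Suc n) = (\<lambda>(y, ys). y # ys) ` (S \<times> lists_of n)"
    by (force simp: length_Suc_conv image_iff)
  moreover have "inj_on (\<lambda>(y, ys). y # ys) (S \<times> lists_of n)" by (auto simp: inj_on_def)
  ultimately have "(\<Sum>xs\<in>lists_of (Suc n). f xs) = (\<Sum>p\<in>S \<times> lists_of n. f (case p of (y, ys) \<Rightarrow> y # ys))"
    by (simp only: sum.reindex comp_def)
  also have "\<dots> = (\<Sum>y\<in>S. \<Sum>ys\<in>lists_of n. f (y # ys))"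
    unfolding sum.cartesian_product by (simp add: case_prod_beta)
  finally show ?thesis .
qed

lemma sum_path_weight: "x \<in> S \<Longrightarrow> (\<Sum>xs\<in>lists_of n. path_weight x xs) = 1"
proof (induction n arbitrary: x)
  case 0
  have "lists_of 0 = {[]}" by auto
  then show ?case by simp
next
  case (Suc n)
  have "(\<Sum>xs\<in>lists_of (Suc n). path_weight x xs) = (\<Sum>y\<in>S. P x y * (\<Sum>ys\<in>lists_of n. path_weight y ys))"
    by (simp add: sum_lists_Suc sum_distrib_left)
  also have "\<dots> = (\<Sum>y\<in>S. P x y)" using Suc.IH by simp
  finally show ?case using P_sum Suc.prems by simp
qed

lemma path_weight_nonneg: "x \<in> S \<Longrightarrow> set xs \<subseteq> S \<Longrightarrow> 0 \<le> path_weight x xs"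
  by (induction xs arbitrary: x) (auto simp: P_nonneg)

lemma hit_prob_eq_sum:
  "x \<in> S \<Longrightarrow> hit_prob D T n x = (\<Sum>xs\<in>lists_of n. path_weight x xs * of_bool (hits_before D T (x # xs)))"
proof (induction n arbitrary: x)
  case 0
  have "lists_of 0 = {[]}" by auto
  then show ?case by simp
next
  case (Suc n)
  consider "x \<in> D" | "x \<notin> D" "x \<in> T" | "x \<notin> D" "x \<notin> T" by blast
  then show ?case
  proof cases
    case 1 then show ?thesis using sum_path_weight[OF Suc.prems, of "Suc n"] by simp
  next
    case 2 then show ?thesis by simp
  next
    case 3
    then have "(\<Sum>xs\<in>lists_of (Suc n). path_weight x xs * of_bool (hits_before D T (x # xs)))
      = (\<Sum>y\<in>S. P x y * (\<Sum>ys\<in>lists_of n. path_weight y ys * of_bool (hits_before D T (y # ys))))"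
      unfolding sum_lists_Suc sum_distrib_left by (simp add: mult.assoc)
    also have "\<dots> = (\<Sum>y\<in>S. P x y * hit_prob D T n y)" using Suc.IH by simp
    finally show ?thesis using 3 by simp
  qed
qed

lemma avoid_prob_eq_sum:
  "x \<in> S \<Longrightarrow> avoid_prob T n x = (\<Sum>xs\<in>lists_of n. path_weight x xs * of_bool (set (x # xs) \<inter> T = {}))"
proof (induction n arbitrary: x)
  case 0
  have "lists_of 0 = {[]}" by auto
  then show ?case by simp
next
  case (Suc n)
  show ?case
  proof (cases "x \<in> T")
    case False
    then have "(\<Sum>xs\<in>lists_of (Suc n). path_weight x xs * of_bool (set (x # xs) \<inter> T = {}))
      = (\<Sum>y\<in>S. P x y * (\<Sum>ys\<in>lists_of n. path_weight y ys * of_bool (set (y # ys) \<inter> T = {})))"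
      unfolding sum_lists_Suc sum_distrib_left by (simp add: mult.assoc)
    also have "\<dots> = (\<Sum>y\<in>S. P x y * avoid_prob T n y)" using Suc.IH by simp
    finally show ?thesis using False by simp
  qed simp
qed

lemma avoid_prob_bounds: "x \<in> S \<Longrightarrow> 0 \<le> avoid_prob T n x \<and> avoid_prob T n x \<le> 1"
proof (induction n arbitrary: x)
  case (Suc n)
  have "(\<Sum>y\<in>S. P x y * avoid_prob T n y) \<le> (\<Sum>y\<in>S. P x y * 1)"
    using Suc by (intro sum_mono mult_left_mono) (auto simp: P_nonneg)
  moreover have "0 \<le> (\<Sum>y\<in>S. P x y * avoid_prob T n y)"
    using Suc by (intro sum_nonneg mult_nonneg_nonneg) (auto simp: P_nonneg)
  ultimately show ?case using P_sum[OF Suc.prems] by simp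
qed simp

lemma avoid_prob_antimono: "x \<in> S \<Longrightarrow> avoid_prob T (Suc n) x \<le> avoid_prob T n x"
proof (induction n arbitrary: x)
  case 0
  then show ?case using avoid_prob_bounds[OF 0, of T "Suc 0"] by (cases "x \<in> T") auto
next
  case (Suc n)
  have "(\<Sum>y\<in>S. P x y * avoid_prob T (Suc n) y) \<le> (\<Sum>y\<in>S. P x y * avoid_prob T n y)"
    using Suc by (intro sum_mono mult_left_mono) (auto simp: P_nonneg simp del: avoid_prob.simps)
  then show ?case by (cases "x \<in> T") (simp_all only: avoid_prob.simps if_True if_False order_refl)
qed

text \<open>A maximum principle. The limit is harmonic off \<open>T\<close>, so a maximum point off \<open>T\<close> passes its value on
to all states that it can jump to, in particular to one with a smaller value of \<open>d\<close>. Descending in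
\<open>d\<close> one ends in \<open>T\<close>, where the limit vanishes.\<close>

lemma avoid_prob_tendsto_0:
  fixes d :: "'a \<Rightarrow> nat"
  assumes progress: "\<And>x. x \<in> S \<Longrightarrow> x \<notin> T \<Longrightarrow> \<exists>y\<in>S. 0 < P x y \<and> d y < d x"
    and x: "x \<in> S"
  shows "(\<lambda>n. avoid_prob T n x) \<longlonglongrightarrow> 0"
proof -
  define m where "m = (\<lambda>x. lim (\<lambda>n. avoid_prob T n x))"
  have lim: "(\<lambda>n. avoid_prob T n y) \<longlonglongrightarrow> m y" if "y \<in> S" for y
  proof -
    have "convergent (\<lambda>n. avoid_prob T n y)"
    proof (rule Bseq_monoseq_convergent)
      show "Bseq (\<lambda>n. avoid_prob T n y)"
        using avoid_prob_bounds[OF that] by (intro BseqI'[of _ 1]) (auto simp: abs_le_iff)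
      show "monoseq (\<lambda>n. avoid_prob T n y)"
        using avoid_prob_antimono[OF that] by (intro decseq_imp_monoseq decseq_SucI)
    qed
    then show ?thesis by (simp add: m_def convergent_LIMSEQ_iff)
  qed
  have mT: "m y = 0" if "y \<in> S" "y \<in> T" for y
  proof -
    have "avoid_prob T n y = 0" for n using that by (cases n) auto
    then show ?thesis by (simp add: m_def lim_const)
  qed
  have harm: "m y = (\<Sum>z\<in>S. P y z * m z)" if "y \<in> S" "y \<notin> T" for y
  proof -
    have "(\<lambda>n. \<Sum>z\<in>S. P y z * avoid_prob T n z) \<longlonglongrightarrow> (\<Sum>z\<in>S. P y z * m z)"
      by (intro tendsto_sum tendsto_mult_left lim)
    then have "(\<lambda>n. avoid_prob T (Suc n) y) \<longlonglongrightarrow> (\<Sum>z\<in>S. P y z * m z)" using that by simp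
    then show ?thesis using LIMSEQ_unique LIMSEQ_Suc[OF lim[OF that(1)]] by blast
  qed
  define M where "M = Max (m ` S)"
  have Mge: "m y \<le> M" if "y \<in> S" for y using that finite_S unfolding M_def by simp
  have "M \<in> m ` S" unfolding M_def using x finite_S by (intro Max_in) auto
  then obtain x0 where "x0 \<in> S" "m x0 = M" by auto
  \<comment> \<open>among the maximum points of the limit, one that is closest to \<open>T\<close> lies in \<open>T\<close>\<close>
  then obtain y where y: "y \<in> S" "m y = M" "\<And>z. z \<in> S \<Longrightarrow> m z = M \<Longrightarrow> d y \<le> d z"
    using ex_has_least_nat[of "\<lambda>z. z \<in> S \<and> m z = M" x0 d] by auto
  have "y \<in> T"
  proof (rule ccontr)
    assume nT: "y \<notin> T"
    then obtain z where z: "z \<in> S" "0 < P y z" "d z < d y" using progress y(1) by blast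
    then have "m z < M" using y(3)[OF z(1)] Mge[OF z(1)] by fastforce
    have "(\<Sum>w\<in>S. P y w * m w) < (\<Sum>w\<in>S. P y w * M)"
    proof (rule sum_strict_mono_ex1[OF finite_S])
      show "\<forall>w\<in>S. P y w * m w \<le> P y w * M" using Mge y(1) by (auto intro!: mult_left_mono P_nonneg)
      show "\<exists>w\<in>S. P y w * m w < P y w * M" using z \<open>m z < M\<close> by (intro bexI[of _ z]) auto
    qed
    also have "\<dots> = M" using P_sum[OF y(1)] by (simp add: sum_distrib_right[symmetric])
    finally show False using harm[OF y(1) nT] y(2) by simp
  qed
  then have "M = 0" using mT y by simp
  have "0 \<le> m x" by (rule LIMSEQ_le_const[OF lim[OF x]]) (use avoid_prob_bounds[OF x] in auto)
  then have "m x = 0" using Mge[OF x] \<open>M = 0\<close> by simp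
  then show ?thesis using lim[OF x] by simp
qed

lemma hit_prob_bounds: "x \<in> S \<Longrightarrow> 0 \<le> hit_prob D T n x \<and> hit_prob D T n x \<le> 1"
proof (induction n arbitrary: x)
  case (Suc n)
  have "(\<Sum>y\<in>S. P x y * hit_prob D T n y) \<le> (\<Sum>y\<in>S. P x y * 1)"
    using Suc by (intro sum_mono mult_left_mono) (auto simp: P_nonneg)
  moreover have "0 \<le> (\<Sum>y\<in>S. P x y * hit_prob D T n y)"
    using Suc by (intro sum_nonneg mult_nonneg_nonneg) (auto simp: P_nonneg)
  ultimately show ?case using P_sum[OF Suc.prems] by simp
qed simp

lemma hit_prob_mono: "x \<in> S \<Longrightarrow> hit_prob D T n x \<le> hit_prob D T (Suc n) x"
proof (induction n arbitrary: x)
  case 0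
  then show ?case using hit_prob_bounds[OF 0, of D T "Suc 0"] by (cases "x \<in> D") auto
next
  case (Suc n)
  have "(\<Sum>y\<in>S. P x y * hit_prob D T n y) \<le> (\<Sum>y\<in>S. P x y * hit_prob D T (Suc n) y)"
    using Suc by (intro sum_mono mult_left_mono) (auto simp: P_nonneg simp del: hit_prob.simps)
  then show ?case by (cases "x \<in> D"; cases "x \<in> T") (simp_all only: hit_prob.simps if_True if_False order_refl)
qed

end

locale reversible_kernel = finite_kernel S P for S :: "'a set" and P +
  fixes w :: "'a \<Rightarrow> real"
  assumes w_nonneg: "x \<in> S \<Longrightarrow> 0 \<le> w x"
    and reversible: "x \<in> S \<Longrightarrow> y \<in> S \<Longrightarrow> w x * P x y = w y * P y x"
begin

text \<open>Twice the usual Dirichlet form: every unordered pair of states is counted in both orders.\<close>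

definition dirichlet :: "('a \<Rightarrow> real) \<Rightarrow> ('a \<Rightarrow> real) \<Rightarrow> real" where
  "dirichlet f g = (\<Sum>x\<in>S. \<Sum>y\<in>S. w x * P x y * ((f x - f y) * (g x - g y)))"

text \<open>Summation by parts; reversibility makes the two orders of a pair contribute equally.\<close>

lemma dirichlet_eq:
  "dirichlet f g = 2 * (\<Sum>x\<in>S. w x * g x * (f x - (\<Sum>y\<in>S. P x y * f y)))"
proof -
  let ?h = "\<lambda>x y. w x * P x y * ((f x - f y) * g x)"
  have "dirichlet f g = (\<Sum>x\<in>S. \<Sum>y\<in>S. ?h x y) + (\<Sum>x\<in>S. \<Sum>y\<in>S. w x * P x y * ((f y - f x) * g y))"
    unfolding dirichlet_def sum.distrib[symmetric] by (intro sum.cong refl) algebra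
  also have "(\<Sum>x\<in>S. \<Sum>y\<in>S. w x * P x y * ((f y - f x) * g y)) = (\<Sum>x\<in>S. \<Sum>y\<in>S. ?h y x)"
    by (intro sum.cong refl) (simp add: reversible)
  also have "\<dots> = (\<Sum>x\<in>S. \<Sum>y\<in>S. ?h x y)" by (rule sum.swap)
  finally have "dirichlet f g = 2 * (\<Sum>x\<in>S. \<Sum>y\<in>S. ?h x y)" by simp
  also have "(\<Sum>x\<in>S. \<Sum>y\<in>S. ?h x y) = (\<Sum>x\<in>S. w x * g x * (f x - (\<Sum>y\<in>S. P x y * f y)))"
  proof (rule sum.cong, rule refl)
    fix x assume x: "x \<in> S"
    have "(\<Sum>y\<in>S. ?h x y) = (\<Sum>y\<in>S. w x * g x * (f x * P x y - P x y * f y))"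
      by (intro sum.cong refl) algebra
    also have "\<dots> = w x * g x * (f x * (\<Sum>y\<in>S. P x y) - (\<Sum>y\<in>S. P x y * f y))"
      by (simp only: sum_distrib_left[symmetric] sum_subtractf)
    finally show "(\<Sum>y\<in>S. ?h x y) = w x * g x * (f x - (\<Sum>y\<in>S. P x y * f y))"
      using P_sum[OF x] by simp
  qed
  finally show ?thesis .
qed

lemma dirichlet_diff_right: "dirichlet f (\<lambda>x. g x - h x) = dirichlet f g - dirichlet f h"
  unfolding dirichlet_def sum_subtractf[symmetric] by (intro sum.cong refl) algebra

lemma dirichlet_mixed: "2 * dirichlet f g \<le> dirichlet f f + dirichlet g g"
proof -
  have "0 \<le> dirichlet (\<lambda>x. f x - g x) (\<lambda>x. f x - g x)"
    unfolding dirichlet_def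
    by (intro sum_nonneg mult_nonneg_nonneg[OF mult_nonneg_nonneg[OF w_nonneg P_nonneg] zero_le_square])
  also have "\<dots> = dirichlet f f + dirichlet g g - 2 * dirichlet f g"
    unfolding dirichlet_def sum_distrib_left sum.distrib[symmetric] sum_subtractf[symmetric]
    by (intro sum.cong refl) algebra
  finally show ?thesis by simp
qed

text \<open>The difference of \<open>hit_prob D T n\<close> and the indicator of \<open>D\<close> is nonnegative and vanishes on \<open>D \<union> T\<close>,
and off this set \<open>hit_prob D T n\<close> is at most its average over one step, which is
\<open>hit_prob D T (Suc n)\<close>. Hence the mixed form of the function with that difference is not positive,
and the function has at most the Dirichlet form of the indicator. This is one half of the Dirichlet
principle, with the advantage that it holds at every finite \<open>n\<close>.\<close>

lemma dirichlet_hit_prob: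
  assumes "D \<inter> T = {}"
  shows "dirichlet (hit_prob D T n) (hit_prob D T n) \<le> 2 * (\<Sum>x\<in>S \<inter> D. w x)"
proof -
  let ?f = "hit_prob D T n" and ?i = "\<lambda>x. of_bool (x \<in> D) :: real"
  have sub: "w x * (?f x - ?i x) * (?f x - (\<Sum>y\<in>S. P x y * ?f y)) \<le> 0" if x: "x \<in> S" for x
  proof -
    consider "x \<in> D" | "x \<notin> D" "x \<in> T" | "x \<notin> D" "x \<notin> T" by blast
    then show ?thesis
    proof cases
      case 1 then have "?f x = ?i x" by (cases n) auto
      then show ?thesis by simp
    next
      case 2 then have "?f x = ?i x" by (cases n) auto
      then show ?thesis by simp
    next
      case 3
      have "?f x \<le> (\<Sum>y\<in>S. P x y * ?f y)" using hit_prob_mono[OF x, of D T n] 3 by simp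
      then show ?thesis using hit_prob_bounds[OF x, of D T n] 3 w_nonneg[OF x]
        by (intro mult_nonneg_nonpos) auto
    qed
  qed
  have "dirichlet ?f (\<lambda>x. ?f x - ?i x) \<le> 0"
    unfolding dirichlet_eq using sum_nonpos[of S, OF sub] by simp
  then have "dirichlet ?f ?f \<le> dirichlet ?f ?i" by (simp add: dirichlet_diff_right)
  then have "dirichlet ?f ?f \<le> dirichlet ?i ?i" using dirichlet_mixed[of ?f ?i] by simp
  also have "\<dots> = 2 * (\<Sum>x\<in>S. w x * ?i x * (?i x - (\<Sum>y\<in>S. P x y * ?i y)))" by (rule dirichlet_eq)
  also have "\<dots> \<le> 2 * (\<Sum>x\<in>S. w x * ?i x)"
  proof -
    have "w x * ?i x * (?i x - (\<Sum>y\<in>S. P x y * ?i y)) \<le> w x * ?i x" if x: "x \<in> S" for x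
    proof -
      have "0 \<le> (\<Sum>y\<in>S. P x y * ?i y)" using x by (intro sum_nonneg mult_nonneg_nonneg) (auto simp: P_nonneg)
      then have "w x * ?i x * (?i x - (\<Sum>y\<in>S. P x y * ?i y)) \<le> w x * ?i x * 1"
        using w_nonneg[OF x] by (intro mult_left_mono) auto
      then show ?thesis by simp
    qed
    then show ?thesis by (intro mult_left_mono sum_mono) auto
  qed
  also have "(\<Sum>x\<in>S. w x * ?i x) = (\<Sum>x\<in>S \<inter> D. w x)"
    using finite_S by (simp add: sum.inter_restrict of_bool_def if_distrib cong: if_cong)
  finally show ?thesis .
qed

text \<open>A step of conductance at least \<open>c\<close> contributes at least \<open>c\<close> times its squared increment to the
Dirichlet form, so that no increment exceeds \<open>sqrt (dirichlet f f / c)\<close>. Paths may stay put, in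
which case the increment is zero whatever the conductance.\<close>

lemma dirichlet_path_bound:
  assumes c: "0 < c" and xs: "set xs \<subseteq> S"
    and cond: "\<And>i. Suc i < length xs \<Longrightarrow> xs ! i \<noteq> xs ! Suc i \<Longrightarrow> c \<le> w (xs ! i) * P (xs ! i) (xs ! Suc i)"
    and ne: "xs \<noteq> []"
  shows "f (hd xs) - f (last xs) \<le> real (length xs) * sqrt (dirichlet f f / c)"
  using xs cond ne
proof (induction xs)
  case (Cons x xs)
  let ?E = "dirichlet f f"
  have nn: "0 \<le> w a * P a b * ((f a - f b) * (f a - f b))" if "a \<in> S" "b \<in> S" for a b
    by (rule mult_nonneg_nonneg[OF mult_nonneg_nonneg[OF w_nonneg P_nonneg] zero_le_square]) (use that in auto)
  have E0: "0 \<le> ?E" unfolding dirichlet_def using nn by (intro sum_nonneg)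
  show ?case
  proof (cases "xs = []")
    case True
    then show ?thesis using E0 c by simp
  next
    case False
    have step: "f x - f (hd xs) \<le> sqrt (?E / c)"
    proof (cases "x = hd xs")
      case True then show ?thesis using E0 c by simp
    next
      case ne: False
      have S: "x \<in> S" "hd xs \<in> S" using Cons.prems(1) False by auto
      have "c \<le> w x * P x (hd xs)" using Cons.prems(2)[of 0] False ne by (simp add: hd_conv_nth)
      then have "c * (f x - f (hd xs))^2 \<le> w x * P x (hd xs) * (f x - f (hd xs))^2"
        by (rule mult_right_mono) simp
      also have "\<dots> = w x * P x (hd xs) * ((f x - f (hd xs)) * (f x - f (hd xs)))" by (simp add: power2_eq_square)
      also have "\<dots> \<le> (\<Sum>y\<in>S. w x * P x y * ((f x - f y) * (f x - f y)))"
        using S nn finite_S by (intro member_le_sum[of "hd xs" S "\<lambda>y. w x * P x y * ((f x - f y) * (f x - f y))"]) auto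
      also have "\<dots> \<le> ?E"
        unfolding dirichlet_def using S nn finite_S
        by (intro member_le_sum[of x S "\<lambda>x. \<Sum>y\<in>S. w x * P x y * ((f x - f y) * (f x - f y))"] sum_nonneg) auto
      finally have "(f x - f (hd xs))^2 \<le> ?E / c" using c by (simp add: field_simps)
      then show ?thesis by (rule real_le_rsqrt)
    qed
    have "f (hd xs) - f (last xs) \<le> real (length xs) * sqrt (?E / c)"
    proof (rule Cons.IH)
      show "c \<le> w (xs ! i) * P (xs ! i) (xs ! Suc i)" if "Suc i < length xs" "xs ! i \<noteq> xs ! Suc i" for i
        using Cons.prems(2)[of "Suc i"] that by simp
    qed (use Cons.prems False in auto)
    then show ?thesis using step False by (simp add: algebra_simps)
  qed
qed simp

section \<open>Trajectories and hitting times\<close>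

definition markov_chain :: "'a \<Rightarrow> 'w measure \<Rightarrow> (nat \<Rightarrow> 'w \<Rightarrow> 'a) \<Rightarrow> bool" where
  "markov_chain \<sigma> M X \<longleftrightarrow> prob_space M \<and> (\<forall>t. X t \<in> measurable M (count_space S)) \<and>
     (\<forall>n x. (\<forall>t\<le>n. x t \<in> S) \<longrightarrow> measure M {\<omega> \<in> space M. \<forall>t\<le>n. X t \<omega> = x t} =
        of_bool (x 0 = \<sigma>) * (\<Prod>t<n. P (x t) (x (Suc t))))"

definition trace :: "(nat \<Rightarrow> 'w \<Rightarrow> 'a) \<Rightarrow> nat \<Rightarrow> 'w \<Rightarrow> 'a list" where
  "trace X n \<omega> = map (\<lambda>t. X t \<omega>) [0..<Suc n]"

lemma length_trace [simp]: "length (trace X n \<omega>) = Suc n"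
  by (simp add: trace_def)

lemma nth_trace: "t \<le> n \<Longrightarrow> trace X n \<omega> ! t = X t \<omega>"
  unfolding trace_def by (subst nth_map) (simp_all del: upt_Suc)

lemma path_weight_eq_prod:
  "path_weight y ys = (\<Prod>t<length ys. P ((y # ys) ! t) ((y # ys) ! Suc t))"
  by (induction ys arbitrary: y) (simp_all add: prod.lessThan_Suc_shift del: prod.lessThan_Suc)

text \<open>An event decided by the first \<open>n\<close> steps is a finite disjoint union of cylinders.\<close>

lemma measure_trace:
  assumes X: "markov_chain \<sigma> M X" and \<sigma>: "\<sigma> \<in> S"
  shows "measure M {\<omega> \<in> space M. Q (trace X n \<omega>)} =
    (\<Sum>xs\<in>lists_of n. path_weight \<sigma> xs * of_bool (Q (\<sigma> # xs)))"
proof -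
  interpret prob_space M using X by (simp add: markov_chain_def)
  have meas [measurable]: "X t \<in> measurable M (count_space S)" for t using X by (simp add: markov_chain_def)
  have XS: "X t \<omega> \<in> S" if "\<omega> \<in> space M" for t \<omega>
    using measurable_space[OF meas that] by simp
  define E where "E = (\<lambda>ys. {\<omega> \<in> space M. trace X n \<omega> = ys})"
  have E_eq: "E ys = {\<omega> \<in> space M. \<forall>t\<le>n. X t \<omega> = ys ! t}" if "length ys = Suc n" for ys
    unfolding E_def using that by (auto simp: list_eq_iff_nth_eq nth_trace less_Suc_eq_le)
  have E_sets: "E ys \<in> sets M" if "ys \<in> lists_of (Suc n)" for ys
  proof -
    have "{\<omega> \<in> space M. X t \<omega> = ys ! t} \<in> sets M" for t
    proof -
      have "X t -` ({ys ! t} \<inter> S) \<inter> space M \<in> sets M" by (rule measurable_sets[OF meas]) simp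
      moreover have "X t -` ({ys ! t} \<inter> S) \<inter> space M = {\<omega> \<in> space M. X t \<omega> = ys ! t}" using XS by auto
      ultimately show ?thesis by simp
    qed
    then have "{\<omega> \<in> space M. \<forall>t\<in>{..n}. X t \<omega> = ys ! t} \<in> sets M"
      by (intro sets.sets_Collect_finite_All) auto
    then show ?thesis using E_eq that by simp
  qed
  have E_measure: "measure M (E (y # ys)) = of_bool (y = \<sigma>) * path_weight y ys"
    if "y \<in> S" "ys \<in> lists_of n" for y ys
  proof -
    have "(y # ys) ! t \<in> S" if "t \<le> n" for t
      using that \<open>y \<in> S\<close> \<open>ys \<in> lists_of n\<close> by (cases t) auto
    then have "measure M {\<omega> \<in> space M. \<forall>t\<le>n. X t \<omega> = (y # ys) ! t} =
        of_bool ((y # ys) ! 0 = \<sigma>) * (\<Prod>t<n. P ((y # ys) ! t) ((y # ys) ! Suc t))"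
      using X unfolding markov_chain_def by blast
    then show ?thesis using that(2) E_eq[of "y # ys"] by (simp add: path_weight_eq_prod)
  qed
  let ?A = "{ys \<in> lists_of (Suc n). Q ys}"
  have fin: "finite ?A" by (rule finite_subset[OF _ finite_lists_of[of "Suc n"]]) auto
  have "set (trace X n \<omega>) \<subseteq> S" if "\<omega> \<in> space M" for \<omega>
    using XS[OF that] by (auto simp: trace_def)
  then have "{\<omega> \<in> space M. Q (trace X n \<omega>)} = (\<Union>ys\<in>?A. E ys)" unfolding E_def by auto
  also have "measure M \<dots> = (\<Sum>ys\<in>?A. measure M (E ys))"
    by (rule finite_measure_finite_Union)
      (use E_sets fin in \<open>auto simp: disjoint_family_on_def E_def\<close>)
  also have "\<dots> = (\<Sum>ys\<in>lists_of (Suc n). measure M (E ys) * of_bool (Q ys))"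
    using finite_lists_of[of "Suc n"] by (intro sum.mono_neutral_cong_left) auto
  also have "\<dots> = (\<Sum>y\<in>S. \<Sum>ys\<in>lists_of n. of_bool (y = \<sigma>) * path_weight y ys * of_bool (Q (y # ys)))"
    unfolding sum_lists_Suc using E_measure by (intro sum.cong refl) simp
  also have "\<dots> = (\<Sum>y\<in>S. if y = \<sigma> then \<Sum>xs\<in>lists_of n. path_weight \<sigma> xs * of_bool (Q (\<sigma> # xs)) else 0)"
    by (intro sum.cong refl) simp
  also have "\<dots> = (\<Sum>xs\<in>lists_of n. path_weight \<sigma> xs * of_bool (Q (\<sigma> # xs)))"
    using \<sigma> finite_S by simp
  finally show ?thesis .
qed

lemma path_weight_nonzero_steps:
  assumes "path_weight x xs \<noteq> 0" "x \<in> S" "set xs \<subseteq> S" "Suc i < length (x # xs)"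
  shows "0 < P ((x # xs) ! i) ((x # xs) ! Suc i)"
  using assms
proof (induction xs arbitrary: x i)
  case (Cons y ys)
  then show ?case using P_nonneg[of x y] by (cases i) auto
qed simp

lemma not_hits_before:
  "\<not> hits_before D T xs \<Longrightarrow> k < length xs \<Longrightarrow> (\<And>l. l < k \<Longrightarrow> xs ! l \<notin> T) \<Longrightarrow> xs ! k \<notin> D"
proof (induction xs arbitrary: k)
  case (Cons x xs)
  show ?case
  proof (cases k)
    case 0 then show ?thesis using Cons.prems by auto
  next
    case (Suc l)
    have "x \<notin> T" using Cons.prems(3)[of 0] Suc by simp
    then have "\<not> hits_before D T xs" using Cons.prems(1) by simp
    moreover have "xs ! l' \<notin> T" if "l' < l" for l' using Cons.prems(3)[of "Suc l'"] that Suc by simp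
    ultimately show ?thesis using Cons.IH[of l] Cons.prems(2) Suc by simp
  qed
qed simp

text \<open>Apart from two events, whose probabilities are the two terms subtracted, the trajectory visits \<open>T\<close>
by time \<open>n\<close> and does not visit \<open>D\<close> before. Cut off at its first visit to \<open>T\<close>, it is a path to which
the assumption on \<open>W\<close> applies, and the resulting visit to \<open>W\<close> lies strictly between its ends.\<close>

lemma measure_hit_lower_bound:
  assumes X: "markov_chain \<sigma> M X" and \<sigma>: "\<sigma> \<in> S"
    and gate: "\<And>xs. xs \<noteq> [] \<Longrightarrow> set xs \<subseteq> S - D \<Longrightarrow> hd xs = \<sigma> \<Longrightarrow> last xs \<in> T
      \<Longrightarrow> (\<And>i. Suc i < length xs \<Longrightarrow> 0 < P (xs ! i) (xs ! Suc i)) \<Longrightarrow> \<exists>y\<in>set xs. y \<in> W \<and> y \<noteq> \<sigma> \<and> y \<notin> T"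
  shows "1 - avoid_prob T n \<sigma> - hit_prob D T n \<sigma> \<le>
    measure M {\<omega> \<in> space M. \<exists>m>0. X m \<omega> \<in> W \<and> (\<forall>t. 0 < t \<and> t \<le> m \<longrightarrow> X t \<omega> \<notin> T)}"
proof -
  interpret prob_space M using X by (simp add: markov_chain_def)
  have meas: "X t \<in> measurable M (count_space S)" for t using X by (simp add: markov_chain_def)
  have XS: "X t \<omega> \<in> S" if "\<omega> \<in> space M" for t \<omega>
    using measurable_space[OF meas that] by simp
  have ev: "{\<omega> \<in> space M. X t \<omega> \<in> A} \<in> sets M" for t A
  proof -
    have "X t -` (A \<inter> S) \<inter> space M \<in> sets M" by (rule measurable_sets[OF meas]) simp
    moreover have "X t -` (A \<inter> S) \<inter> space M = {\<omega> \<in> space M. X t \<omega> \<in> A}" using XS by auto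
    ultimately show ?thesis by simp
  qed
  let ?H = "{\<omega> \<in> space M. \<exists>m>0. X m \<omega> \<in> W \<and> (\<forall>t. 0 < t \<and> t \<le> m \<longrightarrow> X t \<omega> \<notin> T)}"
  have H: "?H \<in> sets M"
  proof -
    have "{\<omega> \<in> space M. X m \<omega> \<in> W \<and> (\<forall>t\<in>{0<..m}. X t \<omega> \<in> - T)} \<in> sets M" for m
      by (intro sets.sets_Collect_conj sets.sets_Collect_finite_All ev) auto
    then have "(\<Union>m\<in>{0<..}. {\<omega> \<in> space M. X m \<omega> \<in> W \<and> (\<forall>t\<in>{0<..m}. X t \<omega> \<in> - T)}) \<in> sets M"
      by (intro sets.countable_UN') auto
    moreover have "?H = (\<Union>m\<in>{0<..}. {\<omega> \<in> space M. X m \<omega> \<in> W \<and> (\<forall>t\<in>{0<..m}. X t \<omega> \<in> - T)})" by auto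
    ultimately show ?thesis by simp
  qed
  define Q where "Q = (\<lambda>xs. hd xs = \<sigma> \<and> set xs \<inter> T \<noteq> {} \<and> \<not> hits_before D T xs
    \<and> (\<forall>i. Suc i < length xs \<longrightarrow> 0 < P (xs ! i) (xs ! Suc i)))"
  have sub: "{\<omega> \<in> space M. Q (trace X n \<omega>)} \<subseteq> ?H"
  proof
    fix \<omega> assume "\<omega> \<in> {\<omega> \<in> space M. Q (trace X n \<omega>)}"
    then have \<omega>: "\<omega> \<in> space M" and Q: "Q (trace X n \<omega>)" by auto
    define xs where "xs = trace X n \<omega>"
    have "\<exists>m. m < length xs \<and> xs ! m \<in> T" using Q unfolding Q_def xs_def by (metis disjoint_iff in_set_conv_nth)
    then obtain m where m: "m < length xs" "xs ! m \<in> T" "\<And>l. l < m \<Longrightarrow> xs ! l \<notin> T"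
      using exists_least_iff[of "\<lambda>m. m < length xs \<and> xs ! m \<in> T"] by (metis less_trans)
    define zs where "zs = take (Suc m) xs"
    have len: "length zs = Suc m" using m(1) by (simp add: zs_def)
    have nth: "zs ! l = xs ! l" if "l \<le> m" for l using that by (simp add: zs_def)
    have "\<exists>y\<in>set zs. y \<in> W \<and> y \<noteq> \<sigma> \<and> y \<notin> T"
    proof (rule gate)
      show ne: "zs \<noteq> []" using len by auto
      have "xs ! l \<in> S - D" if "l \<le> m" for l
      proof -
        have "xs ! l \<notin> D"
          using not_hits_before[of D T xs l] Q m that unfolding Q_def xs_def[symmetric] by auto
        moreover have "xs ! l \<in> S" using XS[OF \<omega>] nth_trace[of l n X \<omega>] that m(1) by (simp add: xs_def)
        ultimately show ?thesis by simp
      qed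
      then show "set zs \<subseteq> S - D" using len nth by (auto simp: in_set_conv_nth less_Suc_eq_le)
      show "hd zs = \<sigma>" using Q len by (simp add: Q_def xs_def zs_def)
      show "last zs \<in> T" using ne len nth[of m] m(2) by (simp add: last_conv_nth)
      show "0 < P (zs ! i) (zs ! Suc i)" if "Suc i < length zs" for i
        using Q that len nth m(1) unfolding Q_def xs_def[symmetric] by auto
    qed
    then obtain i where i: "i \<le> m" "xs ! i \<in> W" "xs ! i \<noteq> \<sigma>" "xs ! i \<notin> T"
      using len nth by (metis in_set_conv_nth less_Suc_eq_le)
    have "xs ! 0 = \<sigma>" using Q m(1) unfolding Q_def xs_def[symmetric] by (metis hd_conv_nth length_0_conv not_less_zero)
    then have "0 < i" using i(3) by (cases i) auto
    moreover have "i < m" using i m(2) by (cases "i = m") auto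
    moreover have "xs ! l = X l \<omega>" if "l \<le> m" for l using nth_trace[of l n X \<omega>] that m(1) by (simp add: xs_def)
    ultimately show "\<omega> \<in> ?H" using i(2) m(3) \<omega> by (intro CollectI conjI exI[of _ i]) auto
  qed
  have "1 - avoid_prob T n \<sigma> - hit_prob D T n \<sigma> =
    (\<Sum>xs\<in>lists_of n. path_weight \<sigma> xs * (1 - of_bool (set (\<sigma> # xs) \<inter> T = {}) - of_bool (hits_before D T (\<sigma> # xs))))"
    using sum_path_weight[OF \<sigma>, of n] avoid_prob_eq_sum[OF \<sigma>, of T n] hit_prob_eq_sum[OF \<sigma>, of D T n]
    by (simp only: right_diff_distrib sum_subtractf mult_1_right)
  also have "\<dots> \<le> (\<Sum>xs\<in>lists_of n. path_weight \<sigma> xs * of_bool (Q (\<sigma> # xs)))"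
  proof (rule sum_mono)
    fix xs assume xs: "xs \<in> lists_of n"
    show "path_weight \<sigma> xs * (1 - of_bool (set (\<sigma> # xs) \<inter> T = {}) - of_bool (hits_before D T (\<sigma> # xs)))
      \<le> path_weight \<sigma> xs * of_bool (Q (\<sigma> # xs))"
    proof (cases "path_weight \<sigma> xs = 0")
      case False
      then have "\<forall>i. Suc i < length (\<sigma> # xs) \<longrightarrow> 0 < P ((\<sigma> # xs) ! i) ((\<sigma> # xs) ! Suc i)"
        using path_weight_nonzero_steps \<sigma> xs by blast
      then have Q: "Q (\<sigma> # xs) \<longleftrightarrow> set (\<sigma> # xs) \<inter> T \<noteq> {} \<and> \<not> hits_before D T (\<sigma> # xs)"
        unfolding Q_def list.sel by blast
      have "(1 - of_bool (set (\<sigma> # xs) \<inter> T = {}) - of_bool (hits_before D T (\<sigma> # xs)) :: real)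
        \<le> of_bool (Q (\<sigma> # xs))" unfolding Q by (simp del: hits_before.simps list.set)
      then show ?thesis using path_weight_nonneg[OF \<sigma>] xs by (intro mult_left_mono) auto
    qed simp
  qed
  also have "\<dots> = measure M {\<omega> \<in> space M. Q (trace X n \<omega>)}" by (rule measure_trace[OF X \<sigma>, symmetric])
  also have "\<dots> \<le> measure M ?H" using finite_measure_mono[OF sub H] .
  finally show ?thesis .
qed

end

lemma hitting_time_less_iff:
  "hitting_time X A \<omega> < hitting_time X B \<omega> \<longleftrightarrow> (\<exists>m>0. X m \<omega> \<in> A \<and> (\<forall>t. 0 < t \<and> t \<le> m \<longrightarrow> X t \<omega> \<notin> B))"
proof -
  have "enat m < hitting_time X B \<omega> \<longleftrightarrow> (\<forall>t. 0 < t \<and> t \<le> m \<longrightarrow> X t \<omega> \<notin> B)" for m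
  proof -
    have "enat m < hitting_time X B \<omega> \<longleftrightarrow> \<not> hitting_time X B \<omega> < enat (Suc m)"
      by (cases "hitting_time X B \<omega>") auto
    also have "hitting_time X B \<omega> < enat (Suc m) \<longleftrightarrow> (\<exists>t. 0 < t \<and> X t \<omega> \<in> B \<and> t \<le> m)"
      unfolding hitting_time_def INF_less_iff by (auto simp: less_Suc_eq_le)
    finally show ?thesis by blast
  qed
  moreover have "hitting_time X A \<omega> < y \<longleftrightarrow> (\<exists>m. 0 < m \<and> X m \<omega> \<in> A \<and> enat m < y)" for y
    unfolding hitting_time_def INF_less_iff by auto
  ultimately show ?thesis by auto
qed

section \<open>The Metropolis dynamics and its gates\<close>

lemma finite_configs: "finite (configs q K L)"
  unfolding configs_def by (intro finite_PiE) (auto simp: vertices_def spins_def)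

lemma connectivity_sym: "connectivity q K L \<sigma> \<sigma>' = connectivity q K L \<sigma>' \<sigma>"
  unfolding connectivity_def by (simp only: neq_commute[of "\<sigma> _"])

lemma connectivity_nonneg: "0 \<le> connectivity q K L \<sigma> \<sigma>'"
  unfolding connectivity_def Let_def by simp

lemma configs_differ:
  assumes "\<sigma> \<in> configs q K L" "\<sigma>' \<in> configs q K L" "\<sigma> \<noteq> \<sigma>'"
  shows "{v \<in> vertices K L. \<sigma> v \<noteq> \<sigma>' v} \<noteq> {}"
proof
  assume "{v \<in> vertices K L. \<sigma> v \<noteq> \<sigma>' v} = {}"
  then have "\<sigma> v = \<sigma>' v" if "v \<in> vertices K L" for v using that by blast
  then have "\<sigma> = \<sigma>'" using assms(1,2) unfolding configs_def by (intro PiE_ext)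
  then show False using assms(3) by simp
qed

lemma connectivity_distinct:
  assumes "\<sigma> \<in> configs q K L" "\<sigma>' \<in> configs q K L" "\<sigma> \<noteq> \<sigma>'"
  shows "connectivity q K L \<sigma> \<sigma>' =
    of_bool (card {v \<in> vertices K L. \<sigma> v \<noteq> \<sigma>' v} = 1) / (real q * real (card (vertices K L)))"
proof -
  have "finite {v \<in> vertices K L. \<sigma> v \<noteq> \<sigma>' v}" by (simp add: vertices_def)
  then have "card {v \<in> vertices K L. \<sigma> v \<noteq> \<sigma>' v} \<noteq> 0" using configs_differ[OF assms] by (simp only: card_0_eq simp_thms)
  then show ?thesis unfolding connectivity_def Let_def by simp
qed

lemma connectivity_pos:
  assumes "0 < q" "vertices K L \<noteq> {}" "card {v \<in> vertices K L. \<sigma> v \<noteq> \<sigma>' v} \<le> 1"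
  shows "connectivity q K L \<sigma> \<sigma>' > 0"
proof -
  have "finite (vertices K L)" by (simp add: vertices_def)
  then have "0 < card (vertices K L)" using assms(2) by (simp add: card_gt_0_iff)
  then have "0 < real q * real (card (vertices K L))" using assms(1) by simp
  moreover have "card {v \<in> vertices K L. \<sigma> v \<noteq> \<sigma>' v} = 0 \<or> card {v \<in> vertices K L. \<sigma> v \<noteq> \<sigma>' v} = 1"
    using assms(3) by linarith
  ultimately show ?thesis using assms(1) unfolding connectivity_def Let_def by auto
qed

text \<open>A neighbour of \<open>\<sigma>\<close> is determined by a site and a new spin, and each such pair has weight
\<open>1 / (q * card V)\<close>. This makes the holding probabilities nonnegative.\<close>

lemma sum_connectivity_le_1:
  assumes \<sigma>: "\<sigma> \<in> configs q K L"
  shows "(\<Sum>\<eta>\<in>configs q K L - {\<sigma>}. connectivity q K L \<sigma> \<eta>) \<le> 1"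
proof -
  let ?C = "configs q K L - {\<sigma>}" and ?N = "real q * real (card (vertices K L))"
  let ?B = "{\<eta> \<in> ?C. card {v \<in> vertices K L. \<sigma> v \<noteq> \<eta> v} = 1}"
  have finV: "finite (vertices K L \<times> spins q)" by (simp add: vertices_def spins_def)
  have finC: "finite ?C" using finite_configs by simp
  have "?B \<subseteq> (\<lambda>(v, s). \<sigma>(v := s)) ` (vertices K L \<times> spins q)"
  proof
    fix \<eta> assume \<eta>: "\<eta> \<in> ?B"
    then have \<eta>E: "\<eta> \<in> vertices K L \<rightarrow>\<^sub>E spins q" and \<sigma>E: "\<sigma> \<in> vertices K L \<rightarrow>\<^sub>E spins q"
      using \<sigma> by (simp_all add: configs_def)
    from \<eta> obtain v where v: "{v \<in> vertices K L. \<sigma> v \<noteq> \<eta> v} = {v}" by (auto simp: card_1_singleton_iff)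
    have "\<eta> = \<sigma>(v := \<eta> v)"
    proof
      fix w show "\<eta> w = (\<sigma>(v := \<eta> v)) w"
      proof (cases "w \<in> vertices K L")
        case True
        have "w \<in> {v \<in> vertices K L. \<sigma> v \<noteq> \<eta> v} \<longleftrightarrow> w = v" unfolding v by blast
        then show ?thesis using True by auto
      next
        case False
        moreover have "v \<in> vertices K L" using v by blast
        ultimately have "w \<noteq> v" by metis
        moreover have "\<eta> w = undefined" "\<sigma> w = undefined"
          using PiE_arb[OF \<eta>E False] PiE_arb[OF \<sigma>E False] by auto
        ultimately show ?thesis by simp
      qed
    qed
    moreover have "v \<in> vertices K L" using v by blast
    moreover from this have "\<eta> v \<in> spins q" by (rule PiE_mem[OF \<eta>E])
    ultimately show "\<eta> \<in> (\<lambda>(v, s). \<sigma>(v := s)) ` (vertices K L \<times> spins q)"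
      by (intro image_eqI[of _ _ "(v, \<eta> v)"]) (simp_all only: prod.case mem_Times_iff fst_conv snd_conv simp_thms)
  qed
  then have "card ?B \<le> card (vertices K L \<times> spins q)"
    using surj_card_le[OF finV] by blast
  then have B: "card ?B \<le> card (vertices K L) * q" by (simp add: card_cartesian_product spins_def)
  have "(\<Sum>\<eta>\<in>?C. connectivity q K L \<sigma> \<eta>) = (\<Sum>\<eta>\<in>?C. of_bool (card {v \<in> vertices K L. \<sigma> v \<noteq> \<eta> v} = 1) / ?N)"
    using connectivity_distinct[OF \<sigma>] by (intro sum.cong) auto
  also have "\<dots> = real (card ?B) / ?N"
    using finC by (simp add: sum_divide_distrib[symmetric] Int_def)
  also have "\<dots> \<le> 1"
  proof -
    have "real (card ?B) \<le> ?N" using of_nat_mono[OF B, where 'a = real] by (simp only: of_nat_mult mult.commute[of _ "real q"])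
    then have "real (card ?B) / ?N \<le> ?N / ?N" by (rule divide_right_mono) simp
    also have "\<dots> \<le> 1" by (simp add: divide_self_if)
    finally show ?thesis .
  qed
  finally show ?thesis .
qed

definition boltzmann :: "nat \<Rightarrow> nat \<Rightarrow> real \<Rightarrow> config \<Rightarrow> real" where
  "boltzmann K L \<beta> \<sigma> = exp (- \<beta> * real_of_int (energy K L \<sigma>))"

text \<open>Only the larger of the two energies enters, whence detailed balance.\<close>

lemma boltzmann_rate:
  "boltzmann K L \<beta> \<sigma> * metropolis_rate q K L \<beta> \<sigma> \<sigma>' =
    connectivity q K L \<sigma> \<sigma>' * exp (- \<beta> * real_of_int (max (energy K L \<sigma>) (energy K L \<sigma>')))"
proof -
  have "energy K L \<sigma> + max 0 (energy K L \<sigma>' - energy K L \<sigma>) = max (energy K L \<sigma>) (energy K L \<sigma>')" by simp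
  then have "- \<beta> * real_of_int (energy K L \<sigma>) + - \<beta> * real_of_int (max 0 (energy K L \<sigma>' - energy K L \<sigma>))
    = - \<beta> * real_of_int (max (energy K L \<sigma>) (energy K L \<sigma>'))"
    by (metis distrib_left of_int_add)
  then show ?thesis
    unfolding boltzmann_def metropolis_rate_def by (simp add: exp_add[symmetric] mult.left_commute)
qed

lemma metropolis_reversible:
  assumes "0 < \<beta>"
  shows "reversible_kernel (configs q K L) (transition_prob q K L \<beta>) (boltzmann K L \<beta>)"
proof
  show "finite (configs q K L)" by (rule finite_configs)
  show "0 \<le> transition_prob q K L \<beta> x y" if x: "x \<in> configs q K L" for x y
  proof (cases "x = y")
    case True
    have "(\<Sum>\<eta>\<in>configs q K L - {x}. metropolis_rate q K L \<beta> x \<eta>) \<le> (\<Sum>\<eta>\<in>configs q K L - {x}. connectivity q K L x \<eta>)"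
    proof (rule sum_mono)
      fix \<eta>
      have "connectivity q K L x \<eta> * exp (- \<beta> * real_of_int (max 0 (energy K L \<eta> - energy K L x)))
        \<le> connectivity q K L x \<eta> * 1"
        using assms connectivity_nonneg by (intro mult_left_mono) auto
      then show "metropolis_rate q K L \<beta> x \<eta> \<le> connectivity q K L x \<eta>" by (simp add: metropolis_rate_def)
    qed
    then show ?thesis using True sum_connectivity_le_1[OF x] by (simp add: transition_prob_def)
  qed (simp add: transition_prob_def metropolis_rate_def connectivity_nonneg)
  show "(\<Sum>y\<in>configs q K L. transition_prob q K L \<beta> x y) = 1" if "x \<in> configs q K L" for x
  proof -
    have "(\<Sum>y\<in>configs q K L. transition_prob q K L \<beta> x y) = transition_prob q K L \<beta> x x +
      (\<Sum>y\<in>configs q K L - {x}. transition_prob q K L \<beta> x y)"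
      using that finite_configs by (rule sum.remove[rotated])
    also have "(\<Sum>y\<in>configs q K L - {x}. transition_prob q K L \<beta> x y) =
      (\<Sum>y\<in>configs q K L - {x}. metropolis_rate q K L \<beta> x y)"
      by (intro sum.cong) (auto simp: transition_prob_def)
    finally show ?thesis by (simp add: transition_prob_def)
  qed
  show "0 \<le> boltzmann K L \<beta> x" for x by (simp add: boltzmann_def)
  show "boltzmann K L \<beta> x * transition_prob q K L \<beta> x y = boltzmann K L \<beta> y * transition_prob q K L \<beta> y x" for x y
    by (cases "x = y") (simp_all add: transition_prob_def boltzmann_rate connectivity_sym[of q K L x y] max.commute)
qed

lemma transition_prob_connectivity:
  assumes "0 < q" "x \<in> configs q K L" "0 < transition_prob q K L \<beta> x y"
  shows "0 < connectivity q K L x y"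
proof (cases "x = y")
  case True then show ?thesis using assms(1) by (simp add: connectivity_def)
next
  case False
  then have "connectivity q K L x y \<noteq> 0" using assms(3) by (auto simp: transition_prob_def metropolis_rate_def)
  then show ?thesis using connectivity_nonneg[of q K L x y] by simp
qed

text \<open>Setting one wrong site to \<open>t\<close> has positive probability at every temperature; the number of wrong
sites is the quantity that decreases in \<open>avoid_prob_tendsto_0\<close>.\<close>

lemma transition_towards_const:
  assumes "0 < q" and x: "x \<in> configs q K L" "x \<noteq> const_config K L t" and t: "t \<in> spins q"
  shows "\<exists>y\<in>configs q K L. 0 < transition_prob q K L \<beta> x y \<and>
    card {v \<in> vertices K L. y v \<noteq> t} < card {v \<in> vertices K L. x v \<noteq> t}"
proof -
  have finV: "finite (vertices K L)" by (simp add: vertices_def)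
  have "const_config K L t \<in> configs q K L" using t by (simp add: const_config_def configs_def)
  then obtain v where v: "v \<in> vertices K L" "x v \<noteq> t"
    using configs_differ[OF x(1) _ x(2)] by (auto simp: const_config_def)
  define y where "y = x(v := t)"
  have "y \<in> configs q K L"
    using x(1) t v(1) unfolding y_def configs_def by (auto simp: PiE_iff extensional_def)
  moreover have "y \<noteq> x" using v(2) unfolding y_def by (metis fun_upd_same)
  moreover have "{w \<in> vertices K L. x w \<noteq> y w} = {v}" using v by (auto simp: y_def)
  moreover have "0 < card (vertices K L)" using finV v(1) by (auto simp: card_gt_0_iff)
  ultimately have "0 < transition_prob q K L \<beta> x y"
    using assms(1) by (simp add: transition_prob_def metropolis_rate_def connectivity_def)
  moreover have "{w \<in> vertices K L. y w \<noteq> t} \<subset> {w \<in> vertices K L. x w \<noteq> t}" using v by (auto simp: y_def)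
  then have "card {w \<in> vertices K L. y w \<noteq> t} < card {w \<in> vertices K L. x w \<noteq> t}"
    using finV by (intro psubset_card_mono) auto
  ultimately show ?thesis using \<open>y \<in> configs q K L\<close> by blast
qed

text \<open>The level \<open>\<Phi>\<close> has to be attainable (there is a path from \<open>\<sigma>\<close> to \<open>T\<close> of energy at most \<open>\<Phi>\<close>), and \<open>W\<close>
has to block this level. Going up to \<open>\<Phi> + 1\<close> costs a further factor \<open>exp (- \<beta>)\<close> in the Dirichlet
form, which beats the factors \<open>C\<close> and \<open>length \<omega>0\<close>, as these do not depend on \<open>\<beta>\<close>.\<close>

theorem gate_hit_whp:
  fixes M :: "real \<Rightarrow> 'w measure" and X :: "real \<Rightarrow> nat \<Rightarrow> 'w \<Rightarrow> config" and \<Phi> :: int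
  assumes q: "0 < q" and V: "vertices K L \<noteq> {}"
    and T: "T \<subseteq> configs q K L" "const_config K L t0 \<in> T" "t0 \<in> spins q"
    and low_T: "\<And>\<tau>. \<tau> \<in> T \<Longrightarrow> energy K L \<tau> \<le> \<Phi>"
    and path: "\<tau>0 \<in> T" "\<omega>0 \<in> paths q K L \<sigma> \<tau>0" "\<And>\<xi>. \<xi> \<in> set \<omega>0 \<Longrightarrow> energy K L \<xi> \<le> \<Phi>"
    and gate: "\<And>\<omega> \<tau>. \<tau> \<in> T \<Longrightarrow> \<omega> \<in> paths q K L \<sigma> \<tau> \<Longrightarrow> (\<And>\<xi>. \<xi> \<in> set \<omega> \<Longrightarrow> energy K L \<xi> \<le> \<Phi>)
      \<Longrightarrow> \<exists>\<xi>\<in>set \<omega>. \<xi> \<in> W \<and> \<xi> \<noteq> \<sigma> \<and> \<xi> \<notin> T"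
    and X: "\<And>\<beta>. \<beta> > 0 \<Longrightarrow> metropolis_chain q K L \<beta> \<sigma> (M \<beta>) (X \<beta>)"
  shows "((\<lambda>\<beta>. prob_hits_before (M \<beta>) (X \<beta>) W T) \<longlongrightarrow> 1) at_top"
proof -
  let ?S = "configs q K L"
  define D where "D = {\<xi>. \<Phi> < energy K L \<xi>}"
  define C where "C = 2 * real (card ?S) * (real q * real (card (vertices K L)))"
  define B where "B = (\<lambda>\<beta>. real (length \<omega>0) * sqrt (C * exp (- \<beta>)))"
  have \<omega>0: "\<omega>0 \<noteq> []" "set \<omega>0 \<subseteq> ?S" "hd \<omega>0 = \<sigma>" "last \<omega>0 = \<tau>0"
    "\<And>i. Suc i < length \<omega>0 \<Longrightarrow> 0 < connectivity q K L (\<omega>0 ! i) (\<omega>0 ! Suc i)"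
    using path(2) unfolding paths_def by auto
  have \<sigma>: "\<sigma> \<in> ?S" using \<omega>0 by auto
  have DT: "D \<inter> T = {}" using low_T unfolding D_def by force
  have bound: "1 - B \<beta> \<le> prob_hits_before (M \<beta>) (X \<beta>) W T" if \<beta>: "0 < \<beta>" for \<beta>
  proof -
    let ?P = "transition_prob q K L \<beta>" and ?w = "boltzmann K L \<beta>"
    interpret reversible_kernel ?S ?P ?w by (rule metropolis_reversible[OF \<beta>])
    have chain: "markov_chain \<sigma> (M \<beta>) (X \<beta>)"
      using X[OF \<beta>] unfolding metropolis_chain_def markov_chain_def .
    have hit: "hit_prob D T n \<sigma> \<le> B \<beta>" for n
    proof -
      let ?f = "hit_prob D T n" and ?N = "real q * real (card (vertices K L))"
      define c where "c = exp (- \<beta> * real_of_int \<Phi>) / ?N"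
      have "?f (last \<omega>0) = 0"
        using DT path(1) \<omega>0(4) by (cases n) auto
      moreover have "?f (hd \<omega>0) - ?f (last \<omega>0) \<le> real (length \<omega>0) * sqrt (dirichlet ?f ?f / c)" if N: "0 < ?N"
      proof (rule dirichlet_path_bound[OF _ \<omega>0(2) _ \<omega>0(1)])
        show "0 < c" using N by (simp add: c_def)
        fix i assume i: "Suc i < length \<omega>0" "\<omega>0 ! i \<noteq> \<omega>0 ! Suc i"
        have mem: "\<omega>0 ! i \<in> set \<omega>0" "\<omega>0 ! Suc i \<in> set \<omega>0" using i(1) by auto
        let ?d = "card {v \<in> vertices K L. (\<omega>0 ! i) v \<noteq> (\<omega>0 ! Suc i) v}"
        have "0 < connectivity q K L (\<omega>0 ! i) (\<omega>0 ! Suc i)" by (rule \<omega>0(5)[OF i(1)])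
        then have "connectivity q K L (\<omega>0 ! i) (\<omega>0 ! Suc i) = 1 / ?N"
          using connectivity_distinct[OF subsetD[OF \<omega>0(2) mem(1)] subsetD[OF \<omega>0(2) mem(2)] i(2)]
          by (cases "?d = 1") simp_all
        moreover have "- \<beta> * real_of_int \<Phi> \<le>
            - \<beta> * real_of_int (max (energy K L (\<omega>0 ! i)) (energy K L (\<omega>0 ! Suc i)))"
          using path(3)[OF mem(1)] path(3)[OF mem(2)] \<beta> by (intro mult_left_mono_neg) auto
        ultimately have "c \<le> connectivity q K L (\<omega>0 ! i) (\<omega>0 ! Suc i) *
            exp (- \<beta> * real_of_int (max (energy K L (\<omega>0 ! i)) (energy K L (\<omega>0 ! Suc i))))"
          using N unfolding c_def by (simp add: divide_right_mono)
        then show "c \<le> ?w (\<omega>0 ! i) * ?P (\<omega>0 ! i) (\<omega>0 ! Suc i)"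
          using i(2) by (simp add: transition_prob_def boltzmann_rate)
      qed
      moreover have "dirichlet ?f ?f / c \<le> C * exp (- \<beta>)" if N: "0 < ?N"
      proof -
        have "?w \<xi> \<le> exp (- \<beta> * (real_of_int \<Phi> + 1))" if "\<xi> \<in> D" for \<xi>
          using that \<beta> unfolding D_def boltzmann_def by simp
        then have "(\<Sum>\<xi>\<in>?S \<inter> D. ?w \<xi>) \<le> (\<Sum>\<xi>\<in>?S \<inter> D. exp (- \<beta> * (real_of_int \<Phi> + 1)))"
          by (intro sum_mono) auto
        also have "\<dots> = real (card (?S \<inter> D)) * exp (- \<beta> * (real_of_int \<Phi> + 1))" by simp
        also have "\<dots> \<le> real (card ?S) * exp (- \<beta> * (real_of_int \<Phi> + 1))"
          using finite_configs by (intro mult_right_mono) (auto intro: card_mono)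
        finally have "dirichlet ?f ?f \<le> 2 * (real (card ?S) * exp (- \<beta> * (real_of_int \<Phi> + 1)))"
          using dirichlet_hit_prob[OF DT, of n] by linarith
        also have "\<dots> = 2 * real (card ?S) * (exp (- \<beta> * real_of_int \<Phi>) * exp (- \<beta>))"
          by (simp add: exp_add[symmetric] algebra_simps)
        also have "\<dots> = C * exp (- \<beta>) * c"
        proof -
          have "real q \<noteq> 0" "real (card (vertices K L)) \<noteq> 0" using N by fastforce+
          then show ?thesis by (simp add: C_def c_def)
        qed
        finally have "dirichlet ?f ?f \<le> C * exp (- \<beta>) * c" .
        moreover have "0 < c" using N by (simp add: c_def)
        ultimately show ?thesis by (simp only: pos_divide_le_eq)
      qed
      moreover have "0 < ?N"
      proof -
        have "finite (vertices K L)" by (simp add: vertices_def)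
        then show ?thesis using q V by (simp add: card_gt_0_iff)
      qed
      ultimately have "?f (hd \<omega>0) \<le> real (length \<omega>0) * sqrt (dirichlet ?f ?f / c)"
        "sqrt (dirichlet ?f ?f / c) \<le> sqrt (C * exp (- \<beta>))" by auto
      then show ?thesis unfolding B_def \<omega>0(3) by (meson mult_left_mono of_nat_0_le_iff order_trans)
    qed
    have lower: "1 - avoid_prob T n \<sigma> - B \<beta> \<le> prob_hits_before (M \<beta>) (X \<beta>) W T" for n
    proof -
      have "1 - avoid_prob T n \<sigma> - hit_prob D T n \<sigma> \<le> measure (M \<beta>) {\<omega> \<in> space (M \<beta>).
          \<exists>m>0. X \<beta> m \<omega> \<in> W \<and> (\<forall>t. 0 < t \<and> t \<le> m \<longrightarrow> X \<beta> t \<omega> \<notin> T)}"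
      proof (rule measure_hit_lower_bound[OF chain \<sigma>])
        fix xs assume xs: "xs \<noteq> []" "set xs \<subseteq> ?S - D" "hd xs = \<sigma>" "last xs \<in> T"
          "\<And>i. Suc i < length xs \<Longrightarrow> 0 < ?P (xs ! i) (xs ! Suc i)"
        have "xs ! i \<in> ?S" if "i < length xs" for i using xs(2) that by (auto dest: nth_mem)
        then have "0 < connectivity q K L (xs ! i) (xs ! Suc i)" if "Suc i < length xs" for i
          using transition_prob_connectivity[OF q _ xs(5)[OF that]] that by simp
        then have "xs \<in> paths q K L \<sigma> (last xs)"
          using xs unfolding paths_def by auto
        moreover have "energy K L \<xi> \<le> \<Phi>" if "\<xi> \<in> set xs" for \<xi> using xs(2) that unfolding D_def by force
        ultimately show "\<exists>y\<in>set xs. y \<in> W \<and> y \<noteq> \<sigma> \<and> y \<notin> T" using gate xs(4) by blast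
      qed
      then show ?thesis using hit[of n] unfolding prob_hits_before_def hitting_time_less_iff by linarith
    qed
    have "(\<lambda>n. avoid_prob T n \<sigma>) \<longlonglongrightarrow> 0"
    proof (rule avoid_prob_tendsto_0[OF _ \<sigma>])
      fix x assume x: "x \<in> ?S" "x \<notin> T"
      then have "x \<noteq> const_config K L t0" using T(2) by metis
      then show "\<exists>y\<in>?S. 0 < ?P x y \<and> card {v \<in> vertices K L. y v \<noteq> t0} < card {v \<in> vertices K L. x v \<noteq> t0}"
        by (rule transition_towards_const[OF q x(1) _ T(3)])
    qed
    then have "(\<lambda>n. 1 - avoid_prob T n \<sigma> - B \<beta>) \<longlonglongrightarrow> 1 - 0 - B \<beta>" by (intro tendsto_intros)
    then show ?thesis using lower by (intro LIMSEQ_le_const2[of _ "1 - B \<beta>"]) auto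
  qed
  have "((\<lambda>\<beta>::real. exp (- \<beta>)) \<longlongrightarrow> 0) at_top"
    by (rule filterlim_compose[OF exp_at_bot filterlim_uminus_at_bot_at_top])
  then have "((\<lambda>\<beta>. 1 - B \<beta>) \<longlongrightarrow> 1 - real (length \<omega>0) * sqrt (C * 0)) at_top"
    unfolding B_def by (intro tendsto_intros)
  then have lim: "((\<lambda>\<beta>. 1 - B \<beta>) \<longlongrightarrow> 1) at_top" by simp
  show ?thesis
  proof (rule tendsto_sandwich[OF _ _ lim tendsto_const])
    show "\<forall>\<^sub>F \<beta> in at_top. 1 - B \<beta> \<le> prob_hits_before (M \<beta>) (X \<beta>) W T"
      using eventually_gt_at_top[of 0] by eventually_elim (rule bound)
    show "\<forall>\<^sub>F \<beta> in at_top. prob_hits_before (M \<beta>) (X \<beta>) W T \<le> 1"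
      using eventually_gt_at_top[of 0]
    proof eventually_elim
      fix \<beta> :: real assume "0 < \<beta>"
      then interpret prob_space "M \<beta>" using X by (simp add: metropolis_chain_def)
      show "prob_hits_before (M \<beta>) (X \<beta>) W T \<le> 1" by (simp add: prob_hits_before_def)
    qed
  qed
qed

section \<open>Cyclic words\<close>

definition cyc_defects :: "nat \<Rightarrow> (nat \<Rightarrow> 'a) \<Rightarrow> nat" where
  "cyc_defects n f = card {j. j < n \<and> f j \<noteq> f (Suc j mod n)}"

definition cyc_arc :: "nat \<Rightarrow> nat \<Rightarrow> nat \<Rightarrow> nat set" where
  "cyc_arc n p a = (\<lambda>x. (p + x) mod n) ` {..<a}"

lemma inj_on_rotate: "inj_on (\<lambda>x. (p + x) mod n) {..<n::nat}"
proof (rule inj_onI)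
  fix x y assume xy: "x \<in> {..<n}" "y \<in> {..<n}" and e: "(p + x) mod n = (p + y) mod n"
  have "(int p + int x) mod int n = (int p + int y) mod int n"
    using arg_cong[OF e, of int] by (simp add: zmod_int)
  then have "int x mod int n = int y mod int n"
    by (metis add.commute mod_add_left_eq mod_add_cong add_diff_cancel_left' mod_diff_left_eq mod_diff_cong)
  then show "x = y" using xy by simp
qed

lemma bij_betw_rotate:
  assumes "0 < n" shows "bij_betw (\<lambda>x. (p + x) mod n) {..<n} {..<n::nat}"
proof -
  have "(\<lambda>x. (p + x) mod n) ` {..<n} = {..<n}"
    using assms by (intro endo_inj_surj inj_on_rotate) auto
  then show ?thesis by (simp add: bij_betw_def inj_on_rotate)
qed

lemma rotate_cases:
  assumes "j < (n::nat)" obtains x where "x < n" "j = (p + x) mod n"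
  using bij_betw_rotate[of n p] assms unfolding bij_betw_def
  by (metis (no_types, lifting) imageE lessThan_iff less_nat_zero_code not_gr_zero)

lemma rotate_eq_iff:
  "x < n \<Longrightarrow> y < n \<Longrightarrow> (p + x) mod n = (p + y) mod n \<longleftrightarrow> x = (y::nat)"
  using inj_onD[OF inj_on_rotate] by (metis lessThan_iff)

lemma mem_arc_iff:
  assumes "x < n" "a \<le> n" shows "(p + x) mod n \<in> cyc_arc n p a \<longleftrightarrow> x < a"
  unfolding cyc_arc_def using assms rotate_eq_iff by fastforce

lemma arc_subset: "0 < n \<Longrightarrow> cyc_arc n p a \<subseteq> {..<n}"
  by (auto simp: cyc_arc_def)

lemma finite_arc [simp]: "finite (cyc_arc n p a)"
  by (simp add: cyc_arc_def)

lemma card_arc: "a \<le> n \<Longrightarrow> card (cyc_arc n p a) = a"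
  unfolding cyc_arc_def by (subst card_image) (auto intro: inj_on_subset[OF inj_on_rotate])

lemma arc_full: "0 < n \<Longrightarrow> cyc_arc n p n = {..<n}"
  using bij_betw_rotate[of n p] by (simp add: cyc_arc_def bij_betw_def)

lemma arc_mod: "cyc_arc n (p mod n) a = cyc_arc n p a"
  by (simp add: cyc_arc_def mod_simps)

lemma arc_1: "cyc_arc n p (Suc 0) = {p mod n}"
  by (auto simp: cyc_arc_def)

lemma arc_add: "cyc_arc n p (a + b) = cyc_arc n p a \<union> cyc_arc n (p + a) b"
proof -
  have "{..<a + b} = {..<a} \<union> (+) a ` {..<b}"
    by (auto simp: lessThan_atLeast0 image_add_atLeastLessThan ivl_disj_un)
  then show ?thesis by (simp add: cyc_arc_def image_Un image_image add.assoc)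
qed

lemma arc_Suc_left: "cyc_arc n p (Suc a) = insert (p mod n) (cyc_arc n (Suc p) a)"
  using arc_add[of n p 1 a] by (simp add: arc_1)

lemma arc_Suc_right: "cyc_arc n p (Suc a) = insert ((p + a) mod n) (cyc_arc n p a)"
  using arc_add[of n p a 1] by (simp add: arc_1)

lemma arc_complement_point:
  assumes "m < n" shows "cyc_arc n (Suc m) (n - 1) = {..<n} - {m}"
proof -
  have n: "0 < n" "Suc (n - 1) = n" using assms by auto
  have "cyc_arc n m n = insert m (cyc_arc n (Suc m) (n - 1))"
    using arc_Suc_left[of n m "n - 1"] n assms by simp
  moreover have "m \<notin> cyc_arc n (Suc m) (n - 1)"
  proof -
    have "(Suc m + (n - 1)) mod n = m" using assms by simp
    then show ?thesis using mem_arc_iff[of "n - 1" n "n - 1" "Suc m"] n by simp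
  qed
  ultimately show ?thesis using arc_full[OF n(1), of m] by blast
qed

text \<open>Cutting the cycle at \<open>m\<close> turns it into the interval of the \<open>n - 1\<close> positions from \<open>Suc m\<close> on, and an
arc that avoids \<open>m\<close> into a subinterval.\<close>

lemma arc_avoiding_point:
  assumes m: "m < n" "m \<notin> cyc_arc n b h" and h: "h < n"
  obtains k where "k + h \<le> n - 1" "cyc_arc n b h = cyc_arc n (Suc m mod n + k) h"
proof -
  have "b mod n < n" using m by simp
  then obtain k where k: "k < n" "b mod n = (Suc m + k) mod n" by (rule rotate_cases)
  have eq: "cyc_arc n b h = cyc_arc n (Suc m mod n + k) h"
    using k(2) arc_mod[of n b h] arc_mod[of n "Suc m mod n + k" h] by (simp add: mod_simps)
  have "k + h \<le> n - 1"
  proof (rule ccontr)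
    assume "\<not> k + h \<le> n - 1"
    then have x: "n - 1 - k < h" "k + (n - 1 - k) = n - 1" using k by auto
    have "(Suc m mod n + k + (n - 1 - k)) mod n = (Suc m + (n - 1)) mod n"
      using x(2) by (simp add: mod_simps add.assoc)
    also have "\<dots> = m" using m by simp
    finally have "m \<in> cyc_arc n (Suc m mod n + k) h"
      using x(1) unfolding cyc_arc_def by (metis image_eqI lessThan_iff)
    then show False using m(2) eq by simp
  qed
  then show ?thesis using that eq by blast
qed

lemma cyc_defects_rotate:
  assumes "0 < n" shows "cyc_defects n (\<lambda>x. f ((p + x) mod n)) = cyc_defects n f"
proof -
  let ?r = "\<lambda>x. (p + x) mod n"
  have s: "?r (Suc x mod n) = Suc (?r x) mod n" for x by (simp add: mod_simps)
  have "?r ` {j. j < n \<and> f (?r j) \<noteq> f (?r (Suc j mod n))} = {j. j < n \<and> f j \<noteq> f (Suc j mod n)}"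
    (is "_ = ?B")
  proof
    show "?B \<subseteq> ?r ` {j. j < n \<and> f (?r j) \<noteq> f (?r (Suc j mod n))}"
    proof
      fix j assume j: "j \<in> ?B"
      then obtain x where x: "x < n" "j = ?r x" using rotate_cases by blast
      then show "j \<in> ?r ` {j. j < n \<and> f (?r j) \<noteq> f (?r (Suc j mod n))}"
        using j unfolding s by blast
    qed
  qed (use assms in \<open>auto simp: s\<close>)
  then have "cyc_defects n f = card (?r ` {j. j < n \<and> f (?r j) \<noteq> f (?r (Suc j mod n))})"
    unfolding cyc_defects_def by simp
  moreover have "inj_on ?r {j. j < n \<and> f (?r j) \<noteq> f (?r (Suc j mod n))}"
    by (rule inj_on_subset[OF inj_on_rotate]) auto
  ultimately show ?thesis unfolding cyc_defects_def by (simp add: card_image)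
qed

lemma cyc_defects_cong:
  assumes "\<And>j. j < n \<Longrightarrow> f j = g j" shows "cyc_defects n f = cyc_defects n g"
proof -
  have "f j = g j \<and> f (Suc j mod n) = g (Suc j mod n)" if "j < n" for j
    using assms[of j] assms[of "Suc j mod n"] that by simp
  then show ?thesis unfolding cyc_defects_def by (metis (no_types, lifting))
qed

lemma const_of_steps:
  assumes "\<And>x. a \<le> x \<Longrightarrow> x < b \<Longrightarrow> g (Suc x) = g x" "a \<le> y" "y \<le> (b::nat)"
  shows "g y = g a"
  using assms(2,3) by (induction y rule: dec_induct) (auto simp: assms(1))

text \<open>Read from just behind its only defect, the word does not change until it is back at that defect;
so it would be constant.\<close>

lemma cyc_defects_ge_2:
  assumes "j < n" "k < n" "f j \<noteq> f k" shows "2 \<le> cyc_defects n f"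
proof (rule ccontr)
  assume neg: "\<not> ?thesis"
  let ?D = "{j. j < n \<and> f j \<noteq> f (Suc j mod n)}"
  have n: "0 < n" using assms by simp
  have c: "card ?D \<le> 1" using neg by (simp add: cyc_defects_def)
  obtain p where p: "p < n" "?D \<subseteq> {p}"
  proof (cases "?D = {}")
    case True then show ?thesis using that n by blast
  next
    case False
    then obtain p where pD: "p \<in> ?D" by blast
    have "\<forall>d\<in>?D. d = p" using c pD card_le_Suc0_iff_eq[of ?D] by simp
    then show ?thesis using that[of p] pD by blast
  qed
  let ?g = "\<lambda>x. f ((Suc p + x) mod n)"
  have step: "?g (Suc x) = ?g x" if "0 \<le> x" "x < n - 1" for x
  proof -
    have "(Suc p + x) mod n = (p + Suc x) mod n" by simp
    moreover have "(p + Suc x) mod n \<noteq> (p + 0) mod n"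
      using that rotate_eq_iff[of "Suc x" n 0 p] by simp
    ultimately have "(Suc p + x) mod n \<noteq> p" using p by simp
    then have "(Suc p + x) mod n \<notin> ?D" using p(2) by blast
    moreover have "(Suc p + x) mod n < n" using n by simp
    ultimately have "f (Suc ((Suc p + x) mod n) mod n) = f ((Suc p + x) mod n)" by simp
    then show ?thesis by (simp only: mod_Suc_eq add_Suc_right)
  qed
  have c: "f i = ?g 0" if "i < n" for i
  proof -
    obtain x where "x < n" "i = (Suc p + x) mod n" using rotate_cases[OF \<open>i < n\<close>] by blast
    then show ?thesis using const_of_steps[of 0 "n-1" ?g x] step by simp
  qed
  show False using c[OF assms(1)] c[OF assms(2)] assms(3) by simp
qed

text \<open>Start reading at a \<open>u\<close> that is preceded by another letter. This uses up one of the two defects, and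
the other one ends the run of \<open>u\<close>.\<close>

lemma cyc_two_arcs:
  assumes d: "cyc_defects n f = 2" and "ju < n" "f ju = u" "js < n" "f js = s" "s \<noteq> u"
  obtains p a where "1 \<le> a" "a < n" "\<And>j. j < n \<Longrightarrow> f j = (if j \<in> cyc_arc n p a then u else s)"
proof -
  have n: "0 < n" using assms by simp
  have "\<exists>x. f ((js + x) mod n) = u"
    using rotate_cases[OF assms(2), of js] assms(3) by metis
  then obtain x0 where x0: "f ((js + x0) mod n) = u" "\<And>x. x < x0 \<Longrightarrow> f ((js + x) mod n) \<noteq> u"
    using exists_least_iff[of "\<lambda>x. f ((js + x) mod n) = u"] by blast
  have x0': "0 < x0" using x0(1) assms by (cases x0) auto
  define p where "p = js + x0"
  define g where "g = (\<lambda>x. f ((p + x) mod n))"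
  have g0: "g 0 = u" by (simp add: g_def p_def x0)
  have "p + (n - 1) = (js + (x0 - 1)) + n" using x0' n by (simp add: p_def)
  then have "(p + (n - 1)) mod n = (js + (x0 - 1)) mod n" by (metis mod_add_self2)
  then have gn: "g (n - 1) \<noteq> u" using x0(2)[of "x0 - 1"] x0' unfolding g_def by simp
  then have "\<exists>a. g a \<noteq> u" by blast
  then obtain a where a: "g a \<noteq> u" "\<And>x. x < a \<Longrightarrow> g x = u"
    using exists_least_iff[of "\<lambda>x. g x \<noteq> u"] by blast
  have a1: "1 \<le> a" using a(1) g0 by (cases a) auto
  have an: "a < n" using a(2)[of "n-1"] gn n by (metis Suc_pred' linorder_neqE_nat less_Suc_eq_le not_le n le_less_linear less_le_not_le)
  let ?D = "{j. j < n \<and> g j \<noteq> g (Suc j mod n)}"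
  have D2: "card ?D = 2"
    using d cyc_defects_rotate[OF n, of f p] by (simp add: cyc_defects_def g_def)
  have sub: "{a - 1, n - 1} \<subseteq> ?D" using a1 an a(1) a(2)[of "a-1"] gn g0 by auto
  have "card {a - 1, n - 1} = 2" using a1 an by auto
  then have "{a - 1, n - 1} = ?D" using D2 by (intro card_subset_eq[OF _ sub]) simp_all
  then have Deq: "?D = {a - 1, n - 1}" ..
  have step: "g (Suc x) = g x" if "a \<le> x" "x < n - 1" for x
  proof -
    have "x \<notin> ?D" using that Deq a1 by auto
    then show ?thesis using that by simp
  qed
  have ga: "g x = g a" if "a \<le> x" "x < n" for x
    using const_of_steps[of a "n-1" g x] step that by simp
  have "g a = s"
  proof -
    obtain x where x: "x < n" "js = (p + x) mod n" using rotate_cases[OF assms(4)] by blast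
    then have "g x = s" using assms by (simp add: g_def)
    then show ?thesis using ga[of x] a(2)[of x] x assms(6) by (metis not_le)
  qed
  then have "f j = (if j \<in> cyc_arc n p a then u else s)" if "j < n" for j
  proof -
    obtain x where x: "x < n" "j = (p + x) mod n" using rotate_cases[OF \<open>j < n\<close>] by blast
    have "f j = g x" by (simp add: g_def x)
    then show ?thesis using x mem_arc_iff[of x n a p] an ga[of x] a(2)[of x] \<open>g a = s\<close>
      by (metis less_imp_le not_le)
  qed
  then show ?thesis using that a1 an by blast
qed

lemma cyc_defects_const: "(\<And>j. j < n \<Longrightarrow> f j = c) \<Longrightarrow> cyc_defects n f = 0"
  by (simp add: cyc_defects_def) 

lemma cyc_defects_initial_segment:
  assumes "\<And>j. j < n \<Longrightarrow> f j = (if j < m then u else s)"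
  shows "cyc_defects n f \<le> 2"
proof -
  have "{j. j < n \<and> f j \<noteq> f (Suc j mod n)} \<subseteq> {m - 1, n - 1}"
  proof
    fix j assume j: "j \<in> {j. j < n \<and> f j \<noteq> f (Suc j mod n)}"
    have "j = m - 1" if "j \<noteq> n - 1"
    proof -
      have "Suc j < n" using j that by auto
      then show ?thesis using j assms[of j] assms[of "Suc j"] by (auto split: if_splits)
    qed
    then show "j \<in> {m - 1, n - 1}" by blast
  qed
  then have "cyc_defects n f \<le> card {m - 1, n - 1}"
    unfolding cyc_defects_def by (intro card_mono) auto
  also have "\<dots> \<le> 2" by (simp add: card_insert_if)
  finally show ?thesis .
qed

section \<open>Energy\<close>

text \<open>The number of disagreeing edges, sorted by rows and columns.\<close>

definition excess :: "nat \<Rightarrow> nat \<Rightarrow> config \<Rightarrow> nat" where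
  "excess K L \<sigma> = (\<Sum>i<K. cyc_defects L (\<lambda>j. \<sigma> (i, j))) + (\<Sum>j<L. cyc_defects K (\<lambda>i. \<sigma> (i, j)))"

lemma cyc_pair_eqD:
  assumes n: "3 \<le> n" "j < n" "k < n" and j: "j = Suc k mod n" and k: "k = Suc j mod n" shows False
proof -
  have S: "Suc i mod n = (if Suc i = n then 0 else Suc i)" if "i < n" for i
    using that by (auto simp: mod_Suc)
  have "(Suc k = n \<and> j = 0) \<or> j = Suc k" using trans[OF j S[OF n(3)]] by metis
  moreover have "(Suc j = n \<and> k = 0) \<or> k = Suc j" using trans[OF k S[OF n(2)]] by metis
  ultimately show False using n(1) by (elim disjE conjE) linarith+
qed

lemma sum_agreements:
  "(\<Sum>j<n. of_bool (f j = f (Suc j mod n))) = int n - int (cyc_defects n f)"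
proof -
  have "(\<Sum>j<n. of_bool (f j = f (Suc j mod n))) = (\<Sum>j<n. 1 - (of_bool (f j \<noteq> f (Suc j mod n)) :: int))"
    by (rule sum.cong) simp_all
  also have "\<dots> = int n - int (cyc_defects n f)"
    by (simp add: sum_subtractf cyc_defects_def Collect_conj_eq lessThan_def)
  finally show ?thesis .
qed

text \<open>From length 3 on, a cycle has as many edges as vertices; so there are \<open>2 * K * L\<close> edges, and each
of them belongs to exactly one position of one row or column.\<close>

lemma energy_eq_excess:
  assumes "3 \<le> K" "3 \<le> L"
  shows "energy K L \<sigma> = int (excess K L \<sigma>) - 2 * int K * int L"
proof -
  define hz where "hz = (\<lambda>(i::nat, j). {(i, j), (i, Suc j mod L)})"
  define vt where "vt = (\<lambda>(i, j::nat). {(i, j), (Suc i mod K, j)})"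
  let ?V = "{..<K} \<times> {..<L}"
  have ne: "Suc j mod n \<noteq> j" if "3 \<le> n" "j < n" for j n :: nat
    using that by (auto simp: mod_Suc)
  have E: "edges K L = hz ` ?V \<union> vt ` ?V"
  proof
    show "edges K L \<subseteq> hz ` ?V \<union> vt ` ?V"
    proof
      fix e assume "e \<in> edges K L"
      then obtain v w where e: "e = {v, w}" "v \<in> ?V" "w \<in> ?V" "nearest_neighbours K L v w"
        by (auto simp: edges_def vertices_def atLeast0LessThan)
      obtain i j i' j' where vw: "v = (i, j)" "w = (i', j')" by fastforce
      have h: "hz v = {(i, j), (i, Suc j mod L)}" "hz w = {(i', j'), (i', Suc j' mod L)}"
        "vt v = {(i, j), (Suc i mod K, j)}" "vt w = {(i', j'), (Suc i' mod K, j')}"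
        by (simp_all add: hz_def vt_def vw)
      consider "i = i'" "j' = Suc j mod L" | "i = i'" "j = Suc j' mod L"
        | "j = j'" "i' = Suc i mod K" | "j = j'" "i = Suc i' mod K"
        using e(4) unfolding vw nearest_neighbours_def cyc_adj_def fst_conv snd_conv by blast
      then have "e = hz v \<or> e = hz w \<or> e = vt v \<or> e = vt w"
        unfolding h unfolding e(1) vw by cases (simp_all only: insert_commute simp_thms)
      then show "e \<in> hz ` ?V \<union> vt ` ?V" using e by blast
    qed
    have m: "x mod K < K" "x mod L < L" for x using assms by auto
    have "{v, w} \<in> edges K L" if "v \<in> ?V" "w \<in> ?V" "nearest_neighbours K L v w" for v w
      using that unfolding edges_def vertices_def atLeast0LessThan by blast
    moreover have "nearest_neighbours K L (i, j) (i, Suc j mod L)"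
      "nearest_neighbours K L (i, j) (Suc i mod K, j)" for i j
      by (simp_all add: nearest_neighbours_def cyc_adj_def)
    ultimately have "hz (i, j) \<in> edges K L" "vt (i, j) \<in> edges K L" if "i < K" "j < L" for i j
      unfolding hz_def vt_def prod.case using m that by (metis lessThan_iff mem_Times_iff fst_conv snd_conv)+
    then show "hz ` ?V \<union> vt ` ?V \<subseteq> edges K L" by auto
  qed
  have ih: "inj_on hz ?V"
  proof (rule inj_onI)
    fix v w assume "v \<in> ?V" "w \<in> ?V" and eq: "hz v = hz w"
    then obtain i j i' j' where vw: "v = (i, j)" "w = (i', j')" "j < L" "j' < L" by blast
    have "\<not> (j = Suc j' mod L \<and> Suc j mod L = j')" using cyc_pair_eqD[OF assms(2) vw(3,4)] by metis
    then show "v = w" using eq unfolding hz_def vw(1,2) prod.case doubleton_eq_iff prod.inject by blast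
  qed
  have iv: "inj_on vt ?V"
  proof (rule inj_onI)
    fix v w assume "v \<in> ?V" "w \<in> ?V" and eq: "vt v = vt w"
    then obtain i j i' j' where vw: "v = (i, j)" "w = (i', j')" "i < K" "i' < K" by blast
    have "\<not> (i = Suc i' mod K \<and> Suc i mod K = i')" using cyc_pair_eqD[OF assms(1) vw(3,4)] by metis
    then show "v = w" using eq unfolding vt_def vw(1,2) prod.case doubleton_eq_iff prod.inject by blast
  qed
  have "hz (i, j) \<noteq> vt (i', j')" if "i' < K" for i j i' j'
    using ne[OF assms(1) that] unfolding hz_def vt_def prod.case doubleton_eq_iff prod.inject by metis
  then have dj: "hz ` ?V \<inter> vt ` ?V = {}" by blast
  have fV: "finite ?V" by simp
  let ?b = "\<lambda>e. of_bool (\<forall>v\<in>e. \<forall>w\<in>e. \<sigma> v = \<sigma> w) :: int"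
  have b2: "?b {x, y} = of_bool (\<sigma> x = \<sigma> y)" for x y by auto
  have "(\<Sum>e\<in>edges K L. ?b e) = (\<Sum>v\<in>?V. ?b (hz v)) + (\<Sum>v\<in>?V. ?b (vt v))"
    unfolding E sum.union_disjoint[OF finite_imageI[OF fV] finite_imageI[OF fV] dj] sum.reindex[OF ih] sum.reindex[OF iv] comp_def ..
  also have "(\<Sum>v\<in>?V. ?b (hz v)) = (\<Sum>i<K. \<Sum>j<L. of_bool (\<sigma> (i, j) = \<sigma> (i, Suc j mod L)))"
    unfolding sum.cartesian_product hz_def by (intro sum.cong refl) (simp only: case_prod_beta b2)
  also have "\<dots> = (\<Sum>i<K. int L - int (cyc_defects L (\<lambda>j. \<sigma> (i, j))))"
    by (intro sum.cong refl sum_agreements[of "\<lambda>j. \<sigma> (_, j)"])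
  also have "(\<Sum>v\<in>?V. ?b (vt v)) = (\<Sum>i<K. \<Sum>j<L. of_bool (\<sigma> (i, j) = \<sigma> (Suc i mod K, j)))"
    unfolding sum.cartesian_product vt_def by (intro sum.cong refl) (simp only: case_prod_beta b2)
  also have "\<dots> = (\<Sum>j<L. \<Sum>i<K. of_bool (\<sigma> (i, j) = \<sigma> (Suc i mod K, j)))"
    by (rule sum.swap)
  also have "\<dots> = (\<Sum>j<L. int K - int (cyc_defects K (\<lambda>i. \<sigma> (i, j))))"
    by (intro sum.cong refl sum_agreements[of "\<lambda>i. \<sigma> (i, _)"])
  finally show ?thesis
    by (simp add: energy_def excess_def sum_subtractf algebra_simps)
qed

section \<open>Configurations of low energy\<close>

lemma block_eq: "block K L i j a b = cyc_arc K i b \<times> cyc_arc L j a"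
  by (auto simp: block_def cyc_arc_def)

lemma list_crossing:
  assumes "xs \<noteq> []" "hd xs \<in> A" "last xs \<notin> A"
    and "\<And>i. Suc i < length xs \<Longrightarrow> xs ! i \<in> A \<Longrightarrow> xs ! i \<notin> G \<Longrightarrow> xs ! Suc i \<in> A \<union> G"
  shows "set xs \<inter> G \<noteq> {}"
  using assms
proof (induction xs)
  case (Cons x xs)
  show ?case
  proof (cases "x \<in> G \<or> xs = []")
    case True then show ?thesis using Cons.prems by auto
  next
    case False
    then have "hd xs \<in> A \<union> G" using Cons.prems(2) Cons.prems(4)[of 0] by (simp add: hd_conv_nth)
    moreover have "set xs \<inter> G \<noteq> {}" if "hd xs \<in> A"
      using False Cons.prems that by (intro Cons.IH) force+
    moreover have "hd xs \<in> set xs" using False by simp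
    ultimately show ?thesis by auto
  qed
qed simp

locale torus =
  fixes K L :: nat
  assumes K3: "3 \<le> K" and KL: "K < L"
begin

lemma L4: "4 \<le> L" using K3 KL by simp

abbreviation row_defects :: "config \<Rightarrow> nat \<Rightarrow> nat" where
  "row_defects \<sigma> i \<equiv> cyc_defects L (\<lambda>j. \<sigma> (i, j))"

abbreviation col_defects :: "config \<Rightarrow> nat \<Rightarrow> nat" where
  "col_defects \<sigma> j \<equiv> cyc_defects K (\<lambda>i. \<sigma> (i, j))"

text \<open>The bound is the excess of a vertical strip with a bar.\<close>

definition low :: "config \<Rightarrow> bool" where
  "low \<sigma> \<longleftrightarrow> excess K L \<sigma> \<le> 2 * K + 2"

definition const_col :: "nat \<Rightarrow> config \<Rightarrow> bool" where
  "const_col s \<sigma> \<longleftrightarrow> (\<exists>j<L. \<forall>i<K. \<sigma> (i, j) = s)"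

definition spin_count :: "nat \<Rightarrow> config \<Rightarrow> nat" where
  "spin_count u \<sigma> = card {v \<in> vertices K L. \<sigma> v = u}"

text \<open>Columns \<open>p, \<dots>, p + a - 1\<close> carry \<open>u\<close>, and so does an arc of \<open>h\<close> sites of the neighbouring column \<open>c\<close>;
the rest is \<open>s\<close>. The plain strip is the case \<open>h = 0\<close>; otherwise at least one further column is left
to \<open>s\<close>.\<close>

definition droplet :: "nat \<Rightarrow> nat \<Rightarrow> nat \<Rightarrow> nat \<Rightarrow> nat \<Rightarrow> nat \<Rightarrow> nat \<Rightarrow> config \<Rightarrow> bool" where
  "droplet s u p a c b h \<sigma> \<longleftrightarrow> p < L \<and> b < K \<and> 1 \<le> a \<and> a < L \<and> h < K \<and> (h \<noteq> 0 \<longrightarrow> Suc a < L)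
     \<and> (c = p + a \<or> c = p + L - 1)
     \<and> (\<forall>i<K. \<forall>j<L. \<sigma> (i, j) = (if j \<in> cyc_arc L p a \<or> j = c mod L \<and> i \<in> cyc_arc K b h then u else s))"

lemma low_bound:
  assumes "low \<sigma>"
  shows "(\<Sum>i<K. row_defects \<sigma> i) + (\<Sum>j<L. col_defects \<sigma> j) \<le> 2 * K + 2"
  using assms by (simp add: low_def excess_def)

lemma two_spin_configI:
  assumes "\<sigma> \<in> configs q K L" "\<And>i j. i < K \<Longrightarrow> j < L \<Longrightarrow> \<sigma> (i, j) = (if (i, j) \<in> C then u else s)"
  shows "\<sigma> = two_spin_config K L s u C"
proof
  fix v show "\<sigma> v = two_spin_config K L s u C v"
  proof (cases "v \<in> vertices K L")
    case True
    then show ?thesis using assms(2)[of "fst v" "snd v"] by (cases v) (simp add: two_spin_config_def vertices_def)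
  next
    case False
    then have "\<sigma> v = undefined" using assms(1) unfolding configs_def by (rule PiE_arb[rotated])
    then show ?thesis using False by (simp add: two_spin_config_def)
  qed
qed

lemma bar_column_notin_arc:
  assumes "1 \<le> a" "a < L" "c = p + a \<or> c = p + L - 1"
  shows "c mod L \<notin> cyc_arc L p a"
proof -
  have "p + L - 1 = p + (L - 1)" using L4 by simp
  then have "c mod L = (p + a) mod L \<or> c mod L = (p + (L - 1)) mod L" using assms(3) by metis
  moreover have "(p + a) mod L \<notin> cyc_arc L p a" using mem_arc_iff[of a L a p] assms by simp
  moreover have "(p + (L - 1)) mod L \<notin> cyc_arc L p a" using mem_arc_iff[of "L - 1" L a p] assms by simp
  ultimately show ?thesis by metis
qed

lemma droplet_Bbar:
  assumes "\<sigma> \<in> configs q K L" "droplet s u p a c b h \<sigma>" "0 < h"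
  shows "\<sigma> \<in> Bbar K L h a K s u"
proof -
  have d: "p < L" "b < K" "h < K" "c = p + a \<or> c = p + L - 1"
    and e: "\<And>i j. i < K \<Longrightarrow> j < L \<Longrightarrow> \<sigma> (i, j) = (if j \<in> cyc_arc L p a \<or> j = c mod L \<and> i \<in> cyc_arc K b h then u else s)"
    using assms(2) unfolding droplet_def by auto
  have K0: "0 < K" using K3 by simp
  have "\<sigma> = two_spin_config K L s u (block K L b p a K \<union> block K L (b + 0) c 1 h)"
    using e K0 by (intro two_spin_configI[OF assms(1)]) (auto simp: block_eq arc_full arc_1)
  moreover have "(b, p) \<in> vertices K L" using d by (simp add: vertices_def)
  moreover have "1 \<le> h" "h \<le> K - 1" "0 + h \<le> K" "c \<in> {p + a, p + L - 1}" using d assms(3) by auto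
  ultimately show ?thesis unfolding Bbar_def by blast
qed

lemma droplet_spin_count:
  assumes "droplet s u p a c b h \<sigma>" "s \<noteq> u"
  shows "spin_count u \<sigma> = a * K + h"
proof -
  have d: "1 \<le> a" "a < L" "h < K" "c = p + a \<or> c = p + L - 1"
    and e: "\<And>i j. i < K \<Longrightarrow> j < L \<Longrightarrow> \<sigma> (i, j) = (if j \<in> cyc_arc L p a \<or> j = c mod L \<and> i \<in> cyc_arc K b h then u else s)"
    using assms(1) unfolding droplet_def by auto
  have 0: "0 < K" "0 < L" using K3 KL by auto
  have "{v \<in> vertices K L. \<sigma> v = u} = {..<K} \<times> cyc_arc L p a \<union> cyc_arc K b h \<times> {c mod L}" (is "?A = ?B")
  proof (rule set_eqI)
    fix v show "v \<in> ?A \<longleftrightarrow> v \<in> ?B"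
      using e[of "fst v" "snd v"] assms(2) arc_subset[OF 0(1), of b h] arc_subset[OF 0(2), of p a] 0
      by (cases v) (auto simp: vertices_def split: if_splits)
  qed
  moreover have "({..<K} \<times> cyc_arc L p a) \<inter> (cyc_arc K b h \<times> {c mod L}) = {}"
    using bar_column_notin_arc[OF d(1,2,4)] by auto
  ultimately show ?thesis using d
    by (simp add: spin_count_def card_Un_disjoint card_cartesian_product card_arc)
qed

text \<open>Coordinates that are only known up to full turns are reduced to the range used for \<open>Rbar\<close> and \<open>Bbar\<close>.\<close>

lemma dropletI:
  assumes "1 \<le> a" "a < L" "h < K" "h \<noteq> 0 \<longrightarrow> Suc a < L"
    and c: "c mod L = (p + a) mod L \<or> c mod L = (p + L - 1) mod L"
    and "\<And>i j. i < K \<Longrightarrow> j < L \<Longrightarrow> \<sigma> (i, j) = (if j \<in> cyc_arc L p a \<or> j = c mod L \<and> i \<in> cyc_arc K b h then u else s)"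
  obtains p' c' b' where "droplet s u p' a c' b' h \<sigma>"
proof -
  have 0: "0 < K" "0 < L" using K3 KL by auto
  have "p + L - 1 = p + (L - 1)" "p mod L + L - 1 = p mod L + (L - 1)" using 0 by auto
  then have "\<exists>c'. c' mod L = c mod L \<and> (c' = p mod L + a \<or> c' = p mod L + L - 1)"
    using c by (metis mod_add_left_eq)
  then obtain c' where "c' mod L = c mod L" "c' = p mod L + a \<or> c' = p mod L + L - 1" by blast
  then have "droplet s u (p mod L) a c' (b mod K) h \<sigma>"
    using assms 0 unfolding droplet_def by (auto simp: arc_mod)
  then show ?thesis by (rule that)
qed

lemma sum_ge_2: "finite A \<Longrightarrow> (\<And>x. x \<in> A \<Longrightarrow> 2 \<le> f x) \<Longrightarrow> 2 * card A \<le> (\<Sum>x\<in>A. f x :: nat)"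
  using sum_bounded_below[of A 2 f] by (simp add: mult.commute)

lemma row_ge_2:
  assumes "j < L" "k < L" "\<sigma> (i, j) \<noteq> \<sigma> (i, k)" shows "2 \<le> row_defects \<sigma> i"
  using cyc_defects_ge_2[of j L k "\<lambda>j. \<sigma> (i, j)"] assms by blast

lemma col_ge_2:
  assumes "i < K" "k < K" "\<sigma> (i, j) \<noteq> \<sigma> (k, j)" shows "2 \<le> col_defects \<sigma> j"
  using cyc_defects_ge_2[of i K k "\<lambda>i. \<sigma> (i, j)"] assms by blast

text \<open>A constant column of \<open>s\<close> and one of \<open>u\<close> cause two defects in each row, that is \<open>2 * K\<close> in total, so
that the columns have at most two. If all columns are constant, all rows agree and, as \<open>3 * K\<close>
exceeds the bound, each consists of two arcs. Otherwise exactly one column is not constant, it and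
every row have two defects, and the rows come in two versions that differ in this column only.
Both versions consist of two arcs, which forces the column to sit at an end of the arc of \<open>u\<close>.\<close>

lemma two_phase_droplet:
  assumes low: "low \<sigma>" and s: "const_col s \<sigma>" and u: "const_col u \<sigma>" and su: "s \<noteq> u"
  obtains p a c b h where "droplet s u p a c b h \<sigma>"
proof -
  have 0: "0 < K" "0 < L" using K3 KL by auto
  obtain js where js: "js < L" "\<And>i. i < K \<Longrightarrow> \<sigma> (i, js) = s" using s by (auto simp: const_col_def)
  obtain ju where ju: "ju < L" "\<And>i. i < K \<Longrightarrow> \<sigma> (i, ju) = u" using u by (auto simp: const_col_def)
  have r2: "2 \<le> row_defects \<sigma> i" if "i < K" for i
    using row_ge_2[of js ju \<sigma> i] js ju su that by auto
  have row: "\<exists>p a. 1 \<le> a \<and> a < L \<and> (\<forall>j<L. \<sigma> (i, j) = (if j \<in> cyc_arc L p a then u else s))"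
    if "i < K" "row_defects \<sigma> i = 2" for i
    using cyc_two_arcs[OF that(2) ju(1) ju(2)[OF that(1)] js(1) js(2)[OF that(1)] su] by metis
  have R: "2 * K \<le> (\<Sum>i<K. row_defects \<sigma> i)"
    using sum_ge_2[of "{..<K}" "row_defects \<sigma>"] r2 by simp
  show ?thesis
  proof (cases "\<forall>j<L. \<forall>i<K. \<sigma> (i, j) = \<sigma> (0, j)")
    case True
    have "row_defects \<sigma> i = row_defects \<sigma> 0" if "i < K" for i
      using True that by (intro cyc_defects_cong) blast
    then have "(\<Sum>i<K. row_defects \<sigma> i) = (\<Sum>i<K. row_defects \<sigma> 0)" by (intro sum.cong refl) blast
    then have "(\<Sum>i<K. row_defects \<sigma> i) = K * row_defects \<sigma> 0" by simp
    then have "K * row_defects \<sigma> 0 \<le> 2 * K + 2" using low_bound[OF low] by linarith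
    moreover have "\<not> 3 \<le> row_defects \<sigma> 0"
    proof
      assume "3 \<le> row_defects \<sigma> 0"
      then have "K * 3 \<le> K * row_defects \<sigma> 0" by (rule mult_le_mono2)
      then show False using calculation K3 by linarith
    qed
    ultimately have "row_defects \<sigma> 0 = 2" using r2[of 0] 0 by linarith
    then obtain p a where pa: "1 \<le> a" "a < L" "\<And>j. j < L \<Longrightarrow> \<sigma> (0, j) = (if j \<in> cyc_arc L p a then u else s)"
      using row[OF 0(1)] by blast
    have "cyc_arc K 0 0 = {}" by (simp add: cyc_arc_def)
    then have eq: "\<sigma> (i, j) = (if j \<in> cyc_arc L p a \<or> j = (p + a) mod L \<and> i \<in> cyc_arc K 0 0 then u else s)"
      if "i < K" "j < L" for i j using True pa(3) that by (metis empty_iff)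
    show ?thesis using 0 by (intro dropletI[of a 0 "p + a" p \<sigma> 0 u s, OF pa(1,2) _ _ _ eq that]) auto
  next
    case False
    then obtain c i' where c: "c < L" "i' < K" "\<sigma> (i', c) \<noteq> \<sigma> (0, c)" by blast
    have c2: "2 \<le> col_defects \<sigma> c" using col_ge_2[of i' 0 \<sigma> c] c 0 by auto
    have other: "\<sigma> (i, j) = \<sigma> (0, j)" if "j < L" "j \<noteq> c" "i < K" for i j
    proof (rule ccontr)
      assume "\<sigma> (i, j) \<noteq> \<sigma> (0, j)"
      then have "2 \<le> col_defects \<sigma> j" using col_ge_2[of i 0 \<sigma> j] that 0 by auto
      then have "4 \<le> (\<Sum>k\<in>{c, j}. col_defects \<sigma> k)" using c2 that by simp
      also have "\<dots> \<le> (\<Sum>j<L. col_defects \<sigma> j)" using that c by (intro sum_mono2) auto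
      finally show False using low_bound[OF low] R by linarith
    qed
    have "col_defects \<sigma> c \<le> (\<Sum>j<L. col_defects \<sigma> j)" using c by (intro member_le_sum) auto
    then have colc: "col_defects \<sigma> c = 2" and R': "(\<Sum>i<K. row_defects \<sigma> i) \<le> 2 * K"
      using low_bound[OF low] R c2 by linarith+
    have r2': "row_defects \<sigma> i = 2" if "i < K" for i
    proof (rule ccontr)
      assume "row_defects \<sigma> i \<noteq> 2"
      then have "3 \<le> row_defects \<sigma> i" using r2[OF that] by simp
      moreover have "2 * (K - 1) \<le> (\<Sum>i\<in>{..<K} - {i}. row_defects \<sigma> i)"
        using sum_ge_2[of "{..<K} - {i}" "row_defects \<sigma>"] r2 that by (simp add: card_Diff_singleton)
      ultimately show False using R' that sum.remove[of "{..<K}" i "row_defects \<sigma>"] by simp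
    qed
    have val: "\<sigma> (i, c) = u \<or> \<sigma> (i, c) = s" if "i < K" for i
      using row[OF that r2'[OF that]] c by metis
    obtain i0 i1 where i: "i0 < K" "i1 < K" "\<sigma> (i0, c) = u" "\<sigma> (i1, c) = s"
    proof (cases "\<sigma> (0, c) = u")
      case True
      then have "\<sigma> (i', c) = s" using val[OF c(2)] c(3) by simp
      then show ?thesis using that[OF 0(1) c(2) True] by simp
    next
      case False
      then have "\<sigma> (0, c) = s" "\<sigma> (i', c) = u" using val[OF 0(1)] val[OF c(2)] c(3) by auto
      then show ?thesis using that[OF c(2) 0(1)] by simp
    qed
    obtain b h where h: "1 \<le> h" "h < K" "\<And>i. i < K \<Longrightarrow> \<sigma> (i, c) = (if i \<in> cyc_arc K b h then u else s)"
      using cyc_two_arcs[OF colc i(1,3,2,4) su] by metis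
    obtain p a where pa: "1 \<le> a" "a < L" "\<forall>j<L. \<sigma> (i0, j) = (if j \<in> cyc_arc L p a then u else s)"
      using row[OF i(1) r2'[OF i(1)]] by blast
    have cin: "c \<in> cyc_arc L p a" using pa(3) i(3) su c by (metis)
    then obtain x where x: "x < a" "c = (p + x) mod L" by (auto simp: cyc_arc_def)
    define g where "g = (\<lambda>y. \<sigma> (i1, (p + y) mod L))"
    have g: "g y = (if y < a \<and> y \<noteq> x then u else s)" if "y < L" for y
    proof (cases "y = x")
      case True then show ?thesis using i x by (simp add: g_def)
    next
      case False
      then have ne: "(p + y) mod L \<noteq> c" using x rotate_eq_iff[OF that, of x p] pa by simp
      then have "g y = \<sigma> (i0, (p + y) mod L)" using other[of "(p+y) mod L" i0] other[of "(p+y) mod L" i1] i 0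
        by (simp add: g_def)
      then show ?thesis using False pa mem_arc_iff[OF that, of a p] 0 by simp
    qed
    have ua: "2 \<le> a"
    proof (rule ccontr)
      assume "\<not> 2 \<le> a"
      then have "a = 1" "x = 0" using pa x by auto
      then have "cyc_arc L p a = {c}" using x by (simp add: arc_1)
      moreover have "ju \<in> cyc_arc L p a" using pa(3) ju i su by metis
      ultimately show False using ju(2)[OF i(2)] i su by auto
    qed
    \<comment> \<open>an \<open>s\<close> in the interior of the arc causes two defects, and the end of the arc a third\<close>
    have "x = 0 \<or> x = a - 1"
    proof (rule ccontr)
      assume n: "\<not> (x = 0 \<or> x = a - 1)"
      have "{x - 1, x, a - 1} \<subseteq> {j. j < L \<and> g j \<noteq> g (Suc j mod L)}"
        using n x pa g[of "x - 1"] g[of x] g[of "Suc x"] g[of "a - 1"] g[of a] su by (auto split: if_splits)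
      then have "card {x - 1, x, a - 1} \<le> cyc_defects L g"
        unfolding cyc_defects_def by (intro card_mono) auto
      moreover have "x - 1 \<noteq> x" "x - 1 \<noteq> a - 1" "x \<noteq> a - 1" using n x(1) by auto
      then have "card {x - 1, x, a - 1} = 3" by simp
      moreover have "cyc_defects L g = 2"
        using cyc_defects_rotate[OF 0(2), of "\<lambda>j. \<sigma> (i1, j)" p] r2'[OF i(2)] by (simp add: g_def)
      ultimately show False by simp
    qed
    then obtain p' where p': "cyc_arc L p a = insert c (cyc_arc L p' (a - 1))"
      "c mod L = (p' + (a - 1)) mod L \<or> c mod L = (p' + L - 1) mod L"
    proof
      assume "x = 0"
      then have "cyc_arc L p a = insert c (cyc_arc L (Suc p) (a - 1))"
        using ua x arc_Suc_left[of L p "a - 1"] by simp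
      moreover have "c mod L = (Suc p + L - 1) mod L" using x \<open>x = 0\<close> by simp
      ultimately show ?thesis using that by blast
    next
      assume "x = a - 1"
      then have "cyc_arc L p a = insert c (cyc_arc L p (a - 1))" "c mod L = (p + (a - 1)) mod L"
        using ua x arc_Suc_right[of L p "a - 1"] by simp_all
      then show ?thesis using that by blast
    qed
    have a1: "1 \<le> a - 1" "a - 1 < L" using ua pa(2) by auto
    have "(p' + (a - 1)) mod L \<notin> cyc_arc L p' (a - 1)" "(p' + L - 1) mod L \<notin> cyc_arc L p' (a - 1)"
      using bar_column_notin_arc[OF a1] by blast+
    then have cn: "c \<notin> cyc_arc L p' (a - 1)" using p'(2) c(1) by (metis mod_less)
    have cc: "c mod L = c" using c by simp
    have eq: "\<sigma> (i, j) = (if j \<in> cyc_arc L p' (a - 1) \<or> j = c mod L \<and> i \<in> cyc_arc K b h then u else s)"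
      if "i < K" "j < L" for i j
    proof (cases "j = c")
      case True then show ?thesis using h(3) cn that c by simp
    next
      case False
      then have "\<sigma> (i, j) = \<sigma> (i0, j)" using other that i by metis
      then show ?thesis using False pa(3) p'(1) that cc by auto
    qed
    show ?thesis
      using ua pa h by (intro dropletI[of "a - 1" h c p' \<sigma> b u s, OF _ _ _ _ p'(2) eq that]) auto
  qed
qed

section \<open>Phases\<close>

definition adjacent :: "config \<Rightarrow> config \<Rightarrow> bool" where
  "adjacent \<sigma> \<sigma>' \<longleftrightarrow> (\<exists>i<K. \<exists>j<L. \<forall>w. w \<noteq> (i, j) \<longrightarrow> \<sigma>' w = \<sigma> w)"

lemma adjacent_sym: "adjacent \<sigma> \<sigma>' \<Longrightarrow> adjacent \<sigma>' \<sigma>"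
  unfolding adjacent_def by metis

lemma spin_count_adjacent:
  assumes "adjacent \<sigma> \<sigma>'" shows "spin_count u \<sigma>' \<le> spin_count u \<sigma> + 1"
proof -
  obtain v where v: "\<forall>w. w \<noteq> v \<longrightarrow> \<sigma>' w = \<sigma> w" using assms unfolding adjacent_def by blast
  have f: "finite {v \<in> vertices K L. \<sigma> v = u}" by (simp add: vertices_def)
  have "{v \<in> vertices K L. \<sigma>' v = u} \<subseteq> insert v {v \<in> vertices K L. \<sigma> v = u}"
    using v by force
  then have "spin_count u \<sigma>' \<le> card (insert v {v \<in> vertices K L. \<sigma> v = u})"
    unfolding spin_count_def using f by (intro card_mono) auto
  also have "\<dots> \<le> spin_count u \<sigma> + 1" unfolding spin_count_def using f by (simp add: card_insert_if)
  finally show ?thesis .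
qed

lemma spin_count_total:
  assumes "droplet s u p a c b h \<sigma>" "s \<noteq> u"
  shows "spin_count s \<sigma> + spin_count u \<sigma> = K * L"
proof -
  have e: "\<And>i j. i < K \<Longrightarrow> j < L \<Longrightarrow> \<sigma> (i, j) \<noteq> u \<Longrightarrow> \<sigma> (i, j) = s"
    using assms(1) unfolding droplet_def by auto
  have "vertices K L = {v \<in> vertices K L. \<sigma> v = s} \<union> {v \<in> vertices K L. \<sigma> v = u}"
    using e by (auto simp: vertices_def)
  then have "card (vertices K L) = card ({v \<in> vertices K L. \<sigma> v = s} \<union> {v \<in> vertices K L. \<sigma> v = u})" by simp
  also have "\<dots> = spin_count s \<sigma> + spin_count u \<sigma>"
    unfolding spin_count_def using assms(2) by (intro card_Un_disjoint) (auto simp: vertices_def)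
  finally show ?thesis by (simp add: vertices_def)
qed

text \<open>A droplet contains only two spins.\<close>

lemma const_col_unique:
  assumes "low \<sigma>" "const_col s \<sigma>" "const_col u \<sigma>" "s \<noteq> u" "const_col t \<sigma>"
  shows "t = s \<or> t = u"
proof -
  obtain p a c b h where "droplet s u p a c b h \<sigma>" using two_phase_droplet assms(1-4) by blast
  then have e: "\<And>i j. i < K \<Longrightarrow> j < L \<Longrightarrow> \<sigma> (i, j) = u \<or> \<sigma> (i, j) = s"
    unfolding droplet_def by auto
  obtain j where "j < L" "\<forall>i<K. \<sigma> (i, j) = t" using assms(5) unfolding const_col_def by blast
  then show ?thesis using e[of 0 j] K3 by auto
qed

lemma const_col_spin:
  assumes "const_col t \<sigma>" "\<sigma> \<in> configs q K L" shows "t \<in> spins q"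
proof -
  obtain j where "j < L" "\<forall>i<K. \<sigma> (i, j) = t" using assms(1) unfolding const_col_def by blast
  then have "\<sigma> (0, j) = t" "(0, j) \<in> vertices K L" using K3 by (auto simp: vertices_def)
  then show ?thesis using assms(2) unfolding configs_def by (metis PiE_mem)
qed

lemma const_col_gained:
  assumes "\<forall>w. w \<noteq> (i, j) \<longrightarrow> \<sigma>' w = \<sigma> w" "\<not> const_col u \<sigma>" "const_col u \<sigma>'"
  shows "\<forall>k<K. \<sigma>' (k, j) = u"
proof -
  obtain j' where "j' < L" "\<forall>k<K. \<sigma>' (k, j') = u" using assms(3) unfolding const_col_def by blast
  moreover have "j' = j"
  proof (rule ccontr)
    assume "j' \<noteq> j"
    then have "\<forall>k<K. \<sigma> (k, j') = u" using assms(1) calculation by auto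
    then show False using assms(2) calculation unfolding const_col_def by blast
  qed
  ultimately show ?thesis by blast
qed

lemma other_row: obtains k where "k < K" "k \<noteq> i" "k \<noteq> i'"
proof -
  have "card {i, i'} \<le> 2" by (simp add: card_insert_if)
  moreover have "K - card {i, i'} \<le> card ({..<K} - {i, i'})"
    using diff_card_le_card_Diff[of "{i, i'}" "{..<K}"] by simp
  ultimately have "card ({..<K} - {i, i'}) \<noteq> 0" using K3 by linarith
  then have "{..<K} - {i, i'} \<noteq> {}" by force
  then show ?thesis using that by blast
qed

lemma other_col: obtains k where "k < L" "k \<noteq> j" "k \<noteq> j'" "k \<noteq> j''"
proof -
  have "card {j, j', j''} \<le> 3" by (simp add: card_insert_if)
  moreover have "L - card {j, j', j''} \<le> card ({..<L} - {j, j', j''})"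
    using diff_card_le_card_Diff[of "{j, j', j''}" "{..<L}"] by simp
  ultimately have "card ({..<L} - {j, j', j''}) \<noteq> 0" using L4 by linarith
  then have "{..<L} - {j, j', j''} \<noteq> {}" by force
  then show ?thesis using that by blast
qed

text \<open>The flip would have to turn one and the same column from constant \<open>s\<close> into constant \<open>u\<close>, while it
changes only one of its \<open>K \<ge> 3\<close> sites.\<close>

lemma const_col_no_swap:
  assumes "adjacent \<sigma> \<sigma>'" "const_col s \<sigma>" "\<not> const_col s \<sigma>'" "const_col u \<sigma>'" "s \<noteq> u"
  shows "const_col u \<sigma>"
proof (rule ccontr)
  assume n: "\<not> const_col u \<sigma>"
  obtain i j where ij: "\<forall>w. w \<noteq> (i, j) \<longrightarrow> \<sigma>' w = \<sigma> w" using assms(1) unfolding adjacent_def by blast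
  have "\<forall>k<K. \<sigma>' (k, j) = u" using const_col_gained[OF ij n assms(4)] .
  moreover have "\<forall>k<K. \<sigma> (k, j) = s" using const_col_gained[OF _ assms(3,2)] ij by metis
  moreover obtain k where "k < K" "k \<noteq> i" using other_row by blast
  moreover from this have "\<sigma>' (k, j) = \<sigma> (k, j)" using ij by blast
  ultimately show False using assms(5) by simp
qed

text \<open>The configurations around the monochromatic one of spin \<open>r\<close>. Usually \<open>r\<close> has a constant column, but
for \<open>L = K + 1\<close> there are low configurations without any constant column; all their rows are
constant, and the almost constant column singles out those with at most one row different
from \<open>r\<close>, which are the ones in contact with configurations that have a constant column of \<open>r\<close>.\<close>

definition phase :: "nat \<Rightarrow> config \<Rightarrow> bool" where
  "phase r \<sigma> \<longleftrightarrow> (\<forall>u. u \<noteq> r \<longrightarrow> \<not> const_col u \<sigma>) \<and> (\<exists>j<L. card {i. i < K \<and> \<sigma> (i, j) \<noteq> r} \<le> 1)"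

lemma phase_if_const_col:
  assumes "const_col r \<sigma>" "\<forall>u. u \<noteq> r \<longrightarrow> \<not> const_col u \<sigma>" shows "phase r \<sigma>"
proof -
  obtain j where "j < L" "\<forall>k<K. \<sigma> (k, j) = r" using assms(1) unfolding const_col_def by blast
  then have "{i. i < K \<and> \<sigma> (i, j) \<noteq> r} = {}" by auto
  then have "card {i. i < K \<and> \<sigma> (i, j) \<noteq> r} \<le> 1" by (metis card.empty zero_le_one)
  then show ?thesis using assms(2) \<open>j < L\<close> unfolding phase_def by blast
qed

text \<open>Two defects in each column amount to \<open>2 * L \<ge> 2 * K + 2\<close>, which leaves none for the rows.\<close>

lemma rows_const_if_no_const_col:
  assumes "low \<sigma>" "\<forall>u. \<not> const_col u \<sigma>" "i < K" "j < L" "k < L"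
  shows "\<sigma> (i, j) = \<sigma> (i, k)"
proof (rule ccontr)
  assume "\<sigma> (i, j) \<noteq> \<sigma> (i, k)"
  then have "2 \<le> row_defects \<sigma> i" using row_ge_2 assms by blast
  also have "\<dots> \<le> (\<Sum>i<K. row_defects \<sigma> i)" using assms(3) by (intro member_le_sum) auto
  finally have r: "2 \<le> (\<Sum>i<K. row_defects \<sigma> i)" .
  have "2 \<le> col_defects \<sigma> j" if "j < L" for j
  proof -
    have "\<exists>k<K. \<sigma> (k, j) \<noteq> \<sigma> (0, j)" using assms(2) that unfolding const_col_def by metis
    then show ?thesis using col_ge_2[of _ 0 \<sigma> j] K3 by auto
  qed
  then have "2 * L \<le> (\<Sum>j<L. col_defects \<sigma> j)" using sum_ge_2[of "{..<L}" "col_defects \<sigma>"] by simp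
  then show False using low_bound[OF assms(1)] r KL by linarith
qed

text \<open>A low path leaves the phase of \<open>r\<close> only through two-phase configurations: a constant column of \<open>t\<close>
cannot arise in the very column in which a constant column of \<open>r\<close> gets lost, nor in a configuration
whose rows are all, up to one, constantly \<open>r\<close>.\<close>

lemma phase_step:
  assumes ph: "phase r \<sigma>" and low: "low \<sigma>" "low \<sigma>'" and adj: "adjacent \<sigma> \<sigma>'"
  shows "phase r \<sigma>' \<or> const_col r \<sigma>' \<and> (\<exists>t. t \<noteq> r \<and> const_col t \<sigma>')"
proof -
  obtain i j where ij: "i < K" "j < L" "\<forall>w. w \<noteq> (i, j) \<longrightarrow> \<sigma>' w = \<sigma> w"
    using adj unfolding adjacent_def by blast
  obtain j1 where j1: "j1 < L" "card {i. i < K \<and> \<sigma> (i, j1) \<noteq> r} \<le> 1"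
    using ph unfolding phase_def by blast
  have nor: "\<not> const_col u \<sigma>" if "u \<noteq> r" for u using ph that unfolding phase_def by blast
  have cols: "card {i. i < K \<and> \<sigma> (i, k) \<noteq> r} \<le> 1" if "\<not> const_col r \<sigma>" "k < L" for k
  proof -
    have "\<forall>u. \<not> const_col u \<sigma>" using nor that by metis
    then have "\<sigma> (i, k) = \<sigma> (i, j1)" if "i < K" for i
      using rows_const_if_no_const_col[OF low(1)] j1 \<open>k < L\<close> that by blast
    then have "{i. i < K \<and> \<sigma> (i, k) \<noteq> r} = {i. i < K \<and> \<sigma> (i, j1) \<noteq> r}" by auto
    then show ?thesis using j1 by simp
  qed
  show ?thesis
  proof (cases "\<exists>t. t \<noteq> r \<and> const_col t \<sigma>'")
    case True
    then obtain t where t: "t \<noteq> r" "const_col t \<sigma>'" by blast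
    have "const_col r \<sigma>'"
    proof (rule ccontr)
      assume n: "\<not> const_col r \<sigma>'"
      show False
      proof (cases "const_col r \<sigma>")
        case True
        then show False using const_col_no_swap[OF adj True n t(2)] nor t(1) by metis
      next
        case False
        have c: "\<forall>k<K. \<sigma>' (k, j) = t" using const_col_gained[OF ij(3) nor[OF t(1)] t(2)] .
        obtain k where k: "k < K" "k \<noteq> i" using other_row by blast
        obtain l where l: "l < K" "l \<noteq> i" "l \<noteq> k" using other_row by blast
        have "{k, l} \<subseteq> {i. i < K \<and> \<sigma> (i, j) \<noteq> r}"
        proof -
          have "\<sigma> (k, j) = t" "\<sigma> (l, j) = t" using k l c ij(3) by (metis prod.inject)+
          then show ?thesis using k l t(1) by simp
        qed
        then have "card {k, l} \<le> card {i. i < K \<and> \<sigma> (i, j) \<noteq> r}" by (intro card_mono) auto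
        then show False using cols[OF False ij(2)] l(3) by simp
      qed
    qed
    then show ?thesis using t by blast
  next
    case False
    then have no: "\<forall>u. u \<noteq> r \<longrightarrow> \<not> const_col u \<sigma>'" by blast
    consider "const_col r \<sigma>'" | "const_col r \<sigma>" | "\<not> const_col r \<sigma>'" "\<not> const_col r \<sigma>" by blast
    then show ?thesis
    proof cases
      case 1 then show ?thesis using phase_if_const_col no by blast
    next
      case 2
      then obtain k where k: "k < L" "\<forall>l<K. \<sigma> (l, k) = r" unfolding const_col_def by blast
      then have "{l. l < K \<and> \<sigma>' (l, k) \<noteq> r} \<subseteq> {i}" using ij(3) by auto
      then have "card {l. l < K \<and> \<sigma>' (l, k) \<noteq> r} \<le> card {i}" by (intro card_mono) auto
      then show ?thesis using no k(1) unfolding phase_def by auto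
    next
      case 3
      obtain k where k: "k < L" "k \<noteq> j" using other_col by blast
      then have "{l. l < K \<and> \<sigma>' (l, k) \<noteq> r} = {l. l < K \<and> \<sigma> (l, k) \<noteq> r}" using ij(3) by auto
      then show ?thesis using no k(1) cols[OF 3(2) k(1)] unfolding phase_def by auto
    qed
  qed
qed

text \<open>One flip destroys at most one of the two constant columns, and by \<open>const_col_no_swap\<close> and
\<open>const_col_unique\<close> it does not create one of a third spin in its place.\<close>

lemma two_phase_step:
  assumes low: "low \<sigma>" "low \<sigma>'" and adj: "adjacent \<sigma> \<sigma>'"
    and c: "const_col r \<sigma>" "const_col t \<sigma>" "r \<noteq> t"
  shows "const_col r \<sigma>' \<and> const_col t \<sigma>' \<or> phase r \<sigma>' \<and> \<not> const_col t \<sigma>' \<or> const_col t \<sigma>' \<and> \<not> const_col r \<sigma>'"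
proof (cases "const_col t \<sigma>'")
  case False
  have r: "const_col r \<sigma>'"
  proof (rule ccontr)
    assume n: "\<not> const_col r \<sigma>'"
    obtain i j where ij: "\<forall>w. w \<noteq> (i, j) \<longrightarrow> \<sigma> w = \<sigma>' w" using adj unfolding adjacent_def by metis
    have "\<forall>k<K. \<sigma> (k, j) = r" "\<forall>k<K. \<sigma> (k, j) = t"
      using const_col_gained[OF ij n c(1)] const_col_gained[OF ij False c(2)] by auto
    then show False using c(3) K3 by (metis less_le_trans zero_less_numeral)
  qed
  have "\<not> const_col u \<sigma>'" if "u \<noteq> r" for u
  proof
    assume u: "const_col u \<sigma>'"
    then have "u \<noteq> t" using False by blast
    then have "const_col u \<sigma>" using const_col_no_swap[OF adj c(2) False u] by blast
    then show False using const_col_unique[OF low(1) c] that \<open>u \<noteq> t\<close> by blast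
  qed
  then show ?thesis using phase_if_const_col r False by blast
qed auto

section \<open>Completing the first column\<close>

lemma rect_bar_Bbar:
  assumes "\<sigma> \<in> configs q K L" and m: "m < K" "m \<notin> cyc_arc K b h" and "p < L" "c = p + 1 \<or> c = p + L - 1"
    and h: "1 \<le> h" "h \<le> K - 2"
    and e: "\<And>i j. i < K \<Longrightarrow> j < L \<Longrightarrow> \<sigma> (i, j) = (if j = p \<and> i \<noteq> m \<or> j = c mod L \<and> i \<in> cyc_arc K b h then u else s)"
  shows "\<sigma> \<in> Bbar K L h 1 (K - 1) s u"
proof -
  have hK: "h < K" using h K3 by linarith
  obtain k where k: "k + h \<le> K - 1" "cyc_arc K b h = cyc_arc K (Suc m mod K + k) h"
    using arc_avoiding_point[OF m hK] by blast
  have m': "cyc_arc K (Suc m mod K) (K - 1) = {..<K} - {m}"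
    using arc_complement_point[OF m(1)] arc_mod[of K "Suc m" "K - 1"] by simp
  have p: "cyc_arc L p 1 = {p}" "cyc_arc L c 1 = {c mod L}" using assms(4) by (simp_all add: arc_1)
  have "\<sigma> = two_spin_config K L s u
      (block K L (Suc m mod K) p 1 (K - 1) \<union> block K L (Suc m mod K + k) c 1 h)"
  proof (rule two_spin_configI[OF assms(1)])
    fix i j assume ij: "i < K" "j < L"
    then show "\<sigma> (i, j) = (if (i, j) \<in> block K L (Suc m mod K) p 1 (K - 1) \<union> block K L (Suc m mod K + k) c 1 h
      then u else s)"
      unfolding block_eq m' p k(2)[symmetric] e[OF ij] by auto
  qed
  moreover have "(Suc m mod K, p) \<in> vertices K L" using m(1) assms(4) by (simp add: vertices_def)
  moreover have "h \<le> K - 1 - 1" "c \<in> {p + 1, p + L - 1}" using h assms(5) by auto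
  ultimately show ?thesis unfolding Bbar_def using h(1) k(1) by blast
qed

lemma two_cols_Rbar:
  assumes "\<sigma> \<in> configs q K L" and m: "m < K" and "p < L" "c = p + 1 \<or> c = p + L - 1"
    and e: "\<And>i j. i < K \<Longrightarrow> j < L \<Longrightarrow> \<sigma> (i, j) = (if (j = p \<or> j = c mod L) \<and> i \<noteq> m then u else s)"
  shows "\<sigma> \<in> Rbar K L 2 (K - 1) s u"
proof -
  have m': "cyc_arc K (Suc m mod K) (K - 1) = {..<K} - {m}"
    using arc_complement_point[OF m(1)] arc_mod[of K "Suc m" "K - 1"] by simp
  have a2: "cyc_arc L p' 2 = {p' mod L, Suc p' mod L}" for p'
    using arc_Suc_left[of L p' 1] by (simp add: arc_1 numeral_2_eq_2)
  obtain p' where p': "p' < L" "cyc_arc L p' 2 = {p, c mod L}"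
    using assms(4)
  proof
    assume "c = p + 1" then show ?thesis using that[of p] assms(3) a2[of p] by simp
  next
    assume c: "c = p + L - 1"
    have "Suc (c mod L) mod L = Suc c mod L" by (simp add: mod_simps)
    also have "\<dots> = p" using c assms(3) by simp
    finally show ?thesis using that[of "c mod L"] assms(3) a2[of "c mod L"] by auto
  qed
  have "\<sigma> = two_spin_config K L s u (block K L (Suc m mod K) p' 2 (K - 1))"
  proof (rule two_spin_configI[OF assms(1)])
    fix i j assume ij: "i < K" "j < L"
    then show "\<sigma> (i, j) = (if (i, j) \<in> block K L (Suc m mod K) p' 2 (K - 1) then u else s)"
      unfolding block_eq m' p' e[OF ij] by auto
  qed
  moreover have "(Suc m mod K, p') \<in> vertices K L" using m(1) p'(1) by (simp add: vertices_def)
  ultimately show ?thesis unfolding Rbar_def by blast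
qed

text \<open>The flip from \<open>\<sigma>\<close> to \<open>\<sigma>'\<close> completes the only constant column of \<open>u\<close>. If there is a bar next to it,
then \<open>\<sigma>\<close> has two nonconstant columns, with at least two defects each, and at least two defects in
every row other than that of the flipped site. This exhausts the bound; so this last row is constantly \<open>s\<close>, which
fixes the spin of the flipped site and keeps the bar away from its row.\<close>

lemma entry_structure:
  assumes cf: "\<sigma> \<in> configs q K L" and low: "low \<sigma>" "low \<sigma>'" and adj: "adjacent \<sigma> \<sigma>'"
    and c: "\<not> const_col u \<sigma>" "const_col s \<sigma>'" "const_col u \<sigma>'" and su: "s \<noteq> u"
  obtains p c b h where "droplet s u p 1 c b h \<sigma>'"
    "h = 0 \<or> (h \<le> K - 2 \<and> \<sigma> \<in> Bbar K L h 1 (K - 1) s u) \<or> \<sigma> \<in> Rbar K L 2 (K - 1) s u"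
proof -
  obtain p a c b h where d: "droplet s u p a c b h \<sigma>'"
    using two_phase_droplet[OF low(2) c(2,3) su] by blast
  then have dd: "p < L" "b < K" "1 \<le> a" "a < L" "h < K" "c = p + a \<or> c = p + L - 1"
    and e: "\<And>i j. i < K \<Longrightarrow> j < L \<Longrightarrow> \<sigma>' (i, j) = (if j \<in> cyc_arc L p a \<or> j = c mod L \<and> i \<in> cyc_arc K b h then u else s)"
    unfolding droplet_def by auto
  obtain i0 j0 where ij: "i0 < K" "j0 < L" "\<forall>w. w \<noteq> (i0, j0) \<longrightarrow> \<sigma>' w = \<sigma> w"
    using adj unfolding adjacent_def by blast
  have 0: "0 < K" "0 < L" using K3 KL by auto
  have arcs: "cyc_arc L p a \<subseteq> {j0}"
  proof
    fix j assume j: "j \<in> cyc_arc L p a"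
    then have "j < L" using arc_subset[OF 0(2), of p a] by blast
    then have uj: "\<forall>i<K. \<sigma>' (i, j) = u" using e j by simp
    show "j \<in> {j0}"
    proof (rule ccontr)
      assume "j \<notin> {j0}"
      then have "\<forall>i<K. \<sigma> (i, j) = u" using uj ij(3) by auto
      then show False using c(1) \<open>j < L\<close> unfolding const_col_def by blast
    qed
  qed
  have "a \<le> 1" using card_mono[OF _ arcs] card_arc[of a L p] dd(4) by simp
  then have a: "a = 1" using dd(3) by simp
  then have ap: "cyc_arc L p a = {p}" using dd(1) by (simp add: arc_1)
  then have pj: "j0 = p" using arcs by simp
  have cn: "c mod L \<noteq> p" using bar_column_notin_arc[OF dd(3,4,6)] ap by simp
  define c0 where "c0 = c mod L"
  have c0: "c0 < L" "c0 \<noteq> p" using cn 0 by (simp_all add: c0_def)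
  show ?thesis
  proof (cases "h = 0")
    case True then show ?thesis using that d a by blast
  next
    case False
    have off: "\<sigma> (i, j) = \<sigma>' (i, j)" if "j \<noteq> p \<or> i \<noteq> i0" for i j
    proof -
      have "(i, j) \<noteq> (i0, j0)" using that pj by blast
      then show ?thesis using ij(3) by simp
    qed
    obtain js where js: "js < L" "\<forall>i<K. \<sigma>' (i, js) = s" using c(2) unfolding const_col_def by blast
    have jsp: "js \<noteq> p" using js e[of 0 p] ap su 0 dd(1) by auto
    have sp: "\<sigma> (i, p) = u" if "i < K" "i \<noteq> i0" for i
      using off[of p i] that e[of i p] ap dd(1) by simp
    have sp0: "\<sigma> (i0, p) \<noteq> u"
    proof
      assume "\<sigma> (i0, p) = u"
      then have "\<forall>i<K. \<sigma> (i, p) = u" using sp by metis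
      then show False using c(1) dd(1) unfolding const_col_def by blast
    qed
    have rows: "2 \<le> row_defects \<sigma> i" if "i < K" "i \<noteq> i0" for i
      using row_ge_2[OF dd(1) js(1), of \<sigma> i] sp[OF that] off[of js i] jsp js(2) that su by simp
    have "2 * card ({..<K} - {i0}) \<le> (\<Sum>i\<in>{..<K} - {i0}. row_defects \<sigma> i)"
      by (rule sum_ge_2) (use rows in auto)
    then have R: "2 * (K - 1) + row_defects \<sigma> i0 \<le> (\<Sum>i<K. row_defects \<sigma> i)"
      using sum.remove[of "{..<K}" i0 "row_defects \<sigma>"] ij(1) by (simp add: card_Diff_singleton)
    obtain k where k: "k < K" "k \<noteq> i0" using other_row by blast
    have colp: "2 \<le> col_defects \<sigma> p" using col_ge_2[OF k(1) ij(1), of \<sigma> p] sp[OF k] sp0 by simp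
    have bin: "b \<in> cyc_arc K b h" using mem_arc_iff[of 0 K h b] dd False by simp
    have "card (cyc_arc K b h) \<noteq> card {..<K}" using card_arc[of h K b] dd(5) by simp
    then have "cyc_arc K b h \<noteq> {..<K}" by metis
    then obtain l where l: "l < K" "l \<notin> cyc_arc K b h" using arc_subset[OF 0(1), of b h] by blast
    have "\<sigma>' (b, c0) = u" "\<sigma>' (l, c0) = s"
      using e[OF dd(2) c0(1)] e[OF l(1) c0(1)] bin l(2) ap c0 by (simp_all add: c0_def)
    then have colc: "2 \<le> col_defects \<sigma> c0"
      using col_ge_2[OF dd(2) l(1), of \<sigma> c0] off[of c0] c0 su by simp
    have "(\<Sum>j\<in>{p, c0}. col_defects \<sigma> j) \<le> (\<Sum>j<L. col_defects \<sigma> j)"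
      using dd(1) c0 by (intro sum_mono2) auto
    then have "4 \<le> (\<Sum>j<L. col_defects \<sigma> j)" using colp colc c0(2) by simp
    then have r0: "row_defects \<sigma> i0 < 2" using R low_bound[OF low(1)] K3 by linarith
    have s0: "\<sigma> (i0, j) = s" if "j < L" for j
    proof (rule ccontr)
      assume "\<sigma> (i0, j) \<noteq> s"
      moreover have "\<sigma> (i0, js) = s" using off[of js i0] jsp js ij(1) by simp
      ultimately show False using row_ge_2[OF that js(1), of \<sigma> i0] r0 by simp
    qed
    have i0n: "i0 \<notin> cyc_arc K b h"
      using s0[OF c0(1)] off[of c0 i0] c0 e[OF ij(1) c0(1)] su by (auto simp: c0_def)
    have val: "\<sigma> (i, j) = (if j = p \<and> i \<noteq> i0 \<or> j = c mod L \<and> i \<in> cyc_arc K b h then u else s)"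
      if "i < K" "j < L" for i j
    proof (cases "i = i0")
      case True then show ?thesis using s0[OF that(2)] i0n by simp
    next
      case False then show ?thesis using off[of j i] e[OF that] ap by simp
    qed
    have cp: "c = p + 1 \<or> c = p + L - 1" using dd(6) a by simp
    show ?thesis
    proof (cases "h \<le> K - 2")
      case True
      then have "\<sigma> \<in> Bbar K L h 1 (K - 1) s u"
        using rect_bar_Bbar[OF cf ij(1) i0n dd(1) cp _ _ val] False by simp
      then show ?thesis using that[of p c b h] d a True by blast
    next
      case n: False
      then have "h = K - 1" using dd(5) by simp
      then have "card (cyc_arc K b h) = card ({..<K} - {i0})"
        using card_arc[of h K b] ij(1) by (simp add: card_Diff_singleton)
      moreover have "cyc_arc K b h \<subseteq> {..<K} - {i0}" using arc_subset[OF 0(1), of b h] i0n by blast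
      ultimately have full: "cyc_arc K b h = {..<K} - {i0}" by (intro card_subset_eq) auto
      have "\<sigma> \<in> Rbar K L 2 (K - 1) s u"
        by (rule two_cols_Rbar[OF cf ij(1) dd(1) cp]) (use val full in auto)
      then show ?thesis using that[of p c b h] d a by blast
    qed
  qed
qed

lemma Rbar_two_cols:
  assumes "\<sigma> \<in> Rbar K L 2 (K - 1) s u"
  shows "\<exists>m<K. \<exists>j<L. \<forall>k<K. \<forall>l<L. \<sigma> (k, l) = (if (l = j \<or> l = Suc j mod L) \<and> k \<noteq> m then u else s)"
proof -
  have 0: "0 < K" "0 < L" using K3 KL by auto
  obtain i j where R': "i < K" "j < L" "\<sigma> = two_spin_config K L s u (block K L i j 2 (K - 1))"
    using assms unfolding Rbar_def vertices_def by auto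
  define m where "m = (i + (K - 1)) mod K"
  have m: "m < K" "Suc m mod K = i" using R' 0 by (simp_all add: m_def mod_Suc_eq)
  have "cyc_arc L j 2 = {j, Suc j mod L}"
    using arc_Suc_left[of L j 1] R'(2) by (simp add: arc_1 numeral_2_eq_2)
  moreover have "cyc_arc K i (K - 1) = {..<K} - {m}"
    using arc_complement_point[OF m(1)] arc_mod[of K "Suc m" "K - 1"] m by simp
  ultimately have "\<sigma> (k, l) = (if (l = j \<or> l = Suc j mod L) \<and> k \<noteq> m then u else s)" if "k < K" "l < L" for k l
    using that unfolding R'(3) two_spin_config_def block_eq by (auto simp: vertices_def)
  then show ?thesis using m(1) R'(2) by blast
qed

text \<open>Two adjacent columns of \<open>K - 1\<close> sites have excess \<open>2 * K + 2\<close>, so a flip must not increase the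
excess. If it changes anything, it either fills one of the two gaps in the row that the rectangle
misses, which completes a column, or removes a corner, that is a site next to that row.\<close>

lemma Rbar_step:
  assumes cf: "\<sigma>' \<in> configs q K L" and R: "\<sigma> \<in> Rbar K L 2 (K - 1) s u" and su: "s \<noteq> u"
    and adj: "adjacent \<sigma> \<sigma>'" and low: "low \<sigma>'"
  shows "\<sigma>' = \<sigma> \<or> \<sigma>' \<in> Bbar K L (K - 2) 1 (K - 1) s u \<or> (\<exists>p c b. droplet s u p 1 c b (K - 1) \<sigma>')"
proof (cases "\<sigma>' = \<sigma>")
  case False
  have 0: "0 < K" "0 < L" using K3 KL by auto
  obtain m j where m: "m < K" and jL: "j < L"
    and e0: "\<forall>k<K. \<forall>l<L. \<sigma> (k, l) = (if (l = j \<or> l = Suc j mod L) \<and> k \<noteq> m then u else s)"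
    using Rbar_two_cols[OF R] by blast
  define j' where "j' = Suc j mod L"
  have j': "j' < L" "j' \<noteq> j" using jL L4 by (auto simp: j'_def mod_Suc)
  have e: "\<sigma> (k, l) = (if (l = j \<or> l = j') \<and> k \<noteq> m then u else s)" if "k < K" "l < L" for k l
    using e0 that by (simp add: j'_def)
  obtain i0 j0 where ij: "i0 < K" "j0 < L" "\<forall>w. w \<noteq> (i0, j0) \<longrightarrow> \<sigma>' w = \<sigma> w"
    using adj unfolding adjacent_def by blast
  then have ne: "\<sigma>' (i0, j0) \<noteq> \<sigma> (i0, j0)" using False by (metis ext)
  have off: "\<sigma>' (k, l) = (if (l = j \<or> l = j') \<and> k \<noteq> m then u else s)"
    if "k < K" "l < L" "k \<noteq> i0 \<or> l \<noteq> j0" for k l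
  proof -
    have "(k, l) \<noteq> (i0, j0)" using that(3) by blast
    then have "\<sigma>' (k, l) = \<sigma> (k, l)" using ij(3) by simp
    then show ?thesis using e[OF that(1,2)] by simp
  qed
  \<comment> \<open>rows other than the missing row \<open>m\<close> and that of the flipped site have two defects\<close>
  have rows: "2 \<le> row_defects \<sigma>' k" if k: "k < K" "k \<noteq> m" "k \<noteq> i0" for k
  proof -
    obtain l where "l < L" "l \<noteq> j" "l \<noteq> j'" using other_col by blast
    then show ?thesis using row_ge_2[of j l \<sigma>' k] off[of k j] off[of k l] k jL su by simp
  qed
  \<comment> \<open>a column of the rectangle has two defects unless its gap in row \<open>m\<close> is flipped\<close>
  have cols: "2 \<le> col_defects \<sigma>' l" if l: "l = j \<or> l = j'" "(m, l) \<noteq> (i0, j0)" for l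
  proof -
    obtain k where k: "k < K" "k \<noteq> m" "k \<noteq> i0" using other_row by blast
    have "l < L" using l(1) jL j'(1) by auto
    then show ?thesis using col_ge_2[of k m \<sigma>' l] off[of k l] off[of m l] k l m su by auto
  qed
  have Rsplit: "(\<Sum>k<K. row_defects \<sigma>' k) = row_defects \<sigma>' i0 + (\<Sum>k\<in>{..<K} - {i0}. row_defects \<sigma>' k)"
    using ij(1) by (intro sum.remove) auto
  have sub: "(\<Sum>l\<in>A. col_defects \<sigma>' l) \<le> (\<Sum>l<L. col_defects \<sigma>' l)" if "A \<subseteq> {..<L}" for A
    using that by (intro sum_mono2) auto
  \<comment> \<open>a flip outside the two columns costs too much\<close>
  have jin: "j0 = j \<or> j0 = j'"
  proof (rule ccontr)
    assume n: "\<not> (j0 = j \<or> j0 = j')"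
    have out: "\<sigma>' (i0, j0) \<noteq> s" using ne e[OF ij(1,2)] n by simp
    have C: "2 \<le> col_defects \<sigma>' j" "2 \<le> col_defects \<sigma>' j'" using cols n by auto
    have "col_defects \<sigma>' j + col_defects \<sigma>' j' \<le> (\<Sum>l<L. col_defects \<sigma>' l)"
      using sub[of "{j, j'}"] j' jL by simp
    obtain k where k: "k < K" "k \<noteq> i0" using other_row by blast
    have "\<sigma>' (k, j0) = s" using off[of k j0] k n ij(2) by simp
    then have "2 \<le> col_defects \<sigma>' j0" using col_ge_2[OF ij(1) k(1), of \<sigma>' j0] out by simp
    then have C6: "6 \<le> (\<Sum>l<L. col_defects \<sigma>' l)"
      using sub[of "{j, j', j0}"] C j' jL n ij(2) by simp
    obtain l where l: "l < L" "l \<noteq> j" "l \<noteq> j'" "l \<noteq> j0" using other_col by blast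
    then have "\<sigma>' (i0, l) = s" using off[of i0 l] ij(1) by simp
    then have R0: "2 \<le> row_defects \<sigma>' i0" using row_ge_2[OF ij(2) l(1), of \<sigma>' i0] out by simp
    have "2 * card ({..<K} - {i0, m}) \<le> (\<Sum>k\<in>{..<K} - {i0, m}. row_defects \<sigma>' k)"
      by (rule sum_ge_2) (use rows in auto)
    also have "\<dots> \<le> (\<Sum>k\<in>{..<K} - {i0}. row_defects \<sigma>' k)" by (intro sum_mono2) auto
    finally have "2 * (K - 2) \<le> (\<Sum>k\<in>{..<K} - {i0}. row_defects \<sigma>' k)"
      using diff_card_le_card_Diff[of "{i0, m}" "{..<K}"] by (simp add: card_insert_if split: if_splits)
    then show False using low_bound[OF low] Rsplit C6 R0 K3 by linarith
  qed
  \<comment> \<open>\<open>p\<close> is the column that is not flipped; the two columns are neighbours in both directions\<close>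
  obtain p c c' where p: "p < L" "p \<noteq> j0" "\<And>l. l = j \<or> l = j' \<longleftrightarrow> l = p \<or> l = j0"
    and c: "c = p + 1 \<or> c = p + L - 1" "c mod L = j0"
    and c': "c' = j0 + 1 \<or> c' = j0 + L - 1" "c' mod L = p"
  proof -
    have "Suc j' = j' + 1" "(j' + L - 1) mod L = j"
      using jL by (auto simp: j'_def mod_Suc)
    then show ?thesis
      using jin that[of j' "j' + L - 1" "j + 1"] that[of j "j + 1" "j' + L - 1"] j' jL
      by (auto simp: j'_def)
  qed
  have colp: "2 \<le> col_defects \<sigma>' p" using cols p by simp
  have C: "col_defects \<sigma>' p + col_defects \<sigma>' j0 \<le> (\<Sum>l<L. col_defects \<sigma>' l)"
    using sub[of "{p, j0}"] p ij(2) by simp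
  show ?thesis
  proof (cases "i0 = m")
    case True
    have "\<sigma>' (i0, j0) \<noteq> s" using ne e[OF ij(1,2)] True by simp
    moreover have "\<sigma>' (i0, p) = s" using off[of i0 p] p ij True by simp
    ultimately have R0: "2 \<le> row_defects \<sigma>' i0" using row_ge_2[OF ij(2) p(1), of \<sigma>' i0] by simp
    have "2 * card ({..<K} - {i0}) \<le> (\<Sum>k\<in>{..<K} - {i0}. row_defects \<sigma>' k)"
      by (rule sum_ge_2) (use rows True in auto)
    then have "2 * (K - 1) \<le> (\<Sum>k\<in>{..<K} - {i0}. row_defects \<sigma>' k)"
      using ij(1) by (simp add: card_Diff_singleton)
    then have c0: "col_defects \<sigma>' j0 < 2" using low_bound[OF low] Rsplit R0 colp C K3 by linarith
    obtain k where k: "k < K" "k \<noteq> i0" using other_row by blast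
    have "\<sigma>' (i0, j0) = \<sigma>' (k, j0)" using col_ge_2[OF ij(1) k(1), of \<sigma>' j0] c0 by (metis not_le)
    also have "\<dots> = u" using off[of k j0] k ij(2) p True by simp
    finally have u0: "\<sigma>' (i0, j0) = u" .
    have "droplet s u j0 1 c' (Suc m mod K) (K - 1) \<sigma>'"
      unfolding droplet_def
    proof (intro conjI allI impI)
      fix k l assume kl: "k < K" "l < L"
      have "cyc_arc L j0 1 = {j0}" using ij(2) by (simp add: arc_1)
      moreover have "cyc_arc K (Suc m mod K) (K - 1) = {..<K} - {m}"
        using arc_complement_point[OF m] arc_mod[of K "Suc m" "K - 1"] by simp
      ultimately show "\<sigma>' (k, l) = (if l \<in> cyc_arc L j0 1 \<or> l = c' mod L \<and> k \<in> cyc_arc K (Suc m mod K) (K - 1) then u else s)"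
        using kl u0 off[OF kl] p c'(2) True by (cases "k = i0 \<and> l = j0") auto
    qed (use ij(2) L4 K3 c'(1) in auto)
    then show ?thesis by blast
  next
    case nm: False
    have x: "\<sigma>' (i0, j0) \<noteq> u" using ne e[OF ij(1,2)] nm p by simp
    have colj: "2 \<le> col_defects \<sigma>' j0" using cols[of j0] p nm by simp
    obtain l where l: "l < L" "l \<noteq> p" "l \<noteq> j0" using other_col by blast
    have rp: "\<sigma>' (i0, p) = u" using off[of i0 p] p ij nm by simp
    have rl: "\<sigma>' (i0, l) = s" using off[of i0 l] p(3)[of l] l ij by simp
    have R0: "2 \<le> row_defects \<sigma>' i0" using row_ge_2[OF p(1) l(1), of \<sigma>' i0] rp rl su by simp
    have "2 * card ({..<K} - {i0, m}) \<le> (\<Sum>k\<in>{..<K} - {i0, m}. row_defects \<sigma>' k)"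
      by (rule sum_ge_2) (use rows in auto)
    also have "\<dots> \<le> (\<Sum>k\<in>{..<K} - {i0}. row_defects \<sigma>' k)" by (intro sum_mono2) auto
    finally have "2 * (K - 2) \<le> (\<Sum>k\<in>{..<K} - {i0}. row_defects \<sigma>' k)"
      using diff_card_le_card_Diff[of "{i0, m}" "{..<K}"] by (simp add: card_insert_if split: if_splits)
    then have eq: "row_defects \<sigma>' i0 = 2" "col_defects \<sigma>' j0 = 2"
      using low_bound[OF low] Rsplit C colp colj R0 K3 by linarith+
    have "\<sigma>' (i0, j0) = u \<or> \<sigma>' (i0, j0) = s"
      using cyc_two_arcs[OF eq(1) p(1) rp l(1) rl su] ij(2) by metis
    then have x: "\<sigma>' (i0, j0) = s" using x by simp
    obtain k where k: "k < K" "k \<noteq> m" "k \<noteq> i0" using other_row by blast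
    have ku: "\<sigma>' (k, j0) = u" using off[of k j0] k ij(2) p by simp
    have ms: "\<sigma>' (m, j0) = s" using off[of m j0] m ij(2) nm by simp
    obtain b h where h: "1 \<le> h" "h < K" "\<And>k. k < K \<Longrightarrow> \<sigma>' (k, j0) = (if k \<in> cyc_arc K b h then u else s)"
      using cyc_two_arcs[OF eq(2) k(1) ku m ms su] by metis
    have mn: "m \<notin> cyc_arc K b h" using h(3)[OF m] ms su by auto
    have arc: "k \<in> cyc_arc K b h \<longleftrightarrow> k \<noteq> m \<and> k \<noteq> i0" if "k < K" for k
      using h(3)[OF that] off[of k j0] that ij(2) p x su by (cases "k = i0") (auto split: if_splits)
    have "cyc_arc K b h = {..<K} - {m, i0}" using arc arc_subset[OF 0(1), of b h] by auto
    then have "h = K - 2" using card_arc[of h K b] h(2) nm m ij(1) by (simp add: card_Diff_subset)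
    moreover have "\<sigma>' \<in> Bbar K L h 1 (K - 1) s u"
    proof (rule rect_bar_Bbar[OF cf m mn p(1) c(1) h(1)])
      show "h \<le> K - 2" using calculation by simp
      fix k l assume kl: "k < K" "l < L"
      show "\<sigma>' (k, l) = (if l = p \<and> k \<noteq> m \<or> l = c mod L \<and> k \<in> cyc_arc K b h then u else s)"
        using off[OF kl] p(2,3) arc[OF kl(1)] c(2) x by (cases "k = i0 \<and> l = j0") auto
    qed
    ultimately show ?thesis by blast
  qed
qed simp

section \<open>Low paths and gates\<close>

lemma Rbar_no_const_col:
  assumes "\<sigma> \<in> Rbar K L 2 (K - 1) s u" "const_col t \<sigma>" shows "t = s"
proof -
  obtain m j where m: "m < K" and j: "j < L" and e: "\<forall>k<K. \<forall>l<L. \<sigma> (k, l) = (if (l = j \<or> l = Suc j mod L) \<and> k \<noteq> m then u else s)"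
    using Rbar_two_cols[OF assms(1)] by blast
  then have "\<sigma> (m, l) = s" if "l < L" for l using that by simp
  then show ?thesis using assms(2) m unfolding const_col_def by blast
qed

lemma Rbar_spin:
  assumes "\<sigma> \<in> Rbar K L 2 (K - 1) s u" shows "\<exists>v\<in>vertices K L. \<sigma> v = u"
proof -
  obtain m j where m: "m < K" and j: "j < L" and e: "\<forall>k<K. \<forall>l<L. \<sigma> (k, l) = (if (l = j \<or> l = Suc j mod L) \<and> k \<noteq> m then u else s)"
    using Rbar_two_cols[OF assms(1)] by blast
  obtain k where "k < K" "k \<noteq> m" using other_row by blast
  then have "\<sigma> (k, j) = u" "(k, j) \<in> vertices K L" using e m j by (auto simp: vertices_def)
  then show ?thesis by blast
qed

lemma connectivity_adjacent:
  assumes cf: "\<sigma> \<in> configs q K L" "\<sigma>' \<in> configs q K L" and pos: "connectivity q K L \<sigma> \<sigma>' > 0"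
  shows "adjacent \<sigma> \<sigma>'"
proof -
  let ?D = "{v \<in> vertices K L. \<sigma> v \<noteq> \<sigma>' v}"
  have fin: "finite ?D" by (simp add: vertices_def)
  have out: "\<sigma>' w = \<sigma> w" if "w \<notin> vertices K L" for w
    using cf that unfolding configs_def by (metis PiE_arb)
  have "card ?D \<le> 1" using pos unfolding connectivity_def Let_def by (auto split: if_splits)
  then obtain v where v: "v \<in> vertices K L" "?D \<subseteq> {v}"
  proof (cases "?D = {}")
    case True
    have "(0, 0) \<in> vertices K L" using K3 KL by (simp add: vertices_def)
    then show ?thesis using that True by blast
  next
    case False
    then obtain v where v: "v \<in> ?D" by blast
    have "card ?D \<le> Suc 0" using \<open>card ?D \<le> 1\<close> by (simp only: One_nat_def)
    from iffD1[OF card_le_Suc0_iff_eq[OF fin] this] have sub: "?D \<subseteq> {v}" using v by blast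
    have "v \<in> vertices K L" using v by simp
    then show ?thesis using sub by (rule that)
  qed
  have "\<sigma>' w = \<sigma> w" if "w \<noteq> v" for w
  proof (rule ccontr)
    assume n: "\<sigma>' w \<noteq> \<sigma> w"
    then have "w \<in> ?D" using out[of w] by auto
    then show False using v(2) that by blast
  qed
  then show ?thesis using v(1) unfolding adjacent_def vertices_def by (cases v) force
qed

lemma droplet_const_cols:
  assumes "droplet s u p 1 c b h \<sigma>" shows "const_col s \<sigma>" "const_col u \<sigma>"
proof -
  have p: "p < L" and e: "\<And>i j. i < K \<Longrightarrow> j < L \<Longrightarrow> \<sigma> (i, j) = (if j \<in> cyc_arc L p 1 \<or> j = c mod L \<and> i \<in> cyc_arc K b h then u else s)"
    using assms unfolding droplet_def by auto
  obtain l where l: "l < L" "l \<noteq> p" "l \<noteq> c mod L" using other_col by blast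
  have "cyc_arc L p 1 = {p}" using p by (simp add: arc_1)
  then have "\<forall>i<K. \<sigma> (i, l) = s" "\<forall>i<K. \<sigma> (i, p) = u" using e p l by simp_all
  then show "const_col s \<sigma>" "const_col u \<sigma>" using l(1) p unfolding const_col_def by blast+
qed

text \<open>Quotient and remainder of the number of sites by \<open>K\<close> are the width of the strip and the length of the bar.\<close>

lemma Bbar_of_spin_count:
  assumes "\<sigma> \<in> configs q K L" "low \<sigma>" "const_col s \<sigma>" "const_col u \<sigma>" "s \<noteq> u"
    and "spin_count u \<sigma> = a * K + h" "1 \<le> h" "h < K"
  shows "\<sigma> \<in> Bbar K L h a K s u"
proof -
  obtain p a' c b h' where d: "droplet s u p a' c b h' \<sigma>"
    using two_phase_droplet assms(2-5) by blast
  then have "a' * K + h' = a * K + h" "h' < K"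
    using droplet_spin_count[OF d assms(5)] assms(6) by (auto simp: droplet_def)
  then have "(a' * K + h') div K = (a * K + h) div K" "(a' * K + h') mod K = (a * K + h) mod K" by simp_all
  then have "a' = a" "h' = h" using \<open>h' < K\<close> assms(8) by simp_all
  then show ?thesis using droplet_Bbar[OF assms(1) d] assms(7) by simp
qed

lemma spin_count_sum:
  assumes "low \<sigma>" "const_col s \<sigma>" "const_col u \<sigma>" "s \<noteq> u"
  shows "spin_count s \<sigma> + spin_count u \<sigma> = K * L"
  using two_phase_droplet[OF assms] spin_count_total assms(4) by metis

text \<open>The strip regime is entered with a single column and an incomplete bar.\<close>

lemma entry_count:
  assumes "\<sigma> \<in> configs q K L" "low \<sigma>" "low \<sigma>'" "adjacent \<sigma> \<sigma>'"
    and "\<not> const_col u \<sigma>" "const_col s \<sigma>'" "const_col u \<sigma>'" "s \<noteq> u"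
  shows "spin_count u \<sigma>' + 1 \<le> 2 * K"
proof -
  obtain p c b h where d: "droplet s u p 1 c b h \<sigma>'" using entry_structure[OF assms] by metis
  then have "h < K" by (simp add: droplet_def)
  then show ?thesis using droplet_spin_count[OF d assms(8)] by simp
qed

definition low_path :: "nat \<Rightarrow> nat \<Rightarrow> config list \<Rightarrow> bool" where
  "low_path q r \<omega> \<longleftrightarrow> (\<forall>\<sigma>\<in>set \<omega>. low \<sigma>) \<and>
     (\<exists>t\<in>spins q - {r}. \<omega> \<in> paths q K L (const_config K L r) (const_config K L t))"

lemma const_config_const_col:
  "const_col s (const_config K L t) \<longleftrightarrow> s = t"
  using K3 KL unfolding const_col_def const_config_def vertices_def by fastforce

text \<open>To show that \<open>G\<close> is a gate it suffices to find a set \<open>A\<close> which low paths can leave only through \<open>G\<close>.\<close>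

lemma low_path_crossing:
  assumes \<omega>: "low_path q r \<omega>"
    and start: "const_config K L r \<in> A"
    and stop: "\<And>t. t \<in> spins q - {r} \<Longrightarrow> const_config K L t \<notin> A"
    and step: "\<And>\<sigma> \<sigma>'. \<sigma> \<in> configs q K L \<Longrightarrow> \<sigma>' \<in> configs q K L \<Longrightarrow> low \<sigma> \<Longrightarrow> low \<sigma>' \<Longrightarrow> adjacent \<sigma> \<sigma>'
      \<Longrightarrow> \<sigma> \<in> A \<Longrightarrow> \<sigma> \<notin> G \<Longrightarrow> \<sigma>' \<notin> G \<Longrightarrow> \<sigma>' \<in> A"
  shows "set \<omega> \<inter> G \<noteq> {}"
proof -
  obtain t where t: "t \<in> spins q - {r}" "\<omega> \<in> paths q K L (const_config K L r) (const_config K L t)"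
    using \<omega> unfolding low_path_def by blast
  then have p: "\<omega> \<noteq> []" "set \<omega> \<subseteq> configs q K L" "hd \<omega> = const_config K L r" "last \<omega> = const_config K L t"
    "\<And>i. Suc i < length \<omega> \<Longrightarrow> connectivity q K L (\<omega> ! i) (\<omega> ! Suc i) > 0"
    unfolding paths_def by auto
  show ?thesis
  proof (rule list_crossing[OF p(1)])
    fix i assume i: "Suc i < length \<omega>" "\<omega> ! i \<in> A" "\<omega> ! i \<notin> G"
    then have m: "\<omega> ! i \<in> set \<omega>" "\<omega> ! Suc i \<in> set \<omega>" by auto
    then have c: "\<omega> ! i \<in> configs q K L" "\<omega> ! Suc i \<in> configs q K L" using p(2) by auto
    show "\<omega> ! Suc i \<in> A \<union> G"
      using step[OF c _ _ connectivity_adjacent[OF c p(5)[OF i(1)]] i(2,3)] m \<omega>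
      unfolding low_path_def by blast
  qed (use p start stop t in auto)
qed

lemma const_config_phase: "phase r (const_config K L r)"
  by (rule phase_if_const_col) (simp_all add: const_config_const_col)

text \<open>In the strip regime the number of sites of spin \<open>t\<close> changes by at most one per flip. The regime is
entered from the phase of \<open>r\<close> with at most \<open>2 * K - 1\<close> of them and left towards the phase of \<open>t\<close>
with at most \<open>2 * K - 1\<close> sites of spin \<open>r\<close> remaining. So every value in between is attained.\<close>

lemma level_gate:
  assumes \<omega>: "low_path q r \<omega>" and n: "2 * K \<le> n + 1" "n + 2 * K \<le> K * L + 1"
  shows "\<exists>\<sigma>\<in>set \<omega>. \<exists>t\<in>spins q - {r}. const_col r \<sigma> \<and> const_col t \<sigma> \<and> spin_count t \<sigma> = n"
proof -
  define G where "G = {\<sigma>. \<exists>t\<in>spins q - {r}. const_col r \<sigma> \<and> const_col t \<sigma> \<and> spin_count t \<sigma> = n}"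
  define A where "A = {\<sigma>. phase r \<sigma> \<or> (\<exists>t\<in>spins q - {r}. const_col r \<sigma> \<and> const_col t \<sigma> \<and> spin_count t \<sigma> < n)}"
  have "set \<omega> \<inter> G \<noteq> {}"
  proof (rule low_path_crossing[OF \<omega>])
    show "const_config K L r \<in> A" by (simp add: A_def const_config_phase)
    show "const_config K L t \<notin> A" if "t \<in> spins q - {r}" for t
      using that const_config_const_col unfolding A_def phase_def by auto
  next
    fix \<sigma> \<sigma>' assume cf: "\<sigma> \<in> configs q K L" "\<sigma>' \<in> configs q K L" and low: "low \<sigma>" "low \<sigma>'"
      and adj: "adjacent \<sigma> \<sigma>'" and A: "\<sigma> \<in> A" and G: "\<sigma>' \<notin> G"
    show "\<sigma>' \<in> A"
    proof (cases "phase r \<sigma>")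
      case True
      show ?thesis
      proof (rule ccontr)
        assume "\<sigma>' \<notin> A"
        then have "\<not> phase r \<sigma>'" by (simp add: A_def)
        then obtain t where t: "t \<noteq> r" "const_col r \<sigma>'" "const_col t \<sigma>'"
          using phase_step[OF True low adj] by blast
        have "\<not> const_col t \<sigma>" using True t(1) unfolding phase_def by blast
        then have "spin_count t \<sigma>' \<le> n"
          using entry_count[OF cf(1) low adj _ t(2,3)] t(1) n(1) by force
        moreover have "t \<in> spins q" using const_col_spin[OF t(3) cf(2)] .
        ultimately show False using G \<open>\<sigma>' \<notin> A\<close> t unfolding A_def G_def by force
      qed
    next
      case False
      then obtain t where t: "t \<in> spins q - {r}" "const_col r \<sigma>" "const_col t \<sigma>" "spin_count t \<sigma> < n"
        using A unfolding A_def by blast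
      then have rt: "r \<noteq> t" by auto
      show ?thesis
        using two_phase_step[OF low adj t(2,3) rt]
      proof (elim disjE conjE)
        assume "const_col r \<sigma>'" "const_col t \<sigma>'"
        moreover have "spin_count t \<sigma>' \<le> n" using spin_count_adjacent[OF adj, of t] t(4) by simp
        ultimately show ?thesis using G t(1) unfolding A_def G_def by force
      next
        assume "phase r \<sigma>'" then show ?thesis by (simp add: A_def)
      next
        assume "const_col t \<sigma>'" "\<not> const_col r \<sigma>'"
        then have "spin_count r \<sigma> + 1 \<le> 2 * K"
          using entry_count[OF cf(2) low(2,1) adjacent_sym[OF adj] _ t(3,2)] rt by blast
        then show ?thesis using spin_count_sum[OF low(1) t(2,3) rt] t(4) n(2) by simp
      qed
    qed
  qed
  then show ?thesis unfolding G_def by blast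
qed

text \<open>The set \<open>A\<close> of \<open>low_path_crossing\<close> consists of the phase of \<open>r\<close> without the rectangles
\<open>Rbar K L 2 (K - 1) r t\<close>, and of the strips with fewer than \<open>K + i\<close> sites. From the phase of \<open>r\<close> one
gets behind the gate by completing a column next to a bar longer than \<open>i\<close>, hence by
\<open>entry_structure\<close> from the gate or from a rectangle. The rectangles belong to the gate if
\<open>i = K - 2\<close>; otherwise, by \<open>Rbar_step\<close>, they are reached only from the gate or from strips with
\<open>2 * K - 1\<close> sites, which lie behind it.\<close>

lemma bar_gate:
  assumes \<omega>: "low_path q r \<omega>" and i: "1 \<le> i" "i \<le> K - 2"
    and G1: "\<And>t. t \<in> spins q - {r} \<Longrightarrow> Bbar K L i 1 K r t \<subseteq> G"
    and G2: "\<And>t h. t \<in> spins q - {r} \<Longrightarrow> Suc i \<le> h \<Longrightarrow> h \<le> K - 2 \<Longrightarrow> Bbar K L h 1 (K - 1) r t \<subseteq> G"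
    and G3: "\<And>t. t \<in> spins q - {r} \<Longrightarrow> i = K - 2 \<Longrightarrow> Rbar K L 2 (K - 1) r t \<subseteq> G"
  shows "set \<omega> \<inter> G \<noteq> {}"
proof -
  define A where "A = {\<sigma>. phase r \<sigma> \<and> (\<forall>t\<in>spins q - {r}. \<sigma> \<notin> Rbar K L 2 (K - 1) r t)
    \<or> (\<exists>t\<in>spins q - {r}. const_col r \<sigma> \<and> const_col t \<sigma> \<and> spin_count t \<sigma> < K + i)}"
  have iK: "i < K" using i K3 by linarith
  have KL2: "K * L \<ge> 4 * K" using L4 by simp
  show ?thesis
  proof (rule low_path_crossing[OF \<omega>])
    have "const_config K L r \<notin> Rbar K L 2 (K - 1) r t" if "t \<in> spins q - {r}" for t
      using Rbar_spin[of "const_config K L r" r t] that by (auto simp: const_config_def)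
    then show "const_config K L r \<in> A" by (simp add: A_def const_config_phase)
    show "const_config K L t \<notin> A" if "t \<in> spins q - {r}" for t
      using that const_config_const_col unfolding A_def phase_def by auto
  next
    fix \<sigma> \<sigma>' assume cf: "\<sigma> \<in> configs q K L" "\<sigma>' \<in> configs q K L" and low: "low \<sigma>" "low \<sigma>'"
      and adj: "adjacent \<sigma> \<sigma>'" and A: "\<sigma> \<in> A" and G: "\<sigma> \<notin> G" "\<sigma>' \<notin> G"
    have no_rect: "\<sigma>' \<notin> Rbar K L 2 (K - 1) r t" if t: "t \<in> spins q - {r}" for t
    proof
      assume R: "\<sigma>' \<in> Rbar K L 2 (K - 1) r t"
      have rt: "r \<noteq> t" using t by auto
      have i2: "i < K - 2" using G3[OF t] R G(2) i(2) by (cases "i = K - 2") auto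
      from Rbar_step[OF cf(1) R rt adjacent_sym[OF adj] low(1)] show False
      proof (elim disjE exE)
        assume eq: "\<sigma> = \<sigma>'"
        then have "\<sigma> \<in> Rbar K L 2 (K - 1) r t" using R by simp
        moreover from this have "const_col t' \<sigma> \<Longrightarrow> t' = r" for t' by (rule Rbar_no_const_col)
        ultimately show False using A t unfolding A_def by blast
      next
        assume "\<sigma> \<in> Bbar K L (K - 2) 1 (K - 1) r t"
        then show False using G2[OF t, of "K - 2"] i2 G(1) by auto
      next
        fix p c b assume d: "droplet r t p 1 c b (K - 1) \<sigma>"
        have ct: "const_col r \<sigma>" "const_col t \<sigma>" using droplet_const_cols[OF d] by auto
        then have "\<not> phase r \<sigma>" using rt unfolding phase_def by metis
        then obtain t' where t': "t' \<in> spins q - {r}" "const_col t' \<sigma>" "spin_count t' \<sigma> < K + i"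
          using A unfolding A_def by blast
        then have "t' = t" using const_col_unique[OF low(1) ct rt t'(2)] by auto
        then show False using t'(3) droplet_spin_count[OF d rt] iK i2 by simp
      qed
    qed
    show "\<sigma>' \<in> A"
    proof (cases "phase r \<sigma>")
      case True
      have "\<sigma> \<notin> Rbar K L 2 (K - 1) r t" if t: "t \<in> spins q - {r}" for t
        using A True t unfolding A_def phase_def by blast
      note nR = this
      show ?thesis
      proof (rule ccontr)
        assume nA: "\<sigma>' \<notin> A"
        then have "\<not> phase r \<sigma>'" using no_rect by (simp add: A_def)
        then obtain t where t: "t \<noteq> r" "const_col r \<sigma>'" "const_col t \<sigma>'"
          using phase_step[OF True low adj] by blast
        have tq: "t \<in> spins q - {r}" using const_col_spin[OF t(3) cf(2)] t(1) by blast
        have nt: "\<not> const_col t \<sigma>" using True t(1) unfolding phase_def by blast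
        have rt: "r \<noteq> t" using t(1) by simp
        obtain p c b h where d: "droplet r t p 1 c b h \<sigma>'"
          "h = 0 \<or> h \<le> K - 2 \<and> \<sigma> \<in> Bbar K L h 1 (K - 1) r t \<or> \<sigma> \<in> Rbar K L 2 (K - 1) r t"
          using entry_structure[OF cf(1) low adj nt t(2,3) rt] by blast
        have n: "spin_count t \<sigma>' = K + h" using droplet_spin_count[OF d(1) rt] by simp
        then have "i \<le> h" using nA tq t unfolding A_def by force
        moreover have "i \<noteq> h"
          using droplet_Bbar[OF cf(2) d(1)] G1[OF tq] G(2) i(1) by auto
        ultimately have "Suc i \<le> h" by simp
        then show False using d(2) nR[OF tq] G2[OF tq] G(1) by auto
      qed
    next
      case False
      then obtain t where t: "t \<in> spins q - {r}" "const_col r \<sigma>" "const_col t \<sigma>" "spin_count t \<sigma> < K + i"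
        using A unfolding A_def by blast
      then have rt: "r \<noteq> t" by auto
      show ?thesis
        using two_phase_step[OF low adj t(2,3) rt]
      proof (elim disjE conjE)
        assume c: "const_col r \<sigma>'" "const_col t \<sigma>'"
        have "spin_count t \<sigma>' \<le> K + i" using spin_count_adjacent[OF adj, of t] t(4) by simp
        moreover have "spin_count t \<sigma>' \<noteq> K + i"
          using Bbar_of_spin_count[OF cf(2) low(2) c rt, of 1 i] G1[OF t(1)] G(2) i(1) iK by auto
        ultimately show ?thesis using c t(1) unfolding A_def by force
      next
        assume "phase r \<sigma>'" then show ?thesis using no_rect by (simp add: A_def)
      next
        assume "const_col t \<sigma>'" "\<not> const_col r \<sigma>'"
        then have "spin_count r \<sigma> + 1 \<le> 2 * K"
          using entry_count[OF cf(2) low(2,1) adjacent_sym[OF adj] _ t(3,2)] rt by blast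
        then show ?thesis using spin_count_sum[OF low(1) t(2,3) rt] t(4) KL2 iK by linarith
      qed
    qed
  qed
qed

text \<open>The same gates at the far end of the strip regime, with \<open>r\<close> as the vanishing spin: now the set that is
left only through the gate consists of the phase of \<open>r\<close>, the strips with more than \<open>K + i\<close> sites
of spin \<open>r\<close>, and the rectangles of spin \<open>r\<close>.\<close>

lemma bar_gate_reversed:
  assumes \<omega>: "low_path q r \<omega>" and i: "1 \<le> i" "i \<le> K - 2"
    and G1: "\<And>t. t \<in> spins q - {r} \<Longrightarrow> Bbar K L i 1 K t r \<subseteq> G"
    and G2: "\<And>t h. t \<in> spins q - {r} \<Longrightarrow> Suc i \<le> h \<Longrightarrow> h \<le> K - 2 \<Longrightarrow> Bbar K L h 1 (K - 1) t r \<subseteq> G"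
    and G3: "\<And>t. t \<in> spins q - {r} \<Longrightarrow> i = K - 2 \<Longrightarrow> Rbar K L 2 (K - 1) t r \<subseteq> G"
  shows "set \<omega> \<inter> G \<noteq> {}"
proof -
  define A where "A = {\<sigma>. phase r \<sigma>
    \<or> (\<exists>t\<in>spins q - {r}. const_col r \<sigma> \<and> const_col t \<sigma> \<and> K + i < spin_count r \<sigma>)
    \<or> (\<exists>t\<in>spins q - {r}. \<sigma> \<in> Rbar K L 2 (K - 1) t r)}"
  have iK: "i < K" using i K3 by linarith
  have KL2: "K * L \<ge> 4 * K" using L4 by simp
  show ?thesis
  proof (rule low_path_crossing[OF \<omega>])
    show "const_config K L r \<in> A" by (simp add: A_def const_config_phase)
    show "const_config K L t \<notin> A" if "t \<in> spins q - {r}" for t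
    proof -
      have "const_config K L t \<notin> Rbar K L 2 (K - 1) t' r" for t'
        using Rbar_spin[of "const_config K L t" t' r] that by (auto simp: const_config_def)
      then show ?thesis using that const_config_const_col unfolding A_def phase_def by auto
    qed
  next
    fix \<sigma> \<sigma>' assume cf: "\<sigma> \<in> configs q K L" "\<sigma>' \<in> configs q K L" and low: "low \<sigma>" "low \<sigma>'"
      and adj: "adjacent \<sigma> \<sigma>'" and A: "\<sigma> \<in> A" and G: "\<sigma> \<notin> G" "\<sigma>' \<notin> G"
    consider (ph) "phase r \<sigma>"
      | (two) t where "t \<in> spins q - {r}" "const_col r \<sigma>" "const_col t \<sigma>" "K + i < spin_count r \<sigma>"
      | (rect) t where "t \<in> spins q - {r}" "\<sigma> \<in> Rbar K L 2 (K - 1) t r"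
      using A unfolding A_def by blast
    then show "\<sigma>' \<in> A"
    proof cases
      case ph
      show ?thesis
      proof (cases "phase r \<sigma>'")
        case True then show ?thesis by (simp add: A_def)
      next
        case False
        then obtain t where t: "t \<noteq> r" "const_col r \<sigma>'" "const_col t \<sigma>'"
          using phase_step[OF ph low adj] by blast
        have tq: "t \<in> spins q - {r}" using const_col_spin[OF t(3) cf(2)] t(1) by blast
        have nt: "\<not> const_col t \<sigma>" using ph t(1) unfolding phase_def by blast
        have rt: "r \<noteq> t" using t(1) by simp
        have "spin_count t \<sigma>' + 1 \<le> 2 * K" using entry_count[OF cf(1) low adj nt t(2,3) rt] .
        then have "K + i < spin_count r \<sigma>'"
          using spin_count_sum[OF low(2) t(2,3) rt] KL2 iK by linarith
        then show ?thesis using tq t unfolding A_def by blast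
      qed
    next
      case two
      then have rt: "r \<noteq> t" by auto
      show ?thesis
        using two_phase_step[OF low adj two(2,3) rt]
      proof (elim disjE conjE)
        assume c: "const_col r \<sigma>'" "const_col t \<sigma>'"
        have "K + i \<le> spin_count r \<sigma>'"
          using spin_count_adjacent[OF adjacent_sym[OF adj], of r] two(4) by simp
        moreover have "spin_count r \<sigma>' \<noteq> K + i"
          using Bbar_of_spin_count[OF cf(2) low(2) c(2,1) rt[symmetric], of 1 i] G1[OF two(1)] G(2) i(1) iK by auto
        ultimately show ?thesis using c two(1) unfolding A_def by force
      next
        assume "phase r \<sigma>'" then show ?thesis by (simp add: A_def)
      next
        assume n: "const_col t \<sigma>'" "\<not> const_col r \<sigma>'"
        obtain p c b h where d: "droplet t r p 1 c b h \<sigma>"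
          "h = 0 \<or> h \<le> K - 2 \<and> \<sigma>' \<in> Bbar K L h 1 (K - 1) t r \<or> \<sigma>' \<in> Rbar K L 2 (K - 1) t r"
          using entry_structure[OF cf(2) low(2,1) adjacent_sym[OF adj] n(2) two(3,2) rt[symmetric]] by blast
        have "Suc i \<le> h" using droplet_spin_count[OF d(1) rt[symmetric]] two(4) by simp
        then have "\<sigma>' \<in> Rbar K L 2 (K - 1) t r" using d(2) G2[OF two(1)] G(2) by auto
        then show ?thesis using two(1) unfolding A_def by blast
      qed
    next
      case rect
      have rt: "t \<noteq> r" using rect(1) by auto
      have i2: "i < K - 2" using G3[OF rect(1)] rect(2) G(1) i(2) by (cases "i = K - 2") auto
      from Rbar_step[OF cf(2) rect(2) rt adj low(2)] show ?thesis
      proof (elim disjE exE)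
        assume "\<sigma>' = \<sigma>" then show ?thesis using A by simp
      next
        assume "\<sigma>' \<in> Bbar K L (K - 2) 1 (K - 1) t r"
        then show ?thesis using G2[OF rect(1), of "K - 2"] i2 G(2) by auto
      next
        fix p c b assume d: "droplet t r p 1 c b (K - 1) \<sigma>'"
        have "const_col t \<sigma>'" "const_col r \<sigma>'" using droplet_const_cols[OF d] by auto
        moreover have "K + i < spin_count r \<sigma>'" using droplet_spin_count[OF d rt] i2 by simp
        ultimately show ?thesis using rect(1) unfolding A_def by blast
      qed
    qed
  qed
qed

lemma Bbar_not_const:
  assumes "\<sigma> \<in> Bbar K L h 1 b s u" "s \<noteq> u" shows "\<sigma> \<noteq> const_config K L t"
proof
  assume \<sigma>: "\<sigma> = const_config K L t"
  have 0: "0 < K" "0 < L" using K3 KL by auto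
  obtain i j k c where B: "(i, j) \<in> vertices K L" "1 \<le> h" "h \<le> b - 1"
    "\<sigma> = two_spin_config K L s u (block K L i j 1 b \<union> block K L (i + k) c 1 h)"
    using assms(1) unfolding Bbar_def by blast
  have ij: "i < K" "j < L" using B(1) by (auto simp: vertices_def)
  obtain l where l: "l < L" "l \<noteq> j" "l \<noteq> c mod L" using other_col by blast
  have "(i + 0) mod K \<in> cyc_arc K i b" using B(2,3) unfolding cyc_arc_def by (intro imageI) simp
  then have "i \<in> cyc_arc K i b" using ij(1) by simp
  then have "\<sigma> (i, j) = u" using ij unfolding B(4) block_eq
    by (simp add: two_spin_config_def vertices_def arc_1)
  moreover have "\<sigma> (i, l) = s" using ij l unfolding B(4) block_eq
    by (simp add: two_spin_config_def vertices_def arc_1)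
  moreover have "\<sigma> (i, j) = \<sigma> (i, l)" using ij l unfolding \<sigma> const_config_def by (simp add: vertices_def)
  ultimately show False using assms(2) by simp
qed

lemma Rbar_not_const:
  assumes "\<sigma> \<in> Rbar K L 2 (K - 1) s u" "s \<noteq> u" shows "\<sigma> \<noteq> const_config K L t"
  using Rbar_no_const_col[OF assms(1)] Rbar_spin[OF assms(1)] assms(2) const_config_const_col
  by (auto simp: const_config_def)

section \<open>A reference path\<close>

text \<open>The first \<open>n\<close> sites are set to \<open>t\<close>, column by column and each column from row 0 on.\<close>

definition filling :: "nat \<Rightarrow> nat \<Rightarrow> nat \<Rightarrow> config" where
  "filling r t n = (\<lambda>(i, j)\<in>vertices K L. if j * K + i < n then t else r)"

lemma filling_apply:
  "i < K \<Longrightarrow> j < L \<Longrightarrow> filling r t n (i, j) = (if j * K + i < n then t else r)"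
  by (simp add: filling_def vertices_def)

text \<open>Each row is an initial segment of \<open>t\<close> followed by \<open>r\<close> and has at most two defects; only the column
that is being filled is not constant.\<close>

lemma low_filling: "low (filling r t n)"
proof -
  have 0: "0 < K" using K3 by simp
  have row: "row_defects (filling r t n) i \<le> 2" if i: "i < K" for i
  proof (rule cyc_defects_initial_segment)
    fix j assume j: "j < L"
    have "j < (n + K - 1 - i) div K \<longleftrightarrow> Suc j * K \<le> n + K - 1 - i"
      using less_eq_div_iff_mult_less_eq[OF 0, of "Suc j" "n + K - 1 - i"] by (simp add: Suc_le_eq)
    also have "\<dots> \<longleftrightarrow> j * K + i < n" using i by auto
    finally show "filling r t n (i, j) = (if j < (n + K - 1 - i) div K then t else r)"
      using filling_apply[OF i j] by simp
  qed
  have "(\<Sum>i<K. row_defects (filling r t n) i) \<le> (\<Sum>i<K. 2)" by (rule sum_mono) (simp add: row)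
  then have R: "(\<Sum>i<K. row_defects (filling r t n) i) \<le> 2 * K" by simp
  have col: "col_defects (filling r t n) j \<le> (if j = n div K then 2 else 0)" if j: "j < L" for j
  proof (cases "j = n div K")
    case True
    have "col_defects (filling r t n) j \<le> 2"
    proof (rule cyc_defects_initial_segment)
      fix i assume i: "i < K"
      have "j * K + i < n \<longleftrightarrow> i < n mod K"
      proof -
        have "j * K + n mod K = n" using div_mult_mod_eq[of n K] True by simp
        then show ?thesis by linarith
      qed
      then show "filling r t n (i, j) = (if i < n mod K then t else r)"
        using filling_apply[OF i j] by simp
    qed
    then show ?thesis using True by simp
  next
    case False
    have "col_defects (filling r t n) j = 0"
    proof (rule cyc_defects_const)
      fix i assume i: "i < K"
      have "j * K + i < n \<longleftrightarrow> j < n div K"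
      proof -
        have "j < n div K \<longleftrightarrow> Suc j * K \<le> n"
          using less_eq_div_iff_mult_less_eq[OF 0, of "Suc j" n] by (simp add: Suc_le_eq)
        moreover have "n div K < j \<longleftrightarrow> n < j * K"
          using div_less_iff_less_mult[OF 0, of n j] by simp
        ultimately show ?thesis using False i by auto
      qed
      then show "filling r t n (i, j) = (if j < n div K then t else r)"
        using filling_apply[OF i j] by simp
    qed
    then show ?thesis by simp
  qed
  have "(\<Sum>j<L. col_defects (filling r t n) j) \<le> (\<Sum>j<L. if j = n div K then 2 else 0)"
    by (rule sum_mono) (use col in simp)
  also have "\<dots> \<le> 2" by simp
  finally show ?thesis using R unfolding low_def excess_def by linarith
qed

lemma low_path_exists:
  assumes "r \<in> spins q" "t \<in> spins q - {r}"
  shows "\<exists>\<omega>. \<omega> \<in> paths q K L (const_config K L r) (const_config K L t) \<and> (\<forall>\<sigma>\<in>set \<omega>. low \<sigma>)"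
proof -
  define \<omega> where "\<omega> = map (filling r t) [0..<Suc (K * L)]"
  have 0: "0 < K" "0 < L" "0 < q" using K3 KL assms(1) by (auto simp: spins_def)
  have V: "vertices K L \<noteq> {}" using 0 by (auto simp: vertices_def)
  have first: "filling r t 0 = const_config K L r"
    unfolding filling_def const_config_def by (rule restrict_ext) auto
  have last: "filling r t (K * L) = const_config K L t"
    unfolding filling_def const_config_def
  proof (rule restrict_ext)
    fix v assume "v \<in> vertices K L"
    then obtain i j where ij: "v = (i, j)" "i < K" "j < L" by (auto simp: vertices_def)
    then have "j * K + i < Suc j * K" by simp
    also have "\<dots> \<le> L * K" using ij by (intro mult_le_mono1) simp
    finally show "(case v of (i, j) \<Rightarrow> if j * K + i < K * L then t else r) = t"
      using ij by (simp add: mult.commute)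
  qed
  have cf: "filling r t n \<in> configs q K L" for n
    using assms unfolding filling_def configs_def by (auto split: prod.splits)
  have step: "connectivity q K L (filling r t n) (filling r t (Suc n)) > 0" for n
  proof (rule connectivity_pos[OF 0(3) V])
    have "{v \<in> vertices K L. filling r t n v \<noteq> filling r t (Suc n) v} \<subseteq> {(n mod K, n div K)}"
    proof
      fix v assume v: "v \<in> {v \<in> vertices K L. filling r t n v \<noteq> filling r t (Suc n) v}"
      then obtain i j where ij: "v = (i, j)" "i < K" "j < L" by (auto simp: vertices_def)
      then have "j * K + i = n" using v filling_apply[OF ij(2,3)] by (auto split: if_splits)
      then show "v \<in> {(n mod K, n div K)}" using ij by auto
    qed
    then have "card {v \<in> vertices K L. filling r t n v \<noteq> filling r t (Suc n) v} \<le> card {(n mod K, n div K)}"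
      by (intro card_mono) auto
    then show "card {v \<in> vertices K L. filling r t n v \<noteq> filling r t (Suc n) v} \<le> 1" by simp
  qed
  have "\<omega> \<in> paths q K L (const_config K L r) (const_config K L t)"
    unfolding paths_def
  proof (intro CollectI conjI allI impI)
    show "hd \<omega> = const_config K L r" using first unfolding \<omega>_def by (simp add: hd_map del: upt_Suc)
    show "last \<omega> = const_config K L t" using last unfolding \<omega>_def by simp
    fix i assume "Suc i < length \<omega>"
    then show "connectivity q K L (\<omega> ! i) (\<omega> ! Suc i) > 0"
      using step[of i] unfolding \<omega>_def by (simp del: upt_Suc)
  qed (use cf in \<open>auto simp: \<omega>_def\<close>)
  moreover have "\<forall>\<sigma>\<in>set \<omega>. low \<sigma>" using low_filling by (auto simp: \<omega>_def)
  ultimately show ?thesis by blast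
qed

section \<open>The critical droplets as gates\<close>

lemma level_gate_hit:
  assumes "low_path q r \<omega>" "2 * K \<le> n + 1" "n + 2 * K \<le> K * L + 1"
    and W: "\<And>\<sigma> t. t \<in> spins q - {r} \<Longrightarrow> \<sigma> \<in> configs q K L \<Longrightarrow> low \<sigma> \<Longrightarrow> const_col r \<sigma> \<Longrightarrow> const_col t \<sigma>
      \<Longrightarrow> spin_count t \<sigma> = n \<Longrightarrow> \<sigma> \<in> W"
  shows "\<exists>\<sigma>\<in>set \<omega>. \<sigma> \<in> W \<and> \<sigma> \<notin> stable_configs q K L"
proof -
  obtain \<sigma> t where \<sigma>: "\<sigma> \<in> set \<omega>" "t \<in> spins q - {r}" "const_col r \<sigma>" "const_col t \<sigma>" "spin_count t \<sigma> = n"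
    using level_gate[OF assms(1-3)] by blast
  have "\<sigma> \<in> configs q K L" "low \<sigma>" using \<sigma>(1) assms(1) unfolding low_path_def paths_def by auto
  moreover have "\<sigma> \<notin> stable_configs q K L"
    using \<sigma>(2,3,4) const_config_const_col unfolding stable_configs_def by auto
  ultimately show ?thesis using \<sigma> W by blast
qed

lemma Pbar_hit:
  assumes "low_path q r \<omega>"
  shows "\<exists>\<sigma>\<in>set \<omega>. \<sigma> \<in> (\<Union>t\<in>spins q - {r}. Pbar K L r t) \<and> \<sigma> \<notin> stable_configs q K L"
proof (rule level_gate_hit[OF assms, of "2 * K - 1"])
  have "K * 4 \<le> K * L" by (rule mult_le_mono2[OF L4])
  then show "2 * K - 1 + 2 * K \<le> K * L + 1" by linarith
  fix \<sigma> t assume a: "t \<in> spins q - {r}" "\<sigma> \<in> configs q K L" "low \<sigma>" "const_col r \<sigma>" "const_col t \<sigma>"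
    "spin_count t \<sigma> = 2 * K - 1"
  have "\<sigma> \<in> Bbar K L (K - 1) 1 K r t"
    using a K3 by (intro Bbar_of_spin_count) auto
  then show "\<sigma> \<in> (\<Union>t\<in>spins q - {r}. Pbar K L r t)" using a(1) unfolding Pbar_def by blast
qed simp

text \<open>There are \<open>2 * K - 1\<close> sites of spin \<open>r\<close> left when there are \<open>K * L + 1 - 2 * K\<close> of spin \<open>t\<close>.\<close>

lemma Ptilde_hit:
  assumes "low_path q r \<omega>"
  shows "\<exists>\<sigma>\<in>set \<omega>. \<sigma> \<in> (\<Union>t\<in>spins q - {r}. Ptilde K L r t) \<and> \<sigma> \<notin> stable_configs q K L"
proof (rule level_gate_hit[OF assms, of "K * L + 1 - 2 * K"])
  have KL4: "K * 4 \<le> K * L" by (rule mult_le_mono2[OF L4])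
  then show "2 * K \<le> K * L + 1 - 2 * K + 1" "K * L + 1 - 2 * K + 2 * K \<le> K * L + 1" by linarith+
  fix \<sigma> t assume a: "t \<in> spins q - {r}" "\<sigma> \<in> configs q K L" "low \<sigma>" "const_col r \<sigma>" "const_col t \<sigma>"
    "spin_count t \<sigma> = K * L + 1 - 2 * K"
  have "spin_count r \<sigma> + spin_count t \<sigma> = K * L" using spin_count_sum[OF a(3-5)] a(1) by blast
  then have "spin_count r \<sigma> = 1 * K + (K - 1)" using a(6) KL4 K3 by linarith
  then have "\<sigma> \<in> Bbar K L (K - 1) 1 K t r"
    using a K3 by (intro Bbar_of_spin_count) auto
  then show "\<sigma> \<in> (\<Union>t\<in>spins q - {r}. Ptilde K L r t)" using a(1) unfolding Ptilde_def Btilde_def by blast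
qed

lemma Wgate_hit:
  assumes "low_path q r \<omega>" "2 \<le> j" "j \<le> L - 3" "1 \<le> h" "h \<le> K - 1"
  shows "\<exists>\<sigma>\<in>set \<omega>. \<sigma> \<in> (\<Union>t\<in>spins q - {r}. Wgate K L j h r t) \<and> \<sigma> \<notin> stable_configs q K L"
proof (rule level_gate_hit[OF assms(1), of "j * K + h"])
  have "2 * K \<le> j * K" using assms(2) by (rule mult_le_mono1)
  then show "2 * K \<le> j * K + h + 1" by linarith
  have "(j + 3) * K \<le> L * K" using assms(2,3) by (intro mult_le_mono1) linarith
  then show "j * K + h + 2 * K \<le> K * L + 1" using assms(5) K3 by (simp add: algebra_simps)
  fix \<sigma> t assume a: "t \<in> spins q - {r}" "\<sigma> \<in> configs q K L" "low \<sigma>" "const_col r \<sigma>" "const_col t \<sigma>"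
    "spin_count t \<sigma> = j * K + h"
  have "\<sigma> \<in> Bbar K L h j K r t"
    using a assms K3 by (intro Bbar_of_spin_count) auto
  then show "\<sigma> \<in> (\<Union>t\<in>spins q - {r}. Wgate K L j h r t)" using a(1) unfolding Wgate_def by blast
qed

lemma bar_gate_hit:
  assumes "set \<omega> \<inter> W \<noteq> {}" and W: "W \<subseteq> (\<Union>t\<in>spins q - {r}. X t)"
    and "\<And>t \<sigma> s. t \<in> spins q - {r} \<Longrightarrow> \<sigma> \<in> X t \<Longrightarrow> \<sigma> \<noteq> const_config K L s"
  shows "\<exists>\<sigma>\<in>set \<omega>. \<sigma> \<in> W \<and> \<sigma> \<notin> stable_configs q K L"
  using assms unfolding stable_configs_def by blast

lemma Qbar_hit:
  assumes "low_path q r \<omega>"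
  shows "\<exists>\<sigma>\<in>set \<omega>. \<sigma> \<in> (\<Union>t\<in>spins q - {r}. Qbar K L r t) \<and> \<sigma> \<notin> stable_configs q K L"
proof (rule bar_gate_hit[OF _ subset_refl])
  show "set \<omega> \<inter> (\<Union>t\<in>spins q - {r}. Qbar K L r t) \<noteq> {}"
    using K3 by (intro bar_gate[OF assms, of "K - 2"]) (auto simp: Qbar_def)
  show "\<sigma> \<noteq> const_config K L s" if "t \<in> spins q - {r}" "\<sigma> \<in> Qbar K L r t" for t \<sigma> s
    using that Bbar_not_const[of \<sigma> _ _ r t] Rbar_not_const[of \<sigma> r t] unfolding Qbar_def by blast
qed

lemma Qtilde_hit:
  assumes "low_path q r \<omega>"
  shows "\<exists>\<sigma>\<in>set \<omega>. \<sigma> \<in> (\<Union>t\<in>spins q - {r}. Qtilde K L r t) \<and> \<sigma> \<notin> stable_configs q K L"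
proof (rule bar_gate_hit[OF _ subset_refl])
  show "set \<omega> \<inter> (\<Union>t\<in>spins q - {r}. Qtilde K L r t) \<noteq> {}"
    using K3 by (intro bar_gate_reversed[OF assms, of "K - 2"]) (auto simp: Qtilde_def Btilde_def Rtilde_def)
  show "\<sigma> \<noteq> const_config K L s" if "t \<in> spins q - {r}" "\<sigma> \<in> Qtilde K L r t" for t \<sigma> s
    using that Bbar_not_const[of \<sigma> _ _ t r] Rbar_not_const[of \<sigma> t r]
    unfolding Qtilde_def Btilde_def Rtilde_def by blast
qed

lemma Hbar_hit:
  assumes "low_path q r \<omega>" "1 \<le> i" "i \<le> K - 3"
  shows "\<exists>\<sigma>\<in>set \<omega>. \<sigma> \<in> (\<Union>t\<in>spins q - {r}. Hbar K L i r t) \<and> \<sigma> \<notin> stable_configs q K L"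
proof (rule bar_gate_hit[OF _ subset_refl])
  have i: "i \<le> K - 2" "i \<noteq> K - 2" using assms by auto
  show "set \<omega> \<inter> (\<Union>t\<in>spins q - {r}. Hbar K L i r t) \<noteq> {}"
    using i by (intro bar_gate[OF assms(1,2) i(1)]) (auto simp: Hbar_def)
  show "\<sigma> \<noteq> const_config K L s" if "t \<in> spins q - {r}" "\<sigma> \<in> Hbar K L i r t" for t \<sigma> s
    using that Bbar_not_const[of \<sigma> _ _ r t] unfolding Hbar_def by blast
qed

lemma Htilde_hit:
  assumes "low_path q r \<omega>" "1 \<le> i" "i \<le> K - 3"
  shows "\<exists>\<sigma>\<in>set \<omega>. \<sigma> \<in> (\<Union>t\<in>spins q - {r}. Htilde K L i r t) \<and> \<sigma> \<notin> stable_configs q K L"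
proof (rule bar_gate_hit[OF _ subset_refl])
  have i: "i \<le> K - 2" "i \<noteq> K - 2" using assms by auto
  show "set \<omega> \<inter> (\<Union>t\<in>spins q - {r}. Htilde K L i r t) \<noteq> {}"
    using i by (intro bar_gate_reversed[OF assms(1,2) i(1)]) (auto simp: Htilde_def Btilde_def)
  show "\<sigma> \<noteq> const_config K L s" if "t \<in> spins q - {r}" "\<sigma> \<in> Htilde K L i r t" for t \<sigma> s
    using that Bbar_not_const[of \<sigma> _ _ t r] unfolding Htilde_def Btilde_def by blast
qed

end

section \<open>Minimal gates\<close>

lemma path_height_ge: "\<xi> \<in> set \<omega> \<Longrightarrow> energy K L \<xi> \<le> path_height K L \<omega>"
  unfolding path_height_def by (intro Max_ge) auto

lemma path_height_attained:
  assumes "\<omega> \<noteq> []" shows "\<exists>\<xi>\<in>set \<omega>. energy K L \<xi> = path_height K L \<omega>"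
proof -
  have "path_height K L \<omega> \<in> energy K L ` set \<omega>" unfolding path_height_def using assms by (intro Max_in) auto
  then show ?thesis by auto
qed

lemma finite_path_heights: "finite (path_height K L ` paths q K L \<sigma> \<tau>)"
proof (rule finite_subset)
  show "path_height K L ` paths q K L \<sigma> \<tau> \<subseteq> energy K L ` configs q K L"
  proof
    fix h assume "h \<in> path_height K L ` paths q K L \<sigma> \<tau>"
    then obtain \<omega> where \<omega>: "h = path_height K L \<omega>" "\<omega> \<noteq> []" "set \<omega> \<subseteq> configs q K L" by (auto simp: paths_def)
    then obtain \<xi> where "\<xi> \<in> set \<omega>" "energy K L \<xi> = h" using path_height_attained by metis
    then show "h \<in> energy K L ` configs q K L" using \<omega>(3) by auto
  qed
qed (simp add: finite_configs)

lemma comm_height_set_le: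
  assumes "finite A" "\<tau> \<in> A" "\<omega> \<in> paths q K L \<sigma> \<tau>"
  shows "comm_height_set q K L \<sigma> A \<le> path_height K L \<omega>"
proof -
  have "comm_height_set q K L \<sigma> A \<le> comm_height q K L \<sigma> \<tau>"
    unfolding comm_height_set_def using assms by (intro Min_le) auto
  also have "\<dots> \<le> path_height K L \<omega>"
    unfolding comm_height_def using assms finite_path_heights by (intro Min_le) auto
  finally show ?thesis .
qed

lemma opt_paths_nonempty:
  assumes "finite A" "A \<noteq> {}" "\<And>\<tau>. \<tau> \<in> A \<Longrightarrow> paths q K L \<sigma> \<tau> \<noteq> {}"
  shows "opt_paths q K L \<sigma> A \<noteq> {}"
proof -
  have "comm_height_set q K L \<sigma> A \<in> comm_height q K L \<sigma> ` A"
    unfolding comm_height_set_def using assms(1,2) by (intro Min_in) auto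
  then obtain \<tau> where \<tau>: "\<tau> \<in> A" "comm_height q K L \<sigma> \<tau> = comm_height_set q K L \<sigma> A" by auto
  have "comm_height q K L \<sigma> \<tau> \<in> path_height K L ` paths q K L \<sigma> \<tau>"
    unfolding comm_height_def using assms(3)[OF \<tau>(1)] finite_path_heights by (intro Min_in) auto
  then show ?thesis using \<tau> unfolding opt_paths_def by auto
qed

lemma all_min_gates_subset: "all_min_gates q K L \<sigma> A \<subseteq> saddles q K L \<sigma> A"
  unfolding all_min_gates_def minimal_gate_def gate_def by blast

text \<open>The saddles form a gate, and a gate with the least number of elements is minimal.\<close>

lemma minimal_gate_exists: "\<exists>W. minimal_gate q K L \<sigma> A W"
proof -
  have "saddles q K L \<sigma> A \<subseteq> configs q K L"
    unfolding saddles_def opt_paths_def paths_def by auto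
  then have fin: "finite (saddles q K L \<sigma> A)" using finite_configs finite_subset by blast
  have "gate q K L \<sigma> A (saddles q K L \<sigma> A)"
    unfolding gate_def
  proof (intro conjI ballI subset_refl)
    fix \<omega> assume \<omega>: "\<omega> \<in> opt_paths q K L \<sigma> A"
    then have "\<omega> \<noteq> []" by (auto simp: opt_paths_def paths_def)
    then obtain \<xi> where "\<xi> \<in> set \<omega>" "energy K L \<xi> = path_height K L \<omega>" using path_height_attained by metis
    then show "set \<omega> \<inter> saddles q K L \<sigma> A \<noteq> {}" using \<omega> unfolding saddles_def by blast
  qed
  then obtain W where W: "gate q K L \<sigma> A W" "\<And>W'. gate q K L \<sigma> A W' \<Longrightarrow> card W \<le> card W'"
    using ex_has_least_nat[of "gate q K L \<sigma> A" _ card] by blast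
  have finW: "finite W" using W(1) fin finite_subset unfolding gate_def by blast
  have "\<exists>\<omega>\<in>opt_paths q K L \<sigma> A. set \<omega> \<inter> W' = {}" if "W' \<subset> W" for W'
  proof -
    have "\<not> gate q K L \<sigma> A W'" using W(2)[of W'] psubset_card_mono[OF finW that] by linarith
    moreover have "W' \<subseteq> saddles q K L \<sigma> A" using that W(1) unfolding gate_def by blast
    ultimately show ?thesis unfolding gate_def by blast
  qed
  then show ?thesis using W(1) unfolding minimal_gate_def by blast
qed

lemma all_min_gates_hit:
  assumes "\<omega> \<in> opt_paths q K L \<sigma> A" shows "set \<omega> \<inter> all_min_gates q K L \<sigma> A \<noteq> {}"
proof -
  obtain W where W: "minimal_gate q K L \<sigma> A W" using minimal_gate_exists by blast
  then have "set \<omega> \<inter> W \<noteq> {}" using assms unfolding minimal_gate_def gate_def by blast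
  then show ?thesis using W unfolding all_min_gates_def by blast
qed

section \<open>The transition out of a monochromatic configuration\<close>

context torus
begin

abbreviation ground :: int where "ground \<equiv> - (2 * int K * int L)"

lemma energy_excess: "energy K L \<sigma> = ground + int (excess K L \<sigma>)"
  using energy_eq_excess[of K L \<sigma>] K3 KL by simp

lemma low_iff_energy: "low \<sigma> \<longleftrightarrow> energy K L \<sigma> \<le> ground + int (2 * K + 2)"
  unfolding energy_excess low_def by linarith

lemma energy_const_config: "energy K L (const_config K L s) = ground"
proof -
  have "row_defects (const_config K L s) i = 0" if "i < K" for i
    by (rule cyc_defects_const[of _ _ s]) (use that in \<open>simp add: const_config_def vertices_def\<close>)
  moreover have "col_defects (const_config K L s) j = 0" if "j < L" for j
    by (rule cyc_defects_const[of _ _ s]) (use that in \<open>simp add: const_config_def vertices_def\<close>)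
  ultimately show ?thesis unfolding energy_excess excess_def by simp
qed

lemma energy_above_ground:
  assumes \<sigma>: "\<sigma> \<in> configs q K L" "\<sigma> \<notin> stable_configs q K L"
  shows "ground < energy K L \<sigma>"
proof (rule ccontr)
  assume "\<not> ground < energy K L \<sigma>"
  then have "excess K L \<sigma> = 0" unfolding energy_excess by simp
  then have d: "row_defects \<sigma> i = 0" "col_defects \<sigma> j = 0" if "i < K" "j < L" for i j
    using that unfolding excess_def by auto
  have 0: "0 < K" "0 < L" using K3 KL by auto
  have const: "\<sigma> (i, j) = \<sigma> (0, 0)" if "i < K" "j < L" for i j
  proof -
    have "\<sigma> (i, j) = \<sigma> (i, 0)" using row_ge_2[OF that(2) 0(2), of \<sigma> i] d(1)[OF that] by linarith
    also have "\<dots> = \<sigma> (0, 0)" using col_ge_2[OF that(1) 0(1), of \<sigma> 0] d(2)[OF 0] by linarith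
    finally show ?thesis .
  qed
  have "\<sigma> = two_spin_config K L (\<sigma> (0, 0)) (\<sigma> (0, 0)) {}"
  proof (rule two_spin_configI[OF \<sigma>(1)])
    fix i j assume "i < K" "j < L"
    from const[OF this] show "\<sigma> (i, j) = (if (i, j) \<in> {} then \<sigma> (0, 0) else \<sigma> (0, 0))" by simp
  qed
  also have "\<dots> = const_config K L (\<sigma> (0, 0))" by (simp add: two_spin_config_def const_config_def)
  finally have "\<sigma> = const_config K L (\<sigma> (0, 0))" .
  moreover have "\<sigma> (0, 0) \<in> spins q"
    by (rule PiE_mem[OF \<sigma>(1)[unfolded configs_def]]) (simp add: vertices_def 0)
  ultimately show False using \<sigma>(2) unfolding stable_configs_def by blast
qed

lemma const_config_inj: "const_config K L s = const_config K L t \<Longrightarrow> s = t"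
  using const_config_const_col[of s s] const_config_const_col[of s t] by simp

lemma other_spin: "1 < q \<Longrightarrow> \<exists>t. t \<in> spins q - {r}"
  unfolding spins_def by (rule exI[of _ "if r = 1 then 2 else 1"]) auto

text \<open>The level \<open>\<Phi>\<close> is kept general because the explicit gates block all low paths, whereas minimal gates
are defined by the communication height.\<close>

lemma hit_whp:
  fixes M :: "real \<Rightarrow> 'w measure" and X :: "real \<Rightarrow> nat \<Rightarrow> 'w \<Rightarrow> config"
  defines "target \<equiv> \<lambda>q r. stable_configs q K L - {const_config K L r}"
  assumes q: "1 < q" and r: "r \<in> spins q"
    and X: "\<And>\<beta>. \<beta> > 0 \<Longrightarrow> metropolis_chain q K L \<beta> (const_config K L r) (M \<beta>) (X \<beta>)"
    and \<Phi>: "ground \<le> \<Phi>" and \<omega>0: "\<tau>0 \<in> target q r" "\<omega>0 \<in> paths q K L (const_config K L r) \<tau>0"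
      "\<And>\<xi>. \<xi> \<in> set \<omega>0 \<Longrightarrow> energy K L \<xi> \<le> \<Phi>"
    and gate: "\<And>\<omega> t. t \<in> spins q - {r} \<Longrightarrow> \<omega> \<in> paths q K L (const_config K L r) (const_config K L t)
      \<Longrightarrow> (\<And>\<xi>. \<xi> \<in> set \<omega> \<Longrightarrow> energy K L \<xi> \<le> \<Phi>) \<Longrightarrow> \<exists>\<xi>\<in>set \<omega>. \<xi> \<in> W \<and> \<xi> \<notin> stable_configs q K L"
  shows "((\<lambda>\<beta>. prob_hits_before (M \<beta>) (X \<beta>) W (target q r)) \<longlongrightarrow> 1) at_top"
proof -
  have targetE: "\<exists>t\<in>spins q - {r}. \<tau> = const_config K L t" if "\<tau> \<in> target q r" for \<tau>
    using that unfolding target_def stable_configs_def by auto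
  obtain t0 where t0: "t0 \<in> spins q - {r}" "\<tau>0 = const_config K L t0" using targetE \<omega>0(1) by blast
  have V: "vertices K L \<noteq> {}" using K3 KL by (auto simp: vertices_def)
  show ?thesis
  proof (rule gate_hit_whp[OF _ V _ _ _ _ \<omega>0 _ X])
    show "0 < q" using q by simp
    show "target q r \<subseteq> configs q K L"
      unfolding target_def stable_configs_def by (auto simp: const_config_def configs_def)
    show "const_config K L t0 \<in> target q r" using \<omega>0(1) t0(2) by simp
    show "t0 \<in> spins q" using t0 by simp
    show "energy K L \<tau> \<le> \<Phi>" if "\<tau> \<in> target q r" for \<tau>
      using targetE[OF that] energy_const_config \<Phi> by auto
    fix \<omega> \<tau> assume \<omega>: "\<tau> \<in> target q r" "\<omega> \<in> paths q K L (const_config K L r) \<tau>"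
      "\<And>\<xi>. \<xi> \<in> set \<omega> \<Longrightarrow> energy K L \<xi> \<le> \<Phi>"
    obtain t where t: "t \<in> spins q - {r}" "\<tau> = const_config K L t" using targetE[OF \<omega>(1)] by blast
    obtain \<xi> where \<xi>: "\<xi> \<in> set \<omega>" "\<xi> \<in> W" "\<xi> \<notin> stable_configs q K L"
      using gate[OF t(1) \<omega>(2)[unfolded t(2)] \<omega>(3)] by blast
    have "const_config K L r \<in> stable_configs q K L" using r by (simp add: stable_configs_def)
    then show "\<exists>\<xi>\<in>set \<omega>. \<xi> \<in> W \<and> \<xi> \<noteq> const_config K L r \<and> \<xi> \<notin> target q r"
      using \<xi> unfolding target_def by blast
  qed
qed

lemma low_gate_whp:
  fixes M :: "real \<Rightarrow> 'w measure" and X :: "real \<Rightarrow> nat \<Rightarrow> 'w \<Rightarrow> config"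
  assumes q: "1 < q" and r: "r \<in> spins q"
    and X: "\<And>\<beta>. \<beta> > 0 \<Longrightarrow> metropolis_chain q K L \<beta> (const_config K L r) (M \<beta>) (X \<beta>)"
    and gate: "\<And>\<omega>. low_path q r \<omega> \<Longrightarrow> \<exists>\<xi>\<in>set \<omega>. \<xi> \<in> W \<and> \<xi> \<notin> stable_configs q K L"
  shows "((\<lambda>\<beta>. prob_hits_before (M \<beta>) (X \<beta>) W (stable_configs q K L - {const_config K L r})) \<longlongrightarrow> 1) at_top"
proof -
  obtain t where t: "t \<in> spins q - {r}" using other_spin[OF q] by blast
  then obtain \<omega>0 where \<omega>0: "\<omega>0 \<in> paths q K L (const_config K L r) (const_config K L t)" "\<forall>\<sigma>\<in>set \<omega>0. low \<sigma>"
    using low_path_exists[OF r] by blast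
  show ?thesis
  proof (rule hit_whp[OF q r X, of "ground + int (2 * K + 2)" "const_config K L t" \<omega>0])
    show "const_config K L t \<in> stable_configs q K L - {const_config K L r}"
      using t const_config_inj[of t r] by (auto simp: stable_configs_def)
    show "energy K L \<xi> \<le> ground + int (2 * K + 2)" if "\<xi> \<in> set \<omega>0" for \<xi>
      using \<omega>0(2) that low_iff_energy by blast
    fix \<omega> t assume "t \<in> spins q - {r}" "\<omega> \<in> paths q K L (const_config K L r) (const_config K L t)"
      "\<And>\<xi>. \<xi> \<in> set \<omega> \<Longrightarrow> energy K L \<xi> \<le> ground + int (2 * K + 2)"
    then have "low_path q r \<omega>" unfolding low_path_def low_iff_energy by blast
    then show "\<exists>\<xi>\<in>set \<omega>. \<xi> \<in> W \<and> \<xi> \<notin> stable_configs q K L" by (rule gate)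
  qed (use \<omega>0 in auto)
qed

text \<open>At the level of the communication height, the paths from \<open>r\<close> to the target that stay below are exactly
the optimal ones, and each of them meets a minimal gate. What has to be checked is that this level
lies strictly above the ground states, so that saddles are not stable: an optimal path is low and
therefore contains a configuration of some \<open>Pbar K L r t\<close>, which is not stable.\<close>

lemma all_min_gates_whp:
  fixes M :: "real \<Rightarrow> 'w measure" and X :: "real \<Rightarrow> nat \<Rightarrow> 'w \<Rightarrow> config"
  defines "target \<equiv> \<lambda>q r. stable_configs q K L - {const_config K L r}"
  assumes q: "1 < q" and r: "r \<in> spins q"
    and X: "\<And>\<beta>. \<beta> > 0 \<Longrightarrow> metropolis_chain q K L \<beta> (const_config K L r) (M \<beta>) (X \<beta>)"
  shows "((\<lambda>\<beta>. prob_hits_before (M \<beta>) (X \<beta>)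
    (all_min_gates q K L (const_config K L r) (target q r)) (target q r)) \<longlongrightarrow> 1) at_top"
proof -
  let ?\<sigma> = "const_config K L r" and ?T = "target q r"
  define \<Phi> where "\<Phi> = comm_height_set q K L ?\<sigma> ?T"
  have targetI: "const_config K L t \<in> ?T" if "t \<in> spins q - {r}" for t
    using that const_config_inj[of t r] by (auto simp: target_def stable_configs_def)
  have targetE: "\<exists>t\<in>spins q - {r}. \<tau> = const_config K L t" if "\<tau> \<in> ?T" for \<tau>
    using that unfolding target_def stable_configs_def by auto
  have finT: "finite ?T" unfolding target_def stable_configs_def by (simp add: spins_def)
  obtain t where t: "t \<in> spins q - {r}" using other_spin[OF q] by blast
  have "?T \<noteq> {}" using targetI[OF t] by blast
  then have "opt_paths q K L ?\<sigma> ?T \<noteq> {}"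
    using finT targetE low_path_exists[OF r] by (intro opt_paths_nonempty) blast+
  then obtain \<omega>0 where \<omega>0: "\<omega>0 \<in> opt_paths q K L ?\<sigma> ?T" by blast
  then obtain \<tau>0 where \<tau>0: "\<tau>0 \<in> ?T" "\<omega>0 \<in> paths q K L ?\<sigma> \<tau>0" "path_height K L \<omega>0 = \<Phi>"
    unfolding opt_paths_def \<Phi>_def by blast
  have e0: "energy K L \<xi> \<le> \<Phi>" if "\<xi> \<in> set \<omega>0" for \<xi> using path_height_ge[OF that, of K L] \<tau>0(3) by simp
  \<comment> \<open>the reference path bounds the communication height, so that optimal paths are low\<close>
  obtain \<omega>1 where \<omega>1: "\<omega>1 \<in> paths q K L ?\<sigma> (const_config K L t)" "\<forall>\<sigma>\<in>set \<omega>1. low \<sigma>"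
    using low_path_exists[OF r t] by blast
  have "\<omega>1 \<noteq> []" using \<omega>1(1) by (simp add: paths_def)
  then obtain \<xi>1 where "\<xi>1 \<in> set \<omega>1" "energy K L \<xi>1 = path_height K L \<omega>1" using path_height_attained by metis
  then have \<Phi>_le: "\<Phi> \<le> ground + int (2 * K + 2)"
    using comm_height_set_le[OF finT targetI[OF t] \<omega>1(1)] \<omega>1(2) unfolding low_iff_energy \<Phi>_def by fastforce
  obtain t' where t': "t' \<in> spins q - {r}" "\<tau>0 = const_config K L t'" using targetE[OF \<tau>0(1)] by blast
  have "low_path q r \<omega>0"
    unfolding low_path_def low_iff_energy using e0 \<Phi>_le \<tau>0(2) t' by force
  then obtain \<xi>0 where \<xi>0: "\<xi>0 \<in> set \<omega>0" "\<xi>0 \<notin> stable_configs q K L" using Pbar_hit by blast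
  have "\<xi>0 \<in> configs q K L" using \<xi>0(1) \<tau>0(2) by (auto simp: paths_def)
  then have \<Phi>_gt: "ground < \<Phi>" using energy_above_ground[OF _ \<xi>0(2)] e0[OF \<xi>0(1)] by fastforce
  show ?thesis
    unfolding target_def
  proof (rule hit_whp[OF q r X, of \<Phi> \<tau>0 \<omega>0])
    fix \<omega> t assume \<omega>: "t \<in> spins q - {r}" "\<omega> \<in> paths q K L ?\<sigma> (const_config K L t)"
      "\<And>\<xi>. \<xi> \<in> set \<omega> \<Longrightarrow> energy K L \<xi> \<le> \<Phi>"
    have "\<omega> \<noteq> []" using \<omega>(2) by (simp add: paths_def)
    then obtain \<xi>1 where "\<xi>1 \<in> set \<omega>" "energy K L \<xi>1 = path_height K L \<omega>" using path_height_attained by metis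
    then have "path_height K L \<omega> = \<Phi>"
      using \<omega>(3) comm_height_set_le[OF finT targetI[OF \<omega>(1)] \<omega>(2)] unfolding \<Phi>_def by fastforce
    then have "\<omega> \<in> opt_paths q K L ?\<sigma> ?T"
      using targetI[OF \<omega>(1)] \<omega>(2) unfolding opt_paths_def \<Phi>_def by blast
    then obtain \<xi> where \<xi>: "\<xi> \<in> set \<omega>" "\<xi> \<in> all_min_gates q K L ?\<sigma> ?T"
      using all_min_gates_hit by blast
    then have "energy K L \<xi> = \<Phi>"
      using all_min_gates_subset unfolding saddles_def opt_paths_def \<Phi>_def by fastforce
    then have "\<xi> \<notin> stable_configs q K L" using \<Phi>_gt energy_const_config unfolding stable_configs_def by auto
    then show "\<exists>\<xi>\<in>set \<omega>. \<xi> \<in> all_min_gates q K L ?\<sigma> (stable_configs q K L - {?\<sigma>}) \<and> \<xi> \<notin> stable_configs q K L"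
      using \<xi> unfolding target_def by blast
  qed (use \<Phi>_gt \<tau>0 e0 in \<open>auto simp: target_def\<close>)
qed

end

theorem corollary3p2:
  fixes q K L r :: nat
    and M :: "real \<Rightarrow> 'w measure"
    and X :: "real \<Rightarrow> nat \<Rightarrow> 'w \<Rightarrow> config"
  assumes "q > 2" and "K \<ge> 3" and "K < L" and "L \<ge> 3"
    and "r \<in> spins q"
    and "\<And>\<beta>. \<beta> > 0 \<Longrightarrow> metropolis_chain q K L \<beta> (const_config K L r) (M \<beta>) (X \<beta>)"
  defines "target \<equiv> stable_configs q K L - {const_config K L r}"
  defines "hit_first_whp \<equiv>
    (\<lambda>W. ((\<lambda>\<beta>. prob_hits_before (M \<beta>) (X \<beta>) W target) \<longlongrightarrow> 1) at_top)"
  shows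
    "(hit_first_whp (\<Union>t\<in>spins q - {r}. Pbar K L r t) \<and>
      hit_first_whp (\<Union>t\<in>spins q - {r}. Ptilde K L r t)) \<and>
     (hit_first_whp (\<Union>t\<in>spins q - {r}. Qbar K L r t) \<and>
      hit_first_whp (\<Union>t\<in>spins q - {r}. Qtilde K L r t)) \<and>
     (\<forall>i\<in>{1..K - 3}.
        hit_first_whp (\<Union>t\<in>spins q - {r}. Hbar K L i r t) \<and>
        hit_first_whp (\<Union>t\<in>spins q - {r}. Htilde K L i r t)) \<and>
     (\<forall>j\<in>{2..L - 3}. \<forall>h\<in>{1..K - 1}.
        hit_first_whp (\<Union>t\<in>spins q - {r}. Wgate K L j h r t)) \<and>
     hit_first_whp (all_min_gates q K L (const_config K L r) target)"
proof -
  interpret torus K L using assms(2,3) by unfold_locales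
  have q: "1 < q" using assms(1) by simp
  have whp: "hit_first_whp W"
    if "\<And>\<omega>. low_path q r \<omega> \<Longrightarrow> \<exists>\<xi>\<in>set \<omega>. \<xi> \<in> W \<and> \<xi> \<notin> stable_configs q K L" for W
    unfolding hit_first_whp_def target_def by (rule low_gate_whp[OF q assms(5,6) that])
  show ?thesis
  proof (intro conjI ballI)
    show "hit_first_whp (\<Union>t\<in>spins q - {r}. Pbar K L r t)"
      "hit_first_whp (\<Union>t\<in>spins q - {r}. Ptilde K L r t)"
      "hit_first_whp (\<Union>t\<in>spins q - {r}. Qbar K L r t)"
      "hit_first_whp (\<Union>t\<in>spins q - {r}. Qtilde K L r t)"
      by (rule whp, erule Pbar_hit Ptilde_hit Qbar_hit Qtilde_hit)+
    show "hit_first_whp (\<Union>t\<in>spins q - {r}. Hbar K L i r t)"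
      "hit_first_whp (\<Union>t\<in>spins q - {r}. Htilde K L i r t)" if "i \<in> {1..K - 3}" for i
      by (rule whp, erule Hbar_hit Htilde_hit; use that in simp)+
    show "hit_first_whp (\<Union>t\<in>spins q - {r}. Wgate K L j h r t)"
      if "j \<in> {2..L - 3}" "h \<in> {1..K - 1}" for j h
      by (rule whp, erule Wgate_hit; use that in simp)
    show "hit_first_whp (all_min_gates q K L (const_config K L r) target)"
      unfolding hit_first_whp_def target_def by (rule all_min_gates_whp[OF q assms(5,6)])
  qed
qed

end
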